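(* Let $V,\gamma,\beta,\lambda,\theta,\bar\theta$ be as in the context. There exist $h_0>0$ and an integer $m\ge0$ such that $0<(G_h\psi)(y,w)<\infty$ for all $0<h\le h_0$ and all $(y,w)\in\mathbb R^{2d}$ (so that $\mathcal K_h$ is defined for $0<h\le h_0$), and such that, with $W_{+,2m}(x,v):=(1+|x|+|v|)^{2m}W(x,v)^2W_+(x,v)$, the following holds. For every $T>0$ there exist $h_T\in(0,\min\{h_0,T\}]$ and a constant $C_T>0$ such that for every $f\in C_W^4(\mathbb R^{2d})$, every probability density $\rho$ on $\mathbb R^{2d}$ satisfying $m_{W_{+,2m}}(\rho)<\infty$, and every $h\in(0,h_T]$, $$\left|\int_{\mathbb R^{2d}}\left[f\,(\mathcal K_h\rho)-f\rho-h(\mathcal Lf)\rho\right]dx\,dv\right|\le C_Th^2\|f\|_{C_W^4}\,m_{W_{+,2m}}(\rho).$$ In particular, on sets of probability densities with uniformly bounded $W_{+,2m}$-moment, $\mathcal K_h$ is weakly consistent with the adjoint $\mathcal L^*$, with one-step consistency residual (the left-hand side above) of order $h^2$.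
   Context: Phase space: $z=(x,v)\in\mathbb R^d\times\mathbb R^d=\mathbb R^{2d}$. Constants $\gamma>0$, $\beta>0$, $\lambda>0$, $0<\theta<\bar\theta$ are fixed. The potential $V\in C^3(\mathbb R^d)$ is bounded from below, $\|D^2V\|_{L^\infty(\mathbb R^d)}<\infty$, and for every multi-index $\mu$ with $|\mu|=3$ there are $C_\mu,m_\mu\ge0$ with $|D^\mu V(x)|\le C_\mu(1+|x|)^{m_\mu}$. Weights: $W(x,v):=\exp(\theta(1+|x|^2+|v|^2))$, $W_+(x,v):=\exp(\bar\theta(1+|x|^2+|v|^2))$. For a weight $\omega:\mathbb R^{2d}\to[1,\infty)$: $\|g\|_{L^\infty_\omega}:=\sup_{z}|g(z)|/\omega(z)$; $C_\omega^k(\mathbb R^{2d}):=\{f\in C^k(\mathbb R^{2d}):\|f\|_{C_\omega^k}:=\sum_{|\alpha|\le k}\|\partial^\alpha f\|_{L^\infty_\omega}<\infty\}$; $m_\omega(\rho):=\int_{\mathbb R^{2d}}\omega\rho\,dx\,dv$ for a density $\rho$. Functions: $\phi^\lambda_{\mathrm{ki}}(x,v):=\lambda V(x)+\frac{\beta}{\gamma}v\cdot\nabla_xV(x)+\frac{\beta}{2}|v|^2$, $\psi:=e^{-\phi^\lambda_{\mathrm{ki}}/2}$, $U(x,v):=\nabla_xV(x)+\gamma v$. Operators: $D_0f:=v\cdot\nabla_xf+\gamma\beta^{-1}\Delta_vf$ and $\mathcal Lf:=D_0f-U\cdot\nabla_vf$, with formal $L^2$-adjoint $\mathcal L^*\rho=-v\cdot\nabla_x\rho+\gamma\beta^{-1}\Delta_v\rho+\nabla_v\cdot((\nabla_xV+\gamma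 v)\rho)$. Kernel: for $h>0$, $$G_h(x,v\mid y,w)=\frac{3^{d/2}(\beta/\gamma)^d}{(2\pi h^2)^d}\exp\!\left(-\frac{3\beta}{\gamma h^3}\left\|x-y-\tfrac h2(v+w)\right\|^2-\frac{\beta}{4\gamma h}\|v-w\|^2\right),$$ and $(G_hg)(y,w):=\int_{\mathbb R^{2d}}G_h(x,v\mid y,w)g(x,v)\,dx\,dv$. One-step kinetic kernel operator (for $\rho\in L^1(\mathbb R^{2d})$, $\rho\ge0$, and $h$ with $0<G_h\psi<\infty$ everywhere): $$(\mathcal K_h\rho)(x,v):=\psi(x,v)\int_{\mathbb R^{2d}}G_h(x,v\mid y,w)\frac{\rho(y,w)}{(G_h\psi)(y,w)}\,dy\,dw.$$ *)

theory Defs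
  imports "HOL-Analysis.Analysis" "HOL-Library.Multiset"
begin

definition partial_deriv :: "'a::euclidean_space \<Rightarrow> ('a \<Rightarrow> real) \<Rightarrow> 'a \<Rightarrow> real" where
  "partial_deriv b f x = frechet_derivative f (at x) b"

text \<open>
  A function is of class $C^{k+1}$ iff it is differentiable and all its first-order partial
  derivatives are of class $C^k$.
\<close>

fun C_k :: "nat \<Rightarrow> ('a::euclidean_space \<Rightarrow> real) \<Rightarrow> bool" where
  "C_k 0 f \<longleftrightarrow> continuous_on UNIV f"
| "C_k (Suc k) f \<longleftrightarrow> f differentiable_on UNIV \<and> (\<forall>b\<in>Basis. C_k k (partial_deriv b f))"

text \<open>
  A multi-index \<open>\<alpha>\<close> is encoded as the multiset that contains each coordinate direction
  \<open>b \<in> Basis\<close> exactly \<open>\<alpha>\<^sub>b\<close> times, so that \<open>|\<alpha>|\<close> is \<open>size \<alpha>\<close>.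
  The derivative \<open>\<partial>\<^sup>\<alpha> f\<close> takes the partial derivatives in some fixed order;
  for \<open>f\<close> of class $C^k$ with \<open>size \<alpha> \<le> k\<close> the order is immaterial (Schwarz).
\<close>

definition multi_indices :: "nat \<Rightarrow> 'a::euclidean_space multiset set" where
  "multi_indices k = {\<alpha>. set_mset \<alpha> \<subseteq> Basis \<and> size \<alpha> \<le> k}"

definition multi_deriv :: "'a::euclidean_space multiset \<Rightarrow> ('a \<Rightarrow> real) \<Rightarrow> 'a \<Rightarrow> real" where
  "multi_deriv \<alpha> f = foldr partial_deriv (SOME bs. mset bs = \<alpha>) f"

lemma finite_multi_indices: "finite (multi_indices k :: 'a::euclidean_space multiset set)"
proof (rule finite_subset)
  show "(multi_indices k :: 'a multiset set) \<subseteq> mset ` {bs. set bs \<subseteq> Basis \<and> length bs \<le> k}"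
  proof
    fix \<alpha> :: "'a multiset"
    assume "\<alpha> \<in> multi_indices k"
    moreover obtain bs where "\<alpha> = mset bs"
      by (metis ex_mset)
    ultimately show "\<alpha> \<in> mset ` {bs. set bs \<subseteq> Basis \<and> length bs \<le> k}"
      by (auto simp: multi_indices_def)
  qed
  show "finite (mset ` {bs. set bs \<subseteq> (Basis :: 'a set) \<and> length bs \<le> k})"
    by (intro finite_imageI finite_lists_length_le finite_Basis)
qed

definition grad :: "('a::euclidean_space \<Rightarrow> real) \<Rightarrow> 'a \<Rightarrow> 'a" where
  "grad f x = (\<Sum>b\<in>Basis. partial_deriv b f x *\<^sub>R b)"

definition laplacian :: "('a::euclidean_space \<Rightarrow> real) \<Rightarrow> 'a \<Rightarrow> real" where
  "laplacian f x = (\<Sum>b\<in>Basis. partial_deriv b (partial_deriv b f) x)"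

definition hessian :: "(real^'n \<Rightarrow> real) \<Rightarrow> real^'n \<Rightarrow> real^'n^'n" where
  "hessian f x = (\<chi> i j. partial_deriv (axis i 1) (partial_deriv (axis j 1) f) x)"

type_synonym 'n phase = "(real^'n) \<times> (real^'n)"

definition weight :: "real \<Rightarrow> 'n::finite phase \<Rightarrow> real" where
  "weight \<theta> = (\<lambda>(x, v). exp (\<theta> * (1 + (norm x)\<^sup>2 + (norm v)\<^sup>2)))"

definition weight_plus :: "real \<Rightarrow> real \<Rightarrow> nat \<Rightarrow> 'n::finite phase \<Rightarrow> real" where
  "weight_plus \<theta> \<theta>' k = (\<lambda>(x, v).
     (1 + norm x + norm v) ^ k * (weight \<theta> (x, v))\<^sup>2 * weight \<theta>' (x, v))"

definition Linf_norm :: "('a \<Rightarrow> real) \<Rightarrow> ('a \<Rightarrow> real) \<Rightarrow> ennreal" where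
  "Linf_norm \<omega> g = (SUP z. ennreal (\<bar>g z\<bar> / \<omega> z))"

definition Ck_norm :: "nat \<Rightarrow> ('a::euclidean_space \<Rightarrow> real) \<Rightarrow> ('a \<Rightarrow> real) \<Rightarrow> ennreal" where
  "Ck_norm k \<omega> f = (\<Sum>\<alpha>\<in>multi_indices k. Linf_norm \<omega> (multi_deriv \<alpha> f))"

definition Ck_space :: "nat \<Rightarrow> ('a::euclidean_space \<Rightarrow> real) \<Rightarrow> ('a \<Rightarrow> real) set" where
  "Ck_space k \<omega> = {f. C_k k f \<and> Ck_norm k \<omega> f < \<infinity>}"

definition prob_density :: "('a::euclidean_space \<Rightarrow> real) \<Rightarrow> bool" where
  "prob_density \<rho> \<longleftrightarrow> integrable lborel \<rho> \<and> (\<forall>z. 0 \<le> \<rho> z) \<and> (\<integral>z. \<rho> z \<partial>lborel) = 1"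

definition moment :: "('a::euclidean_space \<Rightarrow> real) \<Rightarrow> ('a \<Rightarrow> real) \<Rightarrow> ennreal" where
  "moment \<omega> \<rho> = (\<integral>\<^sup>+z. ennreal (\<omega> z * \<rho> z) \<partial>lborel)"

definition phi_ki :: "(real^'n \<Rightarrow> real) \<Rightarrow> real \<Rightarrow> real \<Rightarrow> real \<Rightarrow> 'n::finite phase \<Rightarrow> real" where
  "phi_ki V \<gamma> \<beta> l = (\<lambda>(x, v). l * V x + \<beta> / \<gamma> * (v \<bullet> grad V x) + \<beta> / 2 * (norm v)\<^sup>2)"

definition psi :: "(real^'n \<Rightarrow> real) \<Rightarrow> real \<Rightarrow> real \<Rightarrow> real \<Rightarrow> 'n::finite phase \<Rightarrow> real" where
  "psi V \<gamma> \<beta> l z = exp (- phi_ki V \<gamma> \<beta> l z / 2)"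

definition drift :: "(real^'n \<Rightarrow> real) \<Rightarrow> real \<Rightarrow> 'n::finite phase \<Rightarrow> real^'n" where
  "drift V \<gamma> = (\<lambda>(x, v). grad V x + \<gamma> *\<^sub>R v)"

definition D0 :: "real \<Rightarrow> real \<Rightarrow> ('n::finite phase \<Rightarrow> real) \<Rightarrow> 'n phase \<Rightarrow> real" where
  "D0 \<gamma> \<beta> f = (\<lambda>(x, v).
     v \<bullet> grad (\<lambda>x'. f (x', v)) x + \<gamma> / \<beta> * laplacian (\<lambda>v'. f (x, v')) v)"

definition kinetic_generator ::
  "(real^'n \<Rightarrow> real) \<Rightarrow> real \<Rightarrow> real \<Rightarrow> ('n::finite phase \<Rightarrow> real) \<Rightarrow> 'n phase \<Rightarrow> real" where
  "kinetic_generator V \<gamma> \<beta> f = (\<lambda>(x, v).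
     D0 \<gamma> \<beta> f (x, v) - drift V \<gamma> (x, v) \<bullet> grad (\<lambda>v'. f (x, v')) v)"

text \<open>\<open>G_kernel \<gamma> \<beta> h (x, v) (y, w)\<close> is $G_h(x,v \mid y,w)$.\<close>

definition G_kernel :: "real \<Rightarrow> real \<Rightarrow> real \<Rightarrow> 'n::finite phase \<Rightarrow> 'n phase \<Rightarrow> real" where
  "G_kernel \<gamma> \<beta> h = (\<lambda>(x, v) (y, w).
     3 powr (real CARD('n) / 2) * (\<beta> / \<gamma>) ^ CARD('n) / (2 * pi * h\<^sup>2) ^ CARD('n) *
     exp (- (3 * \<beta> / (\<gamma> * h ^ 3)) * (norm (x - y - (h / 2) *\<^sub>R (v + w)))\<^sup>2
          - \<beta> / (4 * \<gamma> * h) * (norm (v - w))\<^sup>2))"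

text \<open>
  For nonnegative \<open>g\<close> (the only case needed) $G_h g$ is an extended nonnegative real, so that
  its finiteness is a genuine assertion.
\<close>

definition G_op :: "real \<Rightarrow> real \<Rightarrow> real \<Rightarrow> ('n::finite phase \<Rightarrow> real) \<Rightarrow> 'n phase \<Rightarrow> ennreal" where
  "G_op \<gamma> \<beta> h g yw = (\<integral>\<^sup>+z. ennreal (G_kernel \<gamma> \<beta> h z yw * g z) \<partial>lborel)"

definition K_integrand :: "(real^'n \<Rightarrow> real) \<Rightarrow> real \<Rightarrow> real \<Rightarrow> real \<Rightarrow> real \<Rightarrow>
    ('n::finite phase \<Rightarrow> real) \<Rightarrow> 'n phase \<Rightarrow> 'n phase \<Rightarrow> real" where
  "K_integrand V \<gamma> \<beta> l h \<rho> z yw =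
     G_kernel \<gamma> \<beta> h z yw * (\<rho> yw / enn2real (G_op \<gamma> \<beta> h (psi V \<gamma> \<beta> l) yw))"

definition K_op :: "(real^'n \<Rightarrow> real) \<Rightarrow> real \<Rightarrow> real \<Rightarrow> real \<Rightarrow> real \<Rightarrow>
    ('n::finite phase \<Rightarrow> real) \<Rightarrow> 'n phase \<Rightarrow> real" where
  "K_op V \<gamma> \<beta> l h \<rho> z = psi V \<gamma> \<beta> l z * (\<integral>yw. K_integrand V \<gamma> \<beta> l h \<rho> z yw \<partial>lborel)"

text \<open>
  The densities carry no regularity, so the adjoint acts on them in the weak sense:
  \<open>weak_adjoint A \<rho> f\<close> is the pairing $\langle A^*\rho, f\rangle = \int (A f)\,\rho$. For the
  kinetic generator this is the distributional form of
  $-v\cdot\nabla_x\rho + \gamma\beta^{-1}\Delta_v\rho + \nabla_v\cdot((\nabla_x V+\gamma v)\rho)$. A family of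
  one-step operators \<open>K h\<close> is weakly consistent with $A^*$ on a set \<open>P\<close> of densities if
  $(K_h\rho - \rho)/h \to A^*\rho$ as $h \downarrow 0$, tested against each \<open>f \<in> F\<close>,
  uniformly in \<open>\<rho> \<in> P\<close>.
\<close>

definition weak_adjoint :: "(('a::euclidean_space \<Rightarrow> real) \<Rightarrow> 'a \<Rightarrow> real) \<Rightarrow>
    ('a \<Rightarrow> real) \<Rightarrow> ('a \<Rightarrow> real) \<Rightarrow> real" where
  "weak_adjoint A \<rho> f = (\<integral>z. A f z * \<rho> z \<partial>lborel)"

definition weakly_consistent :: "(real \<Rightarrow> ('a::euclidean_space \<Rightarrow> real) \<Rightarrow> 'a \<Rightarrow> real) \<Rightarrow>
    (('a \<Rightarrow> real) \<Rightarrow> 'a \<Rightarrow> real) \<Rightarrow> ('a \<Rightarrow> real) set \<Rightarrow> ('a \<Rightarrow> real) set \<Rightarrow> bool" where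
  "weakly_consistent K A F P \<longleftrightarrow> (\<forall>f\<in>F. uniform_limit P
     (\<lambda>h \<rho>. ((\<integral>z. f z * K h \<rho> z \<partial>lborel) - (\<integral>z. f z * \<rho> z \<partial>lborel)) / h)
     (\<lambda>\<rho>. weak_adjoint A \<rho> f) (at_right 0))"

definition consistency_residual :: "(real \<Rightarrow> ('a::euclidean_space \<Rightarrow> real) \<Rightarrow> 'a \<Rightarrow> real) \<Rightarrow>
    (('a \<Rightarrow> real) \<Rightarrow> 'a \<Rightarrow> real) \<Rightarrow> real \<Rightarrow> ('a \<Rightarrow> real) \<Rightarrow> ('a \<Rightarrow> real) \<Rightarrow> real" where
  "consistency_residual K A h f \<rho> =
     \<bar>\<integral>z. (f z * K h \<rho> z - f z * \<rho> z - h * A f z * \<rho> z) \<partial>lborel\<bar>"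

end

theory Submission
  imports Defs "HOL-Probability.Distributions"
begin

text \<open>
  Let $Z = (y + h w + \frac{h}{2}\xi + \eta, w + \xi)$ with independent centred Gaussians
  $\xi$ (variance $2\gamma h/\beta$) and $\eta$ (variance $\gamma h^3/(6\beta)$); its density is
  $G_h(\cdot \mid y, w)$. By Fubini, $\int f\,\mathcal K_h\rho = \int \rho\, E[(f\psi)(Z)] / E[\psi(Z)]$,
  so it suffices to expand this quotient pointwise. Averaging over $(\xi,\eta)$ and
  $(-\xi,-\eta)$ cancels the odd Taylor terms, and a fourth-order expansion in $v$, a second-order one in
  $x$ and a mixed one give $E[(f\psi)(Z)] = \psi\,(f + h\mathcal Lf + h f \kappa) + R_f$ with
  $R_f = O(h^2)$ and $\kappa$ independent of $f$. Taking $f = 1$ eliminates $\kappa$ from the quotient.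
  As $\log\psi$ has gradient of linear growth, weights and $\psi(Z)/\psi(z)$ cost only a factor
  $e^{\epsilon(1+|z|^2)}$ for small $h$, and the AM-HM inequality $1/E[\psi(Z)] \le E[1/\psi(Z)]$ turns
  this upper bound into the lower bound for the denominator. Polynomial factors are absorbed by the gap
  $\theta < \bar\theta$, so the exponent $m = 0$ suffices.
\<close>

subsection \<open>Functions of class \<open>C\<^sup>k\<close> and iterated directional derivatives\<close>

text \<open>The scaling dictates the orders: xi ~ sqrt h, whereas the position moves by h w + b with
  b = (h/2) xi + eta ~ h^(3/2). Four velocity or two position derivatives thus cost h^2. So each
  point is reached by a velocity move followed by a position move. Of the mixed terms, h w meets
  only the even part in xi and b only the odd part; both give h^2. The first-order term is a Doob
  transform with D0: D0 (f psi) / psi = L f + f (D0 psi / psi), because 2 (gamma/beta) grad_v log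
  psi = -U. So kappa = D0 psi / psi, and the first-order term sees lambda only through kappa. The
  noise is unbounded, so local bounds hold with constants depending on a random radius R.
  Polynomials in R are harmless, but bounds on log psi are exponentiated; linear growth of its
  gradient makes the exponent at most sqrt h times a quadratic in |z| and the noise, which is why
  the step must be small.\<close>

lemma differentiable_line:
  fixes f :: "'a::euclidean_space \<Rightarrow> real"
  assumes "f differentiable_on UNIV"
  shows "((\<lambda>t. f (z + t *\<^sub>R u)) has_real_derivative partial_deriv u f (z + t *\<^sub>R u)) (at t)"
proof -
  have f: "(f has_derivative frechet_derivative f (at (z + t *\<^sub>R u))) (at (z + t *\<^sub>R u))"
    using assms by (simp add: differentiable_on_def frechet_derivative_works)
  have "((\<lambda>t. f (z + t *\<^sub>R u)) has_derivative
      (\<lambda>s. frechet_derivative f (at (z + t *\<^sub>R u)) (s *\<^sub>R u))) (at t)"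
    by (rule has_derivative_compose[where f="\<lambda>t. z + t *\<^sub>R u" and g=f, OF _ f])
       (auto intro!: derivative_eq_intros)
  moreover have "frechet_derivative f (at (z + t *\<^sub>R u)) (s *\<^sub>R u) = partial_deriv u f (z + t *\<^sub>R u) * s" for s
    using linear_scale[OF has_derivative_linear[OF f], of s u] by (simp add: partial_deriv_def)
  ultimately show ?thesis
    by (simp add: has_field_derivative_def)
qed

lemma partial_deriv_eqI:
  assumes "(f has_derivative f') (at x)"
  shows "partial_deriv u f x = f' u"
  unfolding partial_deriv_def using frechet_derivative_at[OF assms] by simp

lemma linear_partial_deriv:
  fixes f :: "'a::euclidean_space \<Rightarrow> real"
  assumes "f differentiable_on UNIV"
  shows "linear (\<lambda>u. partial_deriv u f x)"
  using assms unfolding partial_deriv_def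
  by (simp add: differentiable_on_def linear_frechet_derivative)

lemma partial_deriv_basis_sum:
  fixes f :: "'a::euclidean_space \<Rightarrow> real"
  assumes "f differentiable_on UNIV"
  shows "partial_deriv u f x = (\<Sum>b\<in>Basis. (u \<bullet> b) * partial_deriv b f x)"
proof -
  have "partial_deriv (\<Sum>b\<in>Basis. (u \<bullet> b) *\<^sub>R b) f x = (\<Sum>b\<in>Basis. partial_deriv ((u \<bullet> b) *\<^sub>R b) f x)"
    by (rule linear_sum[OF linear_partial_deriv[OF assms]])
  then show ?thesis
    using linear_scale[OF linear_partial_deriv[OF assms]] by (simp add: euclidean_representation)
qed

lemma partial_deriv_sum:
  fixes g :: "'i \<Rightarrow> 'a::euclidean_space \<Rightarrow> real"
  assumes "\<And>i. i \<in> I \<Longrightarrow> g i differentiable_on UNIV"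
  shows "partial_deriv u (\<lambda>x. \<Sum>i\<in>I. c i * g i x) = (\<lambda>x. \<Sum>i\<in>I. c i * partial_deriv u (g i) x)"
proof
  fix x
  have "((\<lambda>x. \<Sum>i\<in>I. c i * g i x) has_derivative (\<lambda>v. \<Sum>i\<in>I. c i * frechet_derivative (g i) (at x) v)) (at x)"
    using assms
    by (intro has_derivative_sum has_derivative_mult_right)
       (simp add: differentiable_on_def frechet_derivative_works[symmetric])
  from partial_deriv_eqI[OF this]
  show "partial_deriv u (\<lambda>x. \<Sum>i\<in>I. c i * g i x) x = (\<Sum>i\<in>I. c i * partial_deriv u (g i) x)"
    by (simp add: partial_deriv_def)
qed

lemma C_k_sum:
  assumes "finite I" "\<And>i. i \<in> I \<Longrightarrow> C_k k (g i)"
  shows "C_k k (\<lambda>x. \<Sum>i\<in>I. c i * g i x)"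
  using assms(2)
proof (induction k arbitrary: g)
  case 0
  then show ?case by (auto intro!: continuous_intros)
next
  case (Suc k)
  then have d: "g i differentiable_on UNIV" if "i \<in> I" for i
    using that by simp
  have "(\<lambda>x. \<Sum>i\<in>I. c i * g i x) differentiable_on UNIV"
    unfolding differentiable_on_def using d assms(1)
    by (auto simp: differentiable_on_def intro!: differentiable_sum differentiable_mult)
  moreover have "C_k k (partial_deriv b (\<lambda>x. \<Sum>i\<in>I. c i * g i x))" if "b \<in> Basis" for b
    using partial_deriv_sum[of I g b c] d Suc that by auto
  ultimately show ?case by simp
qed

lemma C_k_Suc_imp: "C_k (Suc k) f \<Longrightarrow> C_k k f"
proof (induction k arbitrary: f)
  case 0
  then show ?case by (auto intro: differentiable_imp_continuous_on)
next
  case (Suc k)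
  then have "C_k k (partial_deriv b f)" if "b \<in> Basis" for b
    using that by (auto intro: Suc.IH)
  then show ?case using Suc.prems by simp
qed

lemma C_k_mono: "C_k k f \<Longrightarrow> j \<le> k \<Longrightarrow> C_k j f"
  by (induction k) (auto simp: le_Suc_eq dest: C_k_Suc_imp simp del: C_k.simps)

lemma C_k_continuous: "C_k k f \<Longrightarrow> continuous_on UNIV f"
  using C_k_mono[of k f 0] by simp

text \<open>\<open>C_k\<close> speaks of basis directions only; linearity in the direction extends
  it, as the noise and the velocity will serve as directions.\<close>

lemma C_k_partial_deriv:
  fixes f :: "'a::euclidean_space \<Rightarrow> real"
  assumes "C_k (Suc k) f"
  shows "C_k k (partial_deriv u f)"
proof -
  have "partial_deriv u f = (\<lambda>x. \<Sum>b\<in>Basis. (u \<bullet> b) * partial_deriv b f x)"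
    using assms by (intro ext partial_deriv_basis_sum) simp
  then show ?thesis
    using assms by (auto intro!: C_k_sum)
qed

text \<open>Directions are arbitrary vectors. The head of the list is the derivative taken last, so
  differentiating once more along \<open>u\<close> means consing \<open>u\<close>.\<close>

abbreviation dir_deriv :: "'a::euclidean_space list \<Rightarrow> ('a \<Rightarrow> real) \<Rightarrow> 'a \<Rightarrow> real" where
  "dir_deriv us f \<equiv> foldr partial_deriv us f"

lemma C_k_dir_deriv: "C_k k f \<Longrightarrow> length us \<le> k \<Longrightarrow> C_k (k - length us) (dir_deriv us f)"
proof (induction us)
  case (Cons u us)
  then have "C_k (Suc (k - length (u # us))) (dir_deriv us f)"
    by (simp add: Suc_diff_Suc del: C_k.simps)
  then show ?case by (simp add: C_k_partial_deriv del: C_k.simps)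
qed simp

lemma dir_deriv_differentiable:
  assumes "C_k k f" "length us < k"
  shows "dir_deriv us f differentiable_on UNIV"
  using C_k_dir_deriv[of k f us] assms
  by (cases "k - length us") auto

text \<open>Reduces multivariate calculus to one real variable: the Taylor and mean value estimates
  are applied along such lines, and each further derivative only prepends the direction.\<close>

lemma dir_deriv_line:
  fixes f :: "'a::euclidean_space \<Rightarrow> real"
  assumes "C_k k f" "length us < k"
  shows "((\<lambda>t. dir_deriv us f (z + t *\<^sub>R u)) has_real_derivative dir_deriv (u # us) f (z + t *\<^sub>R u)) (at t)"
  using differentiable_line[OF dir_deriv_differentiable[OF assms]] by simp

lemma dir_deriv_MVT:
  fixes f :: "'a::euclidean_space \<Rightarrow> real"
  assumes "C_k k f" "length us < k"
  obtains t where "0 < t" "t < 1" "dir_deriv us f (z + u) - dir_deriv us f z = dir_deriv (u # us) f (z + t *\<^sub>R u)"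
proof -
  have "\<exists>t. 0 < t \<and> t < 1 \<and> dir_deriv us f (z + 1 *\<^sub>R u) - dir_deriv us f (z + 0 *\<^sub>R u) =
      (1 - 0) * dir_deriv (u # us) f (z + t *\<^sub>R u)"
    using dir_deriv_line[OF assms, of z u] by (intro MVT2) (auto simp del: foldr_Cons)
  then show ?thesis using that by auto
qed

text \<open>The second difference of \<open>f\<close> over the parallelogram spanned by e u and e v
  is symmetric in the two directions. Applying the mean value theorem once in each direction, in
  either order, equates the two mixed derivatives at nearby points; e -> 0 and continuity do the
  rest.\<close>

lemma partial_deriv_commute:
  fixes f :: "'a::euclidean_space \<Rightarrow> real"
  assumes C2: "C_k 2 f"
  shows "partial_deriv u (partial_deriv v f) = partial_deriv v (partial_deriv u f)"
proof
  fix x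
  have mvt: "\<exists>s t. 0 < s \<and> s < e \<and> 0 < t \<and> t < e \<and>
      f (x + e *\<^sub>R u + e *\<^sub>R v) - f (x + e *\<^sub>R u) - f (x + e *\<^sub>R v) + f x =
      e * e * partial_deriv v (partial_deriv u f) (x + s *\<^sub>R u + t *\<^sub>R v)"
    if e: "e > 0" for e and u v
  proof -
    have df: "f differentiable_on UNIV"
      using dir_deriv_differentiable[OF C2, of "[]"] by simp
    have ddf: "partial_deriv u f differentiable_on UNIV"
      using dir_deriv_differentiable[OF C2, of "[u]"] by simp
    have d1: "((\<lambda>s. f (x + e *\<^sub>R v + s *\<^sub>R u) - f (x + s *\<^sub>R u)) has_real_derivative
        partial_deriv u f (x + e *\<^sub>R v + s *\<^sub>R u) - partial_deriv u f (x + s *\<^sub>R u)) (at s)" for s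
      by (intro derivative_intros differentiable_line df)
    obtain s where s: "0 < s" "s < e"
      "f (x + e *\<^sub>R v + e *\<^sub>R u) - f (x + e *\<^sub>R u) - (f (x + e *\<^sub>R v + 0 *\<^sub>R u) - f (x + 0 *\<^sub>R u))
       = (e - 0) * (partial_deriv u f (x + e *\<^sub>R v + s *\<^sub>R u) - partial_deriv u f (x + s *\<^sub>R u))"
      using MVT2[OF e d1] by blast
    have d2: "((\<lambda>t. partial_deriv u f (x + s *\<^sub>R u + t *\<^sub>R v)) has_real_derivative
        partial_deriv v (partial_deriv u f) (x + s *\<^sub>R u + t *\<^sub>R v)) (at t)" for t
      by (intro differentiable_line ddf)
    obtain t where t: "0 < t" "t < e"
      "partial_deriv u f (x + s *\<^sub>R u + e *\<^sub>R v) - partial_deriv u f (x + s *\<^sub>R u + 0 *\<^sub>R v)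
       = (e - 0) * partial_deriv v (partial_deriv u f) (x + s *\<^sub>R u + t *\<^sub>R v)"
      using MVT2[OF e d2] by blast
    have "f (x + e *\<^sub>R u + e *\<^sub>R v) - f (x + e *\<^sub>R u) - f (x + e *\<^sub>R v) + f x
        = e * (partial_deriv u f (x + s *\<^sub>R u + e *\<^sub>R v) - partial_deriv u f (x + s *\<^sub>R u))"
      using s(3) by (simp add: algebra_simps)
    also have "\<dots> = e * e * partial_deriv v (partial_deriv u f) (x + s *\<^sub>R u + t *\<^sub>R v)"
      using t(3) by simp
    finally show ?thesis using s t by blast
  qed
  \<comment> \<open>With e = 1 / (n + 1) the offsets of the intermediate points form null
    sequences.\<close>
  have "\<exists>s t s' t'. \<bar>s\<bar> < inverse (Suc n) \<and> \<bar>t\<bar> < inverse (Suc n) \<and> \<bar>s'\<bar> < inverse (Suc n) \<and> \<bar>t'\<bar> < inverse (Suc n) \<and>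
      partial_deriv v (partial_deriv u f) (x + s *\<^sub>R u + t *\<^sub>R v) =
      partial_deriv u (partial_deriv v f) (x + s' *\<^sub>R v + t' *\<^sub>R u)" for n :: nat
  proof -
    define e where "e = inverse (real (Suc n))"
    have e: "e > 0" by (simp add: e_def)
    obtain s t where 1: "0 < s" "s < e" "0 < t" "t < e"
      "f (x + e *\<^sub>R u + e *\<^sub>R v) - f (x + e *\<^sub>R u) - f (x + e *\<^sub>R v) + f x =
      e * e * partial_deriv v (partial_deriv u f) (x + s *\<^sub>R u + t *\<^sub>R v)"
      using mvt[OF e, of u v] by blast
    obtain s' t' where 2: "0 < s'" "s' < e" "0 < t'" "t' < e"
      "f (x + e *\<^sub>R v + e *\<^sub>R u) - f (x + e *\<^sub>R v) - f (x + e *\<^sub>R u) + f x =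
      e * e * partial_deriv u (partial_deriv v f) (x + s' *\<^sub>R v + t' *\<^sub>R u)"
      using mvt[OF e, of v u] by blast
    have "e * e * partial_deriv v (partial_deriv u f) (x + s *\<^sub>R u + t *\<^sub>R v) =
          e * e * partial_deriv u (partial_deriv v f) (x + s' *\<^sub>R v + t' *\<^sub>R u)"
      unfolding 1(5)[symmetric] 2(5)[symmetric] by (simp add: add.commute add.left_commute)
    then have "partial_deriv v (partial_deriv u f) (x + s *\<^sub>R u + t *\<^sub>R v) =
          partial_deriv u (partial_deriv v f) (x + s' *\<^sub>R v + t' *\<^sub>R u)"
      using e by simp
    then show ?thesis
      using 1 2 unfolding e_def[symmetric]
      by (intro exI[of _ s] exI[of _ t] exI[of _ s'] exI[of _ t']) simp
  qed
  then obtain s t s' t' :: "nat \<Rightarrow> real" where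
    b: "\<And>n. \<bar>s n\<bar> < inverse (Suc n)" "\<And>n. \<bar>t n\<bar> < inverse (Suc n)"
       "\<And>n. \<bar>s' n\<bar> < inverse (Suc n)" "\<And>n. \<bar>t' n\<bar> < inverse (Suc n)" and
    eq: "\<And>n. partial_deriv v (partial_deriv u f) (x + s n *\<^sub>R u + t n *\<^sub>R v) =
      partial_deriv u (partial_deriv v f) (x + s' n *\<^sub>R v + t' n *\<^sub>R u)"
    by metis
  have lim0: "r \<longlonglongrightarrow> 0" if "\<And>n. \<bar>r n\<bar> < inverse (real (Suc n))" for r
    by (rule tendsto_rabs_zero_cancel, rule real_tendsto_sandwich[OF _ _ tendsto_const LIMSEQ_inverse_real_of_nat])
       (use that in \<open>auto intro!: always_eventually less_imp_le\<close>)
  have l1: "(\<lambda>n. x + s n *\<^sub>R u + t n *\<^sub>R v) \<longlonglongrightarrow> x + 0 *\<^sub>R u + 0 *\<^sub>R v"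
    by (intro tendsto_intros lim0 b)
  have l2: "(\<lambda>n. x + s' n *\<^sub>R v + t' n *\<^sub>R u) \<longlonglongrightarrow> x + 0 *\<^sub>R v + 0 *\<^sub>R u"
    by (intro tendsto_intros lim0 b)
  have c: "continuous_on UNIV (partial_deriv a (partial_deriv b f))" for a b
    using C_k_dir_deriv[OF C2, of "[a,b]"] by simp
  have "(\<lambda>n. partial_deriv v (partial_deriv u f) (x + s n *\<^sub>R u + t n *\<^sub>R v)) \<longlonglongrightarrow> partial_deriv v (partial_deriv u f) x"
    using continuous_on_tendsto_compose[OF c l1] by simp
  moreover have "(\<lambda>n. partial_deriv u (partial_deriv v f) (x + s' n *\<^sub>R v + t' n *\<^sub>R u)) \<longlonglongrightarrow> partial_deriv u (partial_deriv v f) x"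
    using continuous_on_tendsto_compose[OF c l2] by simp
  ultimately show "partial_deriv u (partial_deriv v f) x = partial_deriv v (partial_deriv u f) x"
    unfolding eq using LIMSEQ_unique by blast
qed

lemma dir_deriv_move:
  assumes "C_k k f" "Suc (length (us @ vs)) \<le> k"
  shows "dir_deriv (us @ u # vs) f = dir_deriv (u # us @ vs) f"
  using assms(2)
proof (induction us)
  case (Cons a us)
  have "C_k 2 (dir_deriv (us @ vs) f)"
    by (rule C_k_mono[OF C_k_dir_deriv[OF assms(1)]]) (use Cons.prems in auto)
  then have "partial_deriv a (partial_deriv u (dir_deriv (us @ vs) f)) = partial_deriv u (partial_deriv a (dir_deriv (us @ vs) f))"
    by (rule partial_deriv_commute)
  moreover have "dir_deriv (us @ u # vs) f = dir_deriv (u # us @ vs) f"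
    by (rule Cons.IH) (use Cons.prems in auto)
  ultimately show ?case by (simp del: foldr_append)
qed simp

text \<open>Induction on the first list: its head is located in the second list and moved to the
  front there. This frees \<open>multi_deriv\<close> from the ordering selected by
  \<open>SOME\<close>.\<close>

lemma dir_deriv_perm:
  assumes "C_k k f" "length us \<le> k" "mset us = mset vs"
  shows "dir_deriv us f = dir_deriv vs f"
  using assms(2,3)
proof (induction us arbitrary: vs)
  case (Cons u us)
  then have "u \<in> set vs" by (metis list.set_intros(1) set_mset_mset)
  then obtain xs ys where vs: "vs = xs @ u # ys" by (meson split_list)
  have len: "length (u # us) = length vs" using Cons.prems(2) by (metis size_mset)
  have "dir_deriv us f = dir_deriv (xs @ ys) f"
    by (rule Cons.IH) (use Cons.prems vs in auto)
  moreover have "dir_deriv vs f = dir_deriv (u # xs @ ys) f"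
    unfolding vs by (rule dir_deriv_move[OF assms(1)]) (use Cons.prems(1) len vs in auto)
  ultimately show ?case by (simp del: foldr_append)
qed simp

lemma multi_deriv_mset:
  assumes "C_k k f" "length us \<le> k"
  shows "multi_deriv (mset us) f = dir_deriv us f"
proof -
  have e: "mset (SOME bs. mset bs = mset us) = mset us"
    by (rule someI[of _ us]) simp
  have "length (SOME bs. mset bs = mset us) = length us"
    using arg_cong[OF e, of size] by simp
  then show ?thesis
    unfolding multi_deriv_def using assms e by (intro dir_deriv_perm[OF assms(1)]) auto
qed

lemma dir_deriv_sum:
  assumes "finite I" "\<And>i. i \<in> I \<Longrightarrow> C_k k (g i)" "length us \<le> k"
  shows "dir_deriv us (\<lambda>x. \<Sum>i\<in>I. c i * g i x) = (\<lambda>x. \<Sum>i\<in>I. c i * dir_deriv us (g i) x)"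
  using assms(3)
proof (induction us)
  case (Cons u us)
  then have "dir_deriv (u # us) (\<lambda>x. \<Sum>i\<in>I. c i * g i x)
      = partial_deriv u (\<lambda>x. \<Sum>i\<in>I. c i * dir_deriv us (g i) x)"
    by simp
  also have "\<dots> = (\<lambda>x. \<Sum>i\<in>I. c i * partial_deriv u (dir_deriv us (g i)) x)"
    by (rule partial_deriv_sum) (use Cons.prems assms(2) in \<open>auto intro!: dir_deriv_differentiable\<close>)
  finally show ?case by simp
qed simp

lemma dir_deriv_basis_sum:
  fixes f :: "'a::euclidean_space \<Rightarrow> real"
  assumes f: "C_k k f" and len: "length (us @ [u]) \<le> k"
  shows "dir_deriv (us @ [u]) f x = (\<Sum>b\<in>Basis. (u \<bullet> b) * dir_deriv (us @ [b]) f x)"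
proof -
  obtain k' where k': "k = Suc k'" using len by (cases k) auto
  have "partial_deriv u f = (\<lambda>x. \<Sum>b\<in>Basis. (u \<bullet> b) * partial_deriv b f x)"
    using f k' by (intro ext partial_deriv_basis_sum) simp
  moreover have "C_k k' (partial_deriv b f)" for b :: 'a
    using f k' by (simp add: C_k_partial_deriv del: C_k.simps)
  ultimately show ?thesis
    using dir_deriv_sum[of Basis k' "\<lambda>b. partial_deriv b f" us "\<lambda>b. u \<bullet> b"] len k' by simp
qed

text \<open>Multilinearity: expanding each of the n directions in the basis gives
  \<open>DIM('a)\<close> summands whose coefficients are at most the norm, whence the factor
  \<open>DIM('a) ^ n\<close>.\<close>

lemma dir_deriv_bound:
  fixes f :: "'a::euclidean_space \<Rightarrow> real"
  assumes f: "C_k k f"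
    and B: "\<And>bs. set bs \<subseteq> Basis \<Longrightarrow> length bs = n \<Longrightarrow> \<bar>dir_deriv bs f x\<bar> \<le> B"
    and n: "length us = n" "n \<le> k"
  shows "\<bar>dir_deriv us f x\<bar> \<le> B * real DIM('a) ^ n * prod_list (map norm us)"
proof -
  \<comment> \<open>Generalised for the induction: \<open>bs\<close> holds the directions already
    replaced by basis vectors. The last remaining direction is moved to the end of the list,
    expanded there, and joins \<open>bs\<close>.\<close>
  have "\<bar>dir_deriv (us @ bs) f x\<bar> \<le> B * real DIM('a) ^ length us * prod_list (map norm us)"
    if "set bs \<subseteq> Basis" "length (us @ bs) = n" for bs us
    using that
  proof (induction us arbitrary: bs rule: rev_induct)
    case Nil
    then show ?case using B by simp
  next
    case (snoc u us)
    have n': "n \<le> k" by (rule n)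
    have "dir_deriv ((us @ [u]) @ bs) f = dir_deriv ((us @ bs) @ [u]) f"
      by (rule dir_deriv_perm[OF f]) (use snoc.prems n' in auto)
    then have "\<bar>dir_deriv ((us @ [u]) @ bs) f x\<bar> = \<bar>\<Sum>b\<in>Basis. (u \<bullet> b) * dir_deriv ((us @ bs) @ [b]) f x\<bar>"
      using dir_deriv_basis_sum[OF f, of "us @ bs" u x] snoc.prems n' by simp
    also have "\<dots> \<le> (\<Sum>b\<in>Basis. \<bar>u \<bullet> b\<bar> * \<bar>dir_deriv ((us @ bs) @ [b]) f x\<bar>)"
      by (rule order_trans[OF sum_abs]) (simp add: abs_mult)
    also have "\<dots> \<le> (\<Sum>b\<in>(Basis::'a set). norm u * (B * real DIM('a) ^ length us * prod_list (map norm us)))"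
    proof (rule sum_mono)
      fix b :: 'a assume b: "b \<in> Basis"
      have "\<bar>dir_deriv (us @ (bs @ [b])) f x\<bar> \<le> B * real DIM('a) ^ length us * prod_list (map norm us)"
        by (rule snoc.IH) (use b snoc.prems in auto)
      then show "\<bar>u \<bullet> b\<bar> * \<bar>dir_deriv ((us @ bs) @ [b]) f x\<bar> \<le> norm u * (B * real DIM('a) ^ length us * prod_list (map norm us))"
        using Basis_le_norm[OF b, of u] by (intro mult_mono) auto
    qed
    finally show ?case by (simp add: algebra_simps)
  qed
  from this[of "[]" us] show ?thesis using n by simp
qed

section \<open>Pointwise bounds from the weighted norms\<close>

lemma Linf_norm_bound:
  assumes "\<omega> z > 0" "Linf_norm \<omega> g \<le> ennreal F" "F \<ge> 0"
  shows "\<bar>g z\<bar> \<le> F * \<omega> z"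
proof -
  have "ennreal (\<bar>g z\<bar> / \<omega> z) \<le> Linf_norm \<omega> g"
    unfolding Linf_norm_def by (rule SUP_upper) simp
  also note assms(2)
  finally have "\<bar>g z\<bar> / \<omega> z \<le> F" using assms(3) by simp
  then show ?thesis using assms(1) by (simp add: divide_simps)
qed

text \<open>The norm is a sum of nonnegative terms over multi-indices and dominates each of them; a
  basis list represents its multi-index.\<close>

lemma Ck_norm_basis_bound:
  fixes f :: "'a::euclidean_space \<Rightarrow> real"
  assumes f: "f \<in> Ck_space k \<omega>" and \<omega>: "\<And>z. \<omega> z > 0"
    and bs: "set bs \<subseteq> Basis" "length bs \<le> k"
  shows "\<bar>dir_deriv bs f z\<bar> \<le> enn2real (Ck_norm k \<omega> f) * \<omega> z"
proof -
  have C: "C_k k f" and fin: "Ck_norm k \<omega> f < \<infinity>"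
    using f by (auto simp: Ck_space_def)
  have "mset bs \<in> multi_indices k"
    using bs by (simp add: multi_indices_def)
  then have "Linf_norm \<omega> (multi_deriv (mset bs) f) \<le> Ck_norm k \<omega> f"
    unfolding Ck_norm_def by (intro member_le_sum) (auto simp: finite_multi_indices)
  then have "Linf_norm \<omega> (dir_deriv bs f) \<le> ennreal (enn2real (Ck_norm k \<omega> f))"
    using fin multi_deriv_mset[OF C bs(2)] by simp
  then show ?thesis by (intro Linf_norm_bound \<omega>) auto
qed

subsection \<open>One-dimensional remainder estimates\<close>

lemma taylor2_bound:
  fixes g :: "real \<Rightarrow> real"
  assumes "\<And>t. (g has_real_derivative g1 t) (at t)" "\<And>t. (g1 has_real_derivative g2 t) (at t)"
    and B: "\<And>t. \<bar>t\<bar> \<le> 1 \<Longrightarrow> \<bar>g2 t\<bar> \<le> B"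
  shows "\<bar>g 1 - g 0 - g1 0\<bar> \<le> B / 2"
proof -
  let ?d = "\<lambda>m. [g, g1, g2] ! m"
  have "\<exists>t. \<bar>t\<bar> \<le> \<bar>1::real\<bar> \<and> g 1 = (\<Sum>m<2. ?d m 0 / fact m * 1 ^ m) + ?d 2 t / fact 2 * 1 ^ 2"
    using assms(1,2) by (intro Maclaurin_bi_le) (auto simp: less_2_cases_iff)
  then obtain t where "\<bar>t\<bar> \<le> 1" "g 1 = g 0 + g1 0 + g2 t / 2"
    by (auto simp: numeral_2_eq_2)
  then show ?thesis using B[of t] by (auto simp: abs_le_iff)
qed

text \<open>The first-order terms of \<open>g\<close> and of its mirror image cancel, and two
  remainders B / 2 are left.\<close>

lemma taylor2_symmetric_bound:
  fixes g :: "real \<Rightarrow> real"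
  assumes g: "\<And>t. (g has_real_derivative g1 t) (at t)" and g1: "\<And>t. (g1 has_real_derivative g2 t) (at t)"
    and B: "\<And>t. \<bar>t\<bar> \<le> 1 \<Longrightarrow> \<bar>g2 t\<bar> \<le> B"
  shows "\<bar>g 1 + g (- 1) - 2 * g 0\<bar> \<le> B"
proof -
  have "\<bar>g 1 - g 0 - g1 0\<bar> \<le> B / 2"
    by (rule taylor2_bound[OF assms])
  moreover have "\<bar>(\<lambda>t. g (- t)) 1 - (\<lambda>t. g (- t)) 0 - (\<lambda>t. - g1 (- t)) 0\<bar> \<le> B / 2"
  proof (rule taylor2_bound)
    show "((\<lambda>t. g (- t)) has_real_derivative - g1 (- t)) (at t)" for t
      using DERIV_mirror[of g "g1 (- t)" t] g[of "- t"] by simp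
    show "((\<lambda>t. - g1 (- t)) has_real_derivative g2 (- t)) (at t)" for t
      using DERIV_minus[OF DERIV_mirror[of g1 "g2 (- t)" t, THEN iffD1]] g1[of "- t"] by simp
  qed (use B in auto)
  ultimately show ?thesis unfolding abs_le_iff by simp
qed

text \<open>Orders one and three cancel; the second-order term survives with coefficient 2 / 2 = 1,
  and the remainder is twice B / 24.\<close>

lemma taylor4_symmetric_bound:
  fixes g :: "real \<Rightarrow> real"
  assumes "\<And>t. (g has_real_derivative g1 t) (at t)" "\<And>t. (g1 has_real_derivative g2 t) (at t)"
    "\<And>t. (g2 has_real_derivative g3 t) (at t)" "\<And>t. (g3 has_real_derivative g4 t) (at t)"
    and B: "\<And>t. \<bar>t\<bar> \<le> 1 \<Longrightarrow> \<bar>g4 t\<bar> \<le> B"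
  shows "\<bar>g 1 + g (- 1) - 2 * g 0 - g2 0\<bar> \<le> B / 12"
proof -
  let ?d = "\<lambda>m. [g, g1, g2, g3, g4] ! m"
  have "\<exists>t. \<bar>t\<bar> \<le> \<bar>s\<bar> \<and> g s = (\<Sum>m<4. ?d m 0 / fact m * s ^ m) + ?d 4 t / fact 4 * s ^ 4" for s
    using assms(1-4) by (intro Maclaurin_bi_le) (auto simp: eval_nat_numeral less_Suc_eq)
  from this[of 1] this[of "- 1"] obtain t t' where
    "\<bar>t\<bar> \<le> 1" "g 1 = g 0 + g1 0 + g2 0 / 2 + g3 0 / 6 + g4 t / 24"
    "\<bar>t'\<bar> \<le> 1" "g (- 1) = g 0 - g1 0 + g2 0 / 2 - g3 0 / 6 + g4 t' / 24"
    by (auto simp: eval_nat_numeral)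
  then have "g 1 + g (- 1) - 2 * g 0 - g2 0 = g4 t / 24 + g4 t' / 24" "\<bar>g4 t\<bar> \<le> B" "\<bar>g4 t'\<bar> \<le> B"
    using B by auto
  then show ?thesis by linarith
qed

text \<open>For the antisymmetric combination first order suffices. It is applied to the position
  shift b, which changes sign together with the noise.\<close>

lemma mvt_symmetric_bound:
  fixes g :: "real \<Rightarrow> real"
  assumes "\<And>t. (g has_real_derivative g1 t) (at t)"
    and B: "\<And>t. \<bar>t\<bar> \<le> 1 \<Longrightarrow> \<bar>g1 t\<bar> \<le> B"
  shows "\<bar>g 1 - g (- 1)\<bar> \<le> 2 * B"
proof -
  obtain t where "- 1 < t" "t < 1" "g 1 - g (- 1) = (1 - (- 1)) * g1 t"
    using MVT2[of "- 1" 1 g g1] assms(1) by auto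
  then show ?thesis using B[of t] by (auto simp: abs_mult)
qed

subsection \<open>The potential and the exponent of \<open>psi\<close>\<close>

lemma inner_grad:
  fixes f :: "'a::euclidean_space \<Rightarrow> real"
  assumes "f differentiable_on UNIV"
  shows "u \<bullet> grad f x = partial_deriv u f x"
  unfolding grad_def partial_deriv_basis_sum[OF assms, of u] by (simp add: inner_sum_right mult.commute)

locale potential =
  fixes V :: "real^'n::finite \<Rightarrow> real" and \<gamma> \<beta> l C :: real and M :: nat
  assumes pos: "\<gamma> > 0" "\<beta> > 0" "l > 0" "C \<ge> 0"
    and V: "C_k 3 V"
    and V1: "\<bar>dir_deriv [u] V x\<bar> \<le> C * (1 + norm x) * norm u"
    and V2: "\<bar>dir_deriv [u, v] V x\<bar> \<le> C * norm u * norm v"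
    and V3: "\<bar>dir_deriv [u, v, w] V x\<bar> \<le> C * (1 + norm x) ^ M * norm u * norm v * norm w"
begin

lemma V_line:
  "((\<lambda>t. V (x + t *\<^sub>R a)) has_real_derivative dir_deriv [a] V (x + t *\<^sub>R a)) (at t)"
  "((\<lambda>t. dir_deriv [u] V (x + t *\<^sub>R a)) has_real_derivative dir_deriv [a, u] V (x + t *\<^sub>R a)) (at t)"
  "((\<lambda>t. dir_deriv [u, v] V (x + t *\<^sub>R a)) has_real_derivative dir_deriv [a, u, v] V (x + t *\<^sub>R a)) (at t)"
  using dir_deriv_line[OF V, of "[]" x a t] dir_deriv_line[OF V, of "[u]" x a t] dir_deriv_line[OF V, of "[u,v]" x a t]
  by simp_all

lemma V_commute: "dir_deriv [u, v] V = dir_deriv [v, u] V"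
  by (rule dir_deriv_perm[OF V]) auto

lemma linear_V1: "linear (\<lambda>u. dir_deriv [u] V x)"
  using linear_partial_deriv[OF dir_deriv_differentiable[OF V, of "[]"]] by simp

lemma linear_V2: "linear (\<lambda>u. dir_deriv [u, v] V x)"
  using linear_partial_deriv[OF dir_deriv_differentiable[OF V, of "[v]"]] by simp

lemma linear_V2': "linear (\<lambda>v. dir_deriv [u, v] V x)"
  unfolding V_commute[of u] by (rule linear_V2)

definition q :: "'n phase \<Rightarrow> real" where
  "q = (\<lambda>(x, v). - (l * V x + \<beta> / \<gamma> * dir_deriv [v] V x + \<beta> / 2 * (v \<bullet> v)) / 2)"

definition qx :: "real^'n \<Rightarrow> 'n phase \<Rightarrow> real" where
  "qx a = (\<lambda>(x, v). - (l * dir_deriv [a] V x + \<beta> / \<gamma> * dir_deriv [v, a] V x) / 2)"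

definition qxx :: "real^'n \<Rightarrow> 'n phase \<Rightarrow> real" where
  "qxx a = (\<lambda>(x, v). - (l * dir_deriv [a, a] V x + \<beta> / \<gamma> * dir_deriv [a, v, a] V x) / 2)"

definition qv :: "real^'n \<Rightarrow> 'n phase \<Rightarrow> real" where
  "qv \<xi> = (\<lambda>(x, v). - (\<beta> / \<gamma> * dir_deriv [\<xi>] V x + \<beta> * (v \<bullet> \<xi>)) / 2)"

text \<open>No phase point appears: at fixed position \<open>q\<close> is quadratic in the velocity,
  so this second derivative is constant. Likewise \<open>qx a\<close> is affine in the velocity, so
  \<open>qxv\<close> sees the position alone.\<close>

definition qvv :: "real^'n \<Rightarrow> real" where
  "qvv \<xi> = - \<beta> * (\<xi> \<bullet> \<xi>) / 2"

definition qxv :: "real^'n \<Rightarrow> real^'n \<Rightarrow> real^'n \<Rightarrow> real" where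
  "qxv a \<xi> x = - (\<beta> / \<gamma> * dir_deriv [\<xi>, a] V x) / 2"

lemma psi_eq: "psi V \<gamma> \<beta> l z = exp (q z)"
proof -
  obtain x v where "z = (x, v)" by (metis surj_pair)
  then show ?thesis
    using inner_grad[OF dir_deriv_differentiable[OF V, of "[]"], of v x]
    by (simp add: psi_def phi_ki_def q_def power2_norm_eq_inner)
qed

lemma q_deriv:
  "((\<lambda>t. q (x + t *\<^sub>R a, v)) has_real_derivative qx a (x + t *\<^sub>R a, v)) (at t)"
  "((\<lambda>t. qx a (x + t *\<^sub>R a, v)) has_real_derivative qxx a (x + t *\<^sub>R a, v)) (at t)"
  "((\<lambda>t. q (x, v + t *\<^sub>R \<xi>)) has_real_derivative qv \<xi> (x, v + t *\<^sub>R \<xi>)) (at t)"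
  "((\<lambda>t. qv \<xi> (x, v + t *\<^sub>R \<xi>)) has_real_derivative qvv \<xi>) (at t)"
  "((\<lambda>t. qx a (x, v + t *\<^sub>R \<xi>)) has_real_derivative qxv a \<xi> x) (at t)"
proof -
  have lin1: "dir_deriv [v + t *\<^sub>R \<xi>] V x = dir_deriv [v] V x + t * dir_deriv [\<xi>] V x" for t
    using linear_add[OF linear_V1] linear_scale[OF linear_V1] by simp
  have sq: "(v + t *\<^sub>R \<xi>) \<bullet> (v + t *\<^sub>R \<xi>) = v \<bullet> v + 2 * t * (v \<bullet> \<xi>) + t\<^sup>2 * (\<xi> \<bullet> \<xi>)" for t
    by (simp add: algebra_simps inner_commute power2_eq_square)
  have lin2: "dir_deriv [v + t *\<^sub>R \<xi>, a] V x = dir_deriv [v, a] V x + t * dir_deriv [\<xi>, a] V x" for t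
    using linear_add[OF linear_V2] linear_scale[OF linear_V2] by simp
  \<comment> \<open>Differentiating \<open>dir_deriv [v] V\<close> along \<open>a\<close> puts
    \<open>a\<close> at the head of the list; symmetry of second derivatives restores the order used
    in \<open>qx\<close>.\<close>
  show "((\<lambda>t. q (x + t *\<^sub>R a, v)) has_real_derivative qx a (x + t *\<^sub>R a, v)) (at t)"
    unfolding q_def qx_def prod.case V_commute[of v a]
    using pos by (auto intro!: derivative_eq_intros V_line simp del: foldr_Cons)
  show "((\<lambda>t. qx a (x + t *\<^sub>R a, v)) has_real_derivative qxx a (x + t *\<^sub>R a, v)) (at t)"
    unfolding qx_def qxx_def prod.case
    using pos by (auto intro!: derivative_eq_intros V_line simp del: foldr_Cons)
  show "((\<lambda>t. q (x, v + t *\<^sub>R \<xi>)) has_real_derivative qv \<xi> (x, v + t *\<^sub>R \<xi>)) (at t)"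
    unfolding q_def qv_def prod.case lin1 sq
    using pos by (auto intro!: derivative_eq_intros simp del: foldr_Cons simp: field_simps inner_commute inner_add_right)
  show "((\<lambda>t. qv \<xi> (x, v + t *\<^sub>R \<xi>)) has_real_derivative qvv \<xi>) (at t)"
    unfolding qv_def qvv_def prod.case inner_add_left inner_scaleR_left
    using pos by (auto intro!: derivative_eq_intros simp del: foldr_Cons)
  show "((\<lambda>t. qx a (x, v + t *\<^sub>R \<xi>)) has_real_derivative qxv a \<xi> x) (at t)"
    unfolding qx_def qxv_def prod.case lin2
    using pos by (auto intro!: derivative_eq_intros simp del: foldr_Cons simp: algebra_simps)
qed

lemma linear_qx: "linear (\<lambda>a. qx a z)"
proof -
  have "linear (\<lambda>a. dir_deriv [a] V x)" "linear (\<lambda>a. dir_deriv [v, a] V x)" for x v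
    by (rule linear_V1 linear_V2')+
  then show ?thesis
    unfolding qx_def case_prod_beta
    by (auto simp: linear_iff algebra_simps add_divide_distrib diff_divide_distrib simp del: foldr_Cons)
qed

lemma linear_qv: "linear (\<lambda>\<xi>. qv \<xi> z)"
  using linear_V1 unfolding qv_def case_prod_beta
  by (auto simp: linear_iff algebra_simps add_divide_distrib diff_divide_distrib simp del: foldr_Cons)

text \<open>
  \<open>psi\<close> is \<open>exp q\<close>, and \<open>qx\<close>, \<open>qxx\<close>, \<open>qv\<close>, \<open>qvv\<close>, \<open>qxv\<close> are directional derivatives of \<open>q\<close>. The
  dimension enters \<open>K\<close> so that \<open>S R\<close> also dominates the constant of \<open>dir_deriv_bound\<close>.
\<close>

definition K :: real where
  "K = real DIM('n phase) + \<beta> + \<beta> / \<gamma> * C + l * C"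

definition S :: "real \<Rightarrow> real" where
  "S R = K * R ^ (M + 1)"

lemma DIM_le_K: "real DIM('n phase) \<le> K"
  using pos by (simp add: K_def)

lemma K_ge_1: "1 \<le> K"
  using DIM_le_K DIM_positive[where 'a="'n phase"] by linarith

text \<open>The exponent M + 1 in \<open>S\<close> collects M powers from the third derivatives of V
  and one from the velocity in \<open>qxx\<close>. Since \<open>S R\<close> is at least 1, a
  quantity of differential order n can be put in the form (S R)^n times n norms, which makes all
  terms of a Taylor coefficient homogeneous. The last two bounds keep the linear growth in R,
  because they will be exponentiated.\<close>

lemma S_bounds:
  assumes R: "R \<ge> 1 + norm (x, v)"
  shows "\<bar>qx a (x, v)\<bar> \<le> S R * norm a" "\<bar>qxx a (x, v)\<bar> \<le> (S R * norm a)\<^sup>2"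
    "\<bar>qv \<xi> (x, v)\<bar> \<le> S R * norm \<xi>" "\<bar>qvv \<xi>\<bar> \<le> (S R * norm \<xi>)\<^sup>2"
    "\<bar>qxv a \<xi> x\<bar> \<le> (S R * norm a) * (S R * norm \<xi>)"
    "1 \<le> S R"
    "\<bar>qx a (x, v)\<bar> \<le> K * R * norm a" "\<bar>qv \<xi> (x, v)\<bar> \<le> K * R * norm \<xi>"
proof -
  have nx: "1 + norm x \<le> R" and nv: "norm v \<le> R" "1 \<le> R"
    using R norm_fst_le[of x v] norm_snd_le[of v x] norm_ge_zero[of "(x, v)"] by linarith+
  have A: "0 \<le> \<beta> / \<gamma> * C" "0 \<le> l * C" "0 < \<beta>" "0 \<le> \<beta> / \<gamma>"
    using pos by auto
  note K1 = K_ge_1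
  have tri: "\<bar>- (c * a + d * b) / 2\<bar> \<le> (c * \<bar>a\<bar> + d * \<bar>b\<bar>) / 2" if "0 \<le> c" "0 \<le> d" for a b c d :: real
    using abs_triangle_ineq[of "c * a" "d * b"] that by (simp add: abs_mult)
  have RM: "R \<le> R ^ (M + 1)" "1 \<le> R ^ M" "1 \<le> R ^ (M + 1)"
    using nv one_le_power[of R M] one_le_power[of R "M + 1"] self_le_power[of R "M + 1"] by simp_all
  have SK: "S R = K * R ^ (M + 1)" by (simp add: S_def)
  have KR: "K * R \<le> S R" unfolding SK using RM K1 by (intro mult_left_mono) auto
  show S1: "1 \<le> S R" unfolding SK using K1 RM mult_mono[of 1 K 1 "R ^ (M+1)"] by simp
  have KS: "K \<le> S R" using KR nv K1 mult_left_mono[of 1 R K] by linarith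
  have S2: "S R \<le> S R * S R" using S1 by simp
  have half: "(a + b) / 2 \<le> c + d" if "a \<le> c" "b \<le> d" "0 \<le> a" "0 \<le> b" for a b c d :: real
    using that by (simp add: field_simps)
  have d1: "\<bar>dir_deriv [u] V x\<bar> \<le> C * R * norm u" for u
    using V1[of u x] nx pos by (rule_tac order_trans[OF V1]) (intro mult_right_mono mult_left_mono; simp)
  have d3: "\<bar>dir_deriv [u, v', w] V x\<bar> \<le> C * R ^ M * norm u * norm v' * norm w" for u v' w
    using nx pos by (rule_tac order_trans[OF V3]) (intro mult_right_mono mult_left_mono power_mono; simp)
  have d2v: "\<bar>dir_deriv [v, a] V x\<bar> \<le> C * R * norm a"
    using nv pos by (rule_tac order_trans[OF V2]) (intro mult_right_mono mult_left_mono; simp)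
  have "\<bar>qx a (x, v)\<bar> \<le> (l * \<bar>dir_deriv [a] V x\<bar> + \<beta> / \<gamma> * \<bar>dir_deriv [v, a] V x\<bar>) / 2"
    unfolding qx_def prod.case by (rule tri) (use A pos in auto)
  also have "\<dots> \<le> l * (C * R * norm a) + \<beta> / \<gamma> * (C * R * norm a)"
    by (intro half mult_left_mono d1 d2v mult_nonneg_nonneg) (use A pos in auto)
  also have "\<dots> = (l * C + \<beta> / \<gamma> * C) * R * norm a" by (simp add: algebra_simps)
  also have "\<dots> \<le> K * R * norm a"
    using A nv by (intro mult_right_mono) (auto simp: K_def)
  finally show "\<bar>qx a (x, v)\<bar> \<le> K * R * norm a" .
  also have "\<dots> \<le> S R * norm a" using KR by (intro mult_right_mono) auto
  finally show "\<bar>qx a (x, v)\<bar> \<le> S R * norm a" .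
  have "\<bar>qxx a (x, v)\<bar> \<le> (l * \<bar>dir_deriv [a, a] V x\<bar> + \<beta> / \<gamma> * \<bar>dir_deriv [a, v, a] V x\<bar>) / 2"
    unfolding qxx_def prod.case by (rule tri) (use A pos in auto)
  also have "\<dots> \<le> l * (C * R ^ (M + 1) * norm a * norm a) + \<beta> / \<gamma> * (C * R ^ (M + 1) * norm a * norm a)"
  proof -
    have "\<bar>dir_deriv [a, v, a] V x\<bar> \<le> C * R ^ M * norm a * norm v * norm a" by (rule d3)
    also have "\<dots> \<le> C * R ^ M * norm a * R * norm a"
      using nv pos by (intro mult_right_mono mult_left_mono) auto
    finally have 1: "\<bar>dir_deriv [a, v, a] V x\<bar> \<le> C * R ^ (M + 1) * norm a * norm a" by (simp add: mult_ac)
    have "\<bar>dir_deriv [a, a] V x\<bar> \<le> C * 1 * norm a * norm a" using V2[of a a x] by simp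
    also have "\<dots> \<le> C * R ^ (M + 1) * norm a * norm a"
      using RM pos by (intro mult_right_mono mult_left_mono) auto
    finally have 2: "\<bar>dir_deriv [a, a] V x\<bar> \<le> C * R ^ (M + 1) * norm a * norm a" .
    show ?thesis
      by (intro half mult_left_mono 1 2 mult_nonneg_nonneg) (use A pos in auto)
  qed
  also have "\<dots> = (l * C + \<beta> / \<gamma> * C) * R ^ (M + 1) * (norm a * norm a)" by (simp add: algebra_simps)
  also have "\<dots> \<le> K * R ^ (M + 1) * (norm a * norm a)"
    using A nv by (intro mult_right_mono) (auto simp: K_def)
  also have "\<dots> = S R * (norm a * norm a)" by (simp add: SK)
  also have "\<dots> \<le> S R * S R * (norm a * norm a)" using S2 by (intro mult_right_mono) auto
  finally show "\<bar>qxx a (x, v)\<bar> \<le> (S R * norm a)\<^sup>2" by (simp add: power2_eq_square mult_ac)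
  have "\<bar>qv \<xi> (x, v)\<bar> \<le> (\<beta> / \<gamma> * \<bar>dir_deriv [\<xi>] V x\<bar> + \<beta> * \<bar>v \<bullet> \<xi>\<bar>) / 2"
    unfolding qv_def prod.case by (rule tri) (use A in auto)
  also have "\<dots> \<le> \<beta> / \<gamma> * (C * R * norm \<xi>) + \<beta> * (R * norm \<xi>)"
  proof -
    have vx: "\<bar>v \<bullet> \<xi>\<bar> \<le> R * norm \<xi>"
      by (rule order_trans[OF Cauchy_Schwarz_ineq2]) (use nv in \<open>auto intro: mult_right_mono\<close>)
    show ?thesis
      by (intro half mult_left_mono d1 vx mult_nonneg_nonneg) (use A in auto)
  qed
  also have "\<dots> = (\<beta> / \<gamma> * C + \<beta>) * R * norm \<xi>" by (simp add: algebra_simps)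
  also have "\<dots> \<le> K * R * norm \<xi>"
    using A nv by (intro mult_right_mono) (auto simp: K_def)
  finally show "\<bar>qv \<xi> (x, v)\<bar> \<le> K * R * norm \<xi>" .
  also have "\<dots> \<le> S R * norm \<xi>" using KR by (intro mult_right_mono) auto
  finally show "\<bar>qv \<xi> (x, v)\<bar> \<le> S R * norm \<xi>" .
  have "\<beta> \<le> K" "\<beta> / \<gamma> * C \<le> K" using A by (simp_all add: K_def)
  then have B: "\<beta> \<le> S R * S R" "\<beta> / \<gamma> * C \<le> S R * S R"
    using KS S2 by (meson order_trans)+
  then have B2: "\<beta> / 2 \<le> S R * S R" using A(3) by simp
  have "\<bar>qvv \<xi>\<bar> = \<beta> / 2 * (norm \<xi>)\<^sup>2"
    using pos by (simp add: qvv_def abs_mult power2_norm_eq_inner)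
  also have "\<dots> \<le> S R * S R * (norm \<xi>)\<^sup>2"
    using B B2 by (intro mult_right_mono) auto
  finally show "\<bar>qvv \<xi>\<bar> \<le> (S R * norm \<xi>)\<^sup>2" by (simp add: power2_eq_square mult_ac)
  have "\<bar>qxv a \<xi> x\<bar> = \<beta> / \<gamma> * \<bar>dir_deriv [\<xi>, a] V x\<bar> / 2"
    using pos by (simp add: qxv_def abs_mult del: foldr_Cons)
  also have "\<dots> \<le> \<beta> / \<gamma> * (C * norm \<xi> * norm a)"
    using half[OF mult_left_mono[OF V2[of \<xi> a x] A(4)] order_refl[of 0]
      mult_nonneg_nonneg[OF A(4) abs_ge_zero]] by (simp only: add_0_right order_refl simp_thms)
  also have "\<dots> = \<beta> / \<gamma> * C * (norm \<xi> * norm a)" by simp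
  also have "\<dots> \<le> S R * S R * (norm \<xi> * norm a)"
    using B B2 by (intro mult_right_mono) auto
  finally show "\<bar>qxv a \<xi> x\<bar> \<le> (S R * norm a) * (S R * norm \<xi>)" by (simp add: mult_ac)
qed

text \<open>Two mean value steps along an L-shaped path: in position at the new velocity, then in
  velocity at the old position. Neither leg leaves the ball, and each costs K R delta. The bound is
  exponentiated later, so it must be linear in R: R delta is then quadratic in |z| and the
  noise.\<close>

lemma q_lipschitz:
  assumes "norm (z' - z) \<le> \<delta>" and R: "R \<ge> 1 + norm z + \<delta>"
  shows "\<bar>q z' - q z\<bar> \<le> 2 * K * R * \<delta>"
proof -
  obtain x v x' v' where z: "z = (x, v)" "z' = (x', v')" by (metis surj_pair)
  have d: "norm (x' - x) \<le> \<delta>" "norm (v' - v) \<le> \<delta>"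
    using assms(1) norm_fst_le[of "x' - x" "v' - v"] norm_snd_le[of "v' - v" "x' - x"] unfolding z by auto
  have \<delta>0: "\<delta> \<ge> 0" using assms(1) norm_ge_zero order_trans by blast
  have seg1: "norm (x + t *\<^sub>R (x' - x), v') \<le> R - 1" if "0 < t" "t < 1" for t
  proof -
    have "norm ((x + t *\<^sub>R (x' - x), v') - z) \<le> norm (z' - z)"
      unfolding z using that by (auto simp: norm_Pair power_mult_distrib intro!: mult_left_le_one_le power_le_one)
    then show ?thesis using assms norm_triangle_sub[of "(x + t *\<^sub>R (x' - x), v')" z] by simp
  qed
  have seg2: "norm (x, v + t *\<^sub>R (v' - v)) \<le> R - 1" if "0 < t" "t < 1" for t
  proof -
    have "norm ((x, v + t *\<^sub>R (v' - v)) - z) \<le> norm (v' - v)"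
      unfolding z using that by (auto simp: norm_Pair mult_left_le_one_le)
    then show ?thesis using assms d norm_triangle_sub[of "(x, v + t *\<^sub>R (v' - v))" z] by simp
  qed
  obtain t where t: "0 < t" "t < 1" "q (x + 1 *\<^sub>R (x' - x), v') - q (x + 0 *\<^sub>R (x' - x), v')
      = (1 - 0) * qx (x' - x) (x + t *\<^sub>R (x' - x), v')"
    using MVT2[of 0 1 "\<lambda>t. q (x + t *\<^sub>R (x' - x), v')", OF _ q_deriv(1)] by auto
  obtain s where s: "0 < s" "s < 1" "q (x, v + 1 *\<^sub>R (v' - v)) - q (x, v + 0 *\<^sub>R (v' - v))
      = (1 - 0) * qv (v' - v) (x, v + s *\<^sub>R (v' - v))"
    using MVT2[of 0 1 "\<lambda>t. q (x, v + t *\<^sub>R (v' - v))", OF _ q_deriv(3)] by auto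
  have "\<bar>q z' - q (x, v')\<bar> \<le> K * R * norm (x' - x)"
    using t(3) S_bounds(7)[of "x + t *\<^sub>R (x' - x)" v' R] seg1[OF t(1,2)] by (simp add: z)
  moreover have "\<bar>q (x, v') - q z\<bar> \<le> K * R * norm (v' - v)"
    using s(3) S_bounds(8)[of x "v + s *\<^sub>R (v' - v)" R] seg2[OF s(1,2)] by (simp add: z)
  moreover have "0 \<le> K * R"
    using K_ge_1 R \<delta>0 by (intro mult_nonneg_nonneg) (auto intro: order_trans[OF _ R])
  then have "K * R * norm (x' - x) \<le> K * R * \<delta>" "K * R * norm (v' - v) \<le> K * R * \<delta>"
    using d by (auto intro: mult_left_mono)
  ultimately show ?thesis by linarith
qed

end

subsection \<open>Pointwise expansion of \<open>f * psi\<close>\<close>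

lemma abs_mult_le:
  fixes a b :: real
  shows "\<bar>a\<bar> \<le> A \<Longrightarrow> \<bar>b\<bar> \<le> B \<Longrightarrow> \<bar>a * b\<bar> \<le> A * B"
  unfolding abs_mult by (intro mult_mono) auto

lemma abs_sum5_le:
  fixes A B D E F :: real
  assumes "\<bar>A\<bar> \<le> a" "\<bar>B\<bar> \<le> b" "\<bar>D\<bar> \<le> d" "\<bar>E\<bar> \<le> e" "\<bar>F\<bar> \<le> g"
  shows "\<bar>A + B + D + E + F\<bar> \<le> a + b + d + e + g"
  using assms by linarith

text \<open>The quantity estimated is the second derivative of r exp q along a line, with r0, r1, r2
  the derivatives of r and P, c those of q. The weight 2 of \<open>c0\<close> comes from |P^2 + c|
  <= 2 eta^2.\<close>

lemma exp_deriv2_bound: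
  fixes e :: real
  assumes r: "\<bar>r0\<bar> \<le> c0 * X" "\<bar>r1\<bar> \<le> c1 * X * \<eta>" "\<bar>r2\<bar> \<le> c2 * X * \<eta>\<^sup>2"
    and P: "\<bar>P\<bar> \<le> \<eta>" "\<bar>c\<bar> \<le> \<eta>\<^sup>2" and e: "0 \<le> e" "e \<le> \<Psi>"
  shows "\<bar>(r2 + 2 * r1 * P + r0 * (P\<^sup>2 + c)) * e\<bar> \<le> (c2 + 2 * c1 + 2 * c0) * X * \<eta>\<^sup>2 * \<Psi>"
proof -
  have "\<bar>P\<^sup>2\<bar> \<le> \<eta>\<^sup>2" using power_mono[OF P(1), of 2] by simp
  then have 1: "\<bar>P\<^sup>2 + c\<bar> \<le> 2 * \<eta>\<^sup>2" using P(2) by linarith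
  have "\<bar>r1 * P\<bar> \<le> c1 * X * \<eta> * \<eta>" by (intro abs_mult_le r P)
  moreover have "\<bar>r0 * (P\<^sup>2 + c)\<bar> \<le> c0 * X * (2 * \<eta>\<^sup>2)" by (intro abs_mult_le r 1)
  ultimately have "\<bar>r2 + 2 * r1 * P + r0 * (P\<^sup>2 + c)\<bar> \<le> c2 * X * \<eta>\<^sup>2 + 2 * (c1 * X * \<eta> * \<eta>) + c0 * X * (2 * \<eta>\<^sup>2)"
    using r(3) by (auto simp: abs_le_iff)
  then have "\<bar>(r2 + 2 * r1 * P + r0 * (P\<^sup>2 + c)) * e\<bar> \<le> (c2 * X * \<eta>\<^sup>2 + 2 * (c1 * X * \<eta> * \<eta>) + c0 * X * (2 * \<eta>\<^sup>2)) * \<Psi>"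
    by (rule abs_mult_le) (use e in simp)
  then show ?thesis by (simp add: algebra_simps power2_eq_square)
qed

text \<open>The fourth derivative of f exp q for q quadratic along the line: the coefficients are
  the complete Bell polynomials in P = q' and c = q'', higher derivatives of q being zero. They are
  at most 1, 1, 2, 4, 10 times powers of eta, and 43 = 1 + 4 + 6 * 2 + 4 * 4 + 10.\<close>

lemma exp_deriv4_bound:
  fixes e :: real
  assumes f: "\<bar>f0\<bar> \<le> \<Phi>" "\<bar>f1\<bar> \<le> \<Phi> * \<eta>" "\<bar>f2\<bar> \<le> \<Phi> * \<eta>\<^sup>2" "\<bar>f3\<bar> \<le> \<Phi> * \<eta> ^ 3" "\<bar>f4\<bar> \<le> \<Phi> * \<eta> ^ 4"
    and P: "\<bar>P\<bar> \<le> \<eta>" "\<bar>c\<bar> \<le> \<eta>\<^sup>2" and e: "0 \<le> e" "e \<le> \<Psi>"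
  shows "\<bar>(f4 + 4 * (f3 * P) + 6 * (f2 * (P\<^sup>2 + c)) + 4 * (f1 * (P ^ 3 + 3 * (P * c)))
      + f0 * (P ^ 4 + 6 * (P\<^sup>2 * c) + 3 * c\<^sup>2)) * e\<bar> \<le> 43 * \<Phi> * \<eta> ^ 4 * \<Psi>"
proof -
  have P2: "\<bar>P\<^sup>2\<bar> \<le> \<eta>\<^sup>2" "\<bar>P ^ 3\<bar> \<le> \<eta> ^ 3" "\<bar>P ^ 4\<bar> \<le> \<eta> ^ 4" "\<bar>c\<^sup>2\<bar> \<le> (\<eta>\<^sup>2)\<^sup>2"
    using power_mono[OF P(1), of 2] power_mono[OF P(1), of 3] power_mono[OF P(1), of 4] power_mono[OF P(2), of 2]
    by (simp_all add: power_abs)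
  have 1: "\<bar>P\<^sup>2 + c\<bar> \<le> 2 * \<eta>\<^sup>2" using P(2) P2(1) by linarith
  have "\<bar>P * c\<bar> \<le> \<eta> * \<eta>\<^sup>2" by (intro abs_mult_le P)
  then have 2: "\<bar>P ^ 3 + 3 * (P * c)\<bar> \<le> 4 * \<eta> ^ 3"
    using P2(2) by (auto simp: abs_le_iff power3_eq_cube power2_eq_square mult.assoc)
  have "\<bar>P\<^sup>2 * c\<bar> \<le> \<eta>\<^sup>2 * \<eta>\<^sup>2" by (intro abs_mult_le P P2)
  moreover have "\<eta>\<^sup>2 * \<eta>\<^sup>2 = \<eta> ^ 4" "(\<eta>\<^sup>2)\<^sup>2 = \<eta> ^ 4"
    by (simp_all flip: power_add power_mult)
  ultimately have 3: "\<bar>P ^ 4 + 6 * (P\<^sup>2 * c) + 3 * c\<^sup>2\<bar> \<le> 10 * \<eta> ^ 4"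
    using P2(3,4) by linarith
  have "\<bar>f3 * P\<bar> \<le> \<Phi> * \<eta> ^ 3 * \<eta>" by (intro abs_mult_le f P)
  moreover have "\<bar>f2 * (P\<^sup>2 + c)\<bar> \<le> \<Phi> * \<eta>\<^sup>2 * (2 * \<eta>\<^sup>2)" by (intro abs_mult_le f 1)
  moreover have "\<bar>f1 * (P ^ 3 + 3 * (P * c))\<bar> \<le> \<Phi> * \<eta> * (4 * \<eta> ^ 3)" by (intro abs_mult_le f 2)
  moreover have "\<bar>f0 * (P ^ 4 + 6 * (P\<^sup>2 * c) + 3 * c\<^sup>2)\<bar> \<le> \<Phi> * (10 * \<eta> ^ 4)" by (intro abs_mult_le f 3)
  moreover have "\<Phi> * \<eta> ^ 3 * \<eta> = \<Phi> * \<eta> ^ 4" "\<Phi> * \<eta>\<^sup>2 * (2 * \<eta>\<^sup>2) = 2 * (\<Phi> * \<eta> ^ 4)"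
    "\<Phi> * \<eta> * (4 * \<eta> ^ 3) = 4 * (\<Phi> * \<eta> ^ 4)" "\<Phi> * (10 * \<eta> ^ 4) = 10 * (\<Phi> * \<eta> ^ 4)"
    by (simp_all add: eval_nat_numeral)
  ultimately have "\<bar>f4 + 4 * (f3 * P) + 6 * (f2 * (P\<^sup>2 + c)) + 4 * (f1 * (P ^ 3 + 3 * (P * c)))
      + f0 * (P ^ 4 + 6 * (P\<^sup>2 * c) + 3 * c\<^sup>2)\<bar> \<le> 43 * (\<Phi> * \<eta> ^ 4)"
    using f(5) by linarith
  then have "\<bar>(f4 + 4 * (f3 * P) + 6 * (f2 * (P\<^sup>2 + c)) + 4 * (f1 * (P ^ 3 + 3 * (P * c)))
      + f0 * (P ^ 4 + 6 * (P\<^sup>2 * c) + 3 * c\<^sup>2)) * e\<bar> \<le> 43 * (\<Phi> * \<eta> ^ 4) * \<Psi>"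
    by (rule abs_mult_le) (use e in simp)
  then show ?thesis by (simp add: mult.assoc)
qed

context potential
begin

text \<open>The derivative of f exp q in the position direction \<open>a\<close>; \<open>gvv\<close>
  is the second derivative in a velocity direction. Both keep exp q as an outer factor, which later
  cancels in the quotient.\<close>

definition gx :: "('n phase \<Rightarrow> real) \<Rightarrow> real^'n \<Rightarrow> 'n phase \<Rightarrow> real" where
  "gx f a z = (dir_deriv [(a, 0)] f z + f z * qx a z) * exp (q z)"

definition gvv :: "('n phase \<Rightarrow> real) \<Rightarrow> real^'n \<Rightarrow> 'n phase \<Rightarrow> real" where
  "gvv f \<xi> z = (dir_deriv [(0, \<xi>), (0, \<xi>)] f z + 2 * dir_deriv [(0, \<xi>)] f z * qv \<xi> z
     + f z * ((qv \<xi> z)\<^sup>2 + qvv \<xi>)) * exp (q z)"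

text \<open>Everything local to the ball of radius \<open>\<delta>\<close> around \<open>z\<close>:
  \<open>\<Phi>\<close> bounds \<open>f\<close> with a factor \<open>S R * norm u\<close> per
  direction, the rate used for the derivatives of \<open>q\<close>, and \<open>\<Psi>\<close> bounds
  exp q.\<close>

context
  fixes f :: "'n phase \<Rightarrow> real" and \<Phi> \<Psi> R \<delta> :: real and z :: "'n phase"
  assumes f: "C_k 4 f"
    and f_bound: "\<And>z' us. norm (z' - z) \<le> \<delta> \<Longrightarrow> length us \<le> 4 \<Longrightarrow>
      \<bar>dir_deriv us f z'\<bar> \<le> \<Phi> * prod_list (map (\<lambda>u. S R * norm u) us)"
    and q_bound: "\<And>z'. norm (z' - z) \<le> \<delta> \<Longrightarrow> exp (q z') \<le> \<Psi>"
    and R: "R \<ge> 1 + norm z + \<delta>"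
begin

lemma near: "norm (z' - z) \<le> \<delta> \<Longrightarrow> 1 + norm z' \<le> R"
  using R norm_triangle_sub[of z' z] by simp

lemma f_line_x:
  assumes "length us < 4"
  shows "((\<lambda>t. dir_deriv us f (x + t *\<^sub>R a, v)) has_real_derivative dir_deriv ((a, 0) # us) f (x + t *\<^sub>R a, v)) (at t)"
  using dir_deriv_line[OF f assms, of "(x, v)" "(a, 0)"] by simp

lemma f_line_v:
  assumes "length us < 4"
  shows "((\<lambda>t. dir_deriv us f (x, v + t *\<^sub>R \<xi>)) has_real_derivative dir_deriv ((0, \<xi>) # us) f (x, v + t *\<^sub>R \<xi>)) (at t)"
  using dir_deriv_line[OF f assms, of "(x, v)" "(0, \<xi>)"] by simp

text \<open>Second order suffices here, the position displacement being O(h). The 5 is 1 + 2 + 2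
  from \<open>exp_deriv2_bound\<close> with all three constants 1, halved by the Taylor
  remainder.\<close>

lemma expansion_x:
  assumes near': "\<And>t. \<bar>t\<bar> \<le> 1 \<Longrightarrow> norm ((x + t *\<^sub>R a, v) - z) \<le> \<delta>"
  shows "\<bar>f (x + a, v) * exp (q (x + a, v)) - f (x, v) * exp (q (x, v)) - gx f a (x, v)\<bar> \<le> 5 / 2 * \<Phi> * \<Psi> * (S R * norm a)\<^sup>2"
proof -
  let ?p = "\<lambda>t. (x + t *\<^sub>R a, v)"
  let ?f1 = "dir_deriv [(a, 0)] f" and ?f2 = "dir_deriv [(a, 0), (a, 0)] f"
  let ?g1 = "\<lambda>t. (?f1 (?p t) + f (?p t) * qx a (?p t)) * exp (q (?p t))"
  let ?g2 = "\<lambda>t. (?f2 (?p t) + 2 * ?f1 (?p t) * qx a (?p t) + f (?p t) * ((qx a (?p t))\<^sup>2 + qxx a (?p t))) * exp (q (?p t))"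
  note d = f_line_x[of "[]" x a v] f_line_x[of "[(a, 0)]" x a v] q_deriv(1,2)[where x=x and a=a and v=v]
  have "\<bar>f (?p 1) * exp (q (?p 1)) - f (?p 0) * exp (q (?p 0)) - ?g1 0\<bar> \<le> (5 * \<Phi> * (S R * norm a)\<^sup>2 * \<Psi>) / 2"
  proof (rule taylor2_bound)
    show "((\<lambda>t. f (?p t) * exp (q (?p t))) has_real_derivative ?g1 t) (at t)" for t
      using d(1)[of t] by (auto intro!: derivative_eq_intros d simp: algebra_simps)
    show "(?g1 has_real_derivative ?g2 t) (at t)" for t
      using d(1)[of t] d(2)[of t]
      by (auto intro!: derivative_eq_intros d simp: algebra_simps power2_eq_square)
    fix t :: real assume "\<bar>t\<bar> \<le> 1"
    then have n: "norm (?p t - z) \<le> \<delta>" by (rule near')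
    have "\<bar>?g2 t\<bar> \<le> (1 + 2 * 1 + 2 * 1) * \<Phi> * (S R * norm a)\<^sup>2 * \<Psi>"
      using f_bound[OF n, of "[]"] f_bound[OF n, of "[(a, 0)]"] f_bound[OF n, of "[(a, 0), (a, 0)]"]
        S_bounds[OF near[OF n]] q_bound[OF n]
      by (intro exp_deriv2_bound) (auto simp: power2_eq_square algebra_simps)
    then show "\<bar>?g2 t\<bar> \<le> 5 * \<Phi> * (S R * norm a)\<^sup>2 * \<Psi>" by simp
  qed
  then show ?thesis by (simp add: gx_def mult_ac)
qed

lemma expansion_vv:
  assumes near': "\<And>t. \<bar>t\<bar> \<le> 1 \<Longrightarrow> norm ((x, v + t *\<^sub>R \<xi>) - z) \<le> \<delta>"
  shows "\<bar>f (x, v + \<xi>) * exp (q (x, v + \<xi>)) + f (x, v - \<xi>) * exp (q (x, v - \<xi>)) - 2 * (f (x, v) * exp (q (x, v))) - gvv f \<xi> (x, v)\<bar>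
    \<le> 43 / 12 * \<Phi> * \<Psi> * (S R * norm \<xi>) ^ 4"
proof -
  let ?p = "\<lambda>t. (x, v + t *\<^sub>R \<xi>)"
  let ?u = "(0, \<xi>) :: 'n phase"
  let ?f1 = "\<lambda>t. dir_deriv [?u] f (?p t)" and ?f2 = "\<lambda>t. dir_deriv [?u, ?u] f (?p t)"
    and ?f3 = "\<lambda>t. dir_deriv [?u, ?u, ?u] f (?p t)" and ?f4 = "\<lambda>t. dir_deriv [?u, ?u, ?u, ?u] f (?p t)"
  let ?P = "\<lambda>t. qv \<xi> (?p t)" and ?c = "qvv \<xi>"
  \<comment> \<open>Successive derivatives along the line. Since P' = c and c' = 0, the coefficients
    stay polynomial in P and c.\<close>
  let ?g0 = "\<lambda>t. f (?p t) * exp (q (?p t))"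
  let ?g1 = "\<lambda>t. (?f1 t + f (?p t) * ?P t) * exp (q (?p t))"
  let ?g2 = "\<lambda>t. (?f2 t + 2 * ?f1 t * ?P t + f (?p t) * ((?P t)\<^sup>2 + ?c)) * exp (q (?p t))"
  let ?g3 = "\<lambda>t. (?f3 t + 3 * (?f2 t * ?P t) + 3 * (?f1 t * ((?P t)\<^sup>2 + ?c)) + f (?p t) * (?P t ^ 3 + 3 * (?P t * ?c))) * exp (q (?p t))"
  let ?g4 = "\<lambda>t. (?f4 t + 4 * (?f3 t * ?P t) + 6 * (?f2 t * ((?P t)\<^sup>2 + ?c)) + 4 * (?f1 t * (?P t ^ 3 + 3 * (?P t * ?c)))
      + f (?p t) * (?P t ^ 4 + 6 * ((?P t)\<^sup>2 * ?c) + 3 * ?c\<^sup>2)) * exp (q (?p t))"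
  have d0: "((\<lambda>t. f (?p t)) has_real_derivative ?f1 t) (at t)" for t
    using f_line_v[of "[]" x v \<xi> t] by simp
  have d1: "(?f1 has_real_derivative ?f2 t) (at t)" "(?f2 has_real_derivative ?f3 t) (at t)"
    "(?f3 has_real_derivative ?f4 t) (at t)" for t
    by (rule f_line_v; simp)+
  note d = d0 d1 q_deriv(3,4)[where x=x and v=v and \<xi>=\<xi>]
  have "\<bar>?g0 1 + ?g0 (- 1) - 2 * ?g0 0 - ?g2 0\<bar> \<le> (43 * \<Phi> * (S R * norm \<xi>) ^ 4 * \<Psi>) / 12"
  proof (rule taylor4_symmetric_bound)
    show "(?g0 has_real_derivative ?g1 t) (at t)" for t
      by (auto intro!: derivative_eq_intros d simp: algebra_simps simp del: foldr_Cons)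
    show "(?g1 has_real_derivative ?g2 t) (at t)" for t
      by (auto intro!: derivative_eq_intros d simp: algebra_simps power2_eq_square simp del: foldr_Cons)
    show "(?g2 has_real_derivative ?g3 t) (at t)" for t
      by (auto intro!: derivative_eq_intros d simp: algebra_simps power2_eq_square power3_eq_cube simp del: foldr_Cons)
    show "(?g3 has_real_derivative ?g4 t) (at t)" for t
      by (auto intro!: derivative_eq_intros d simp: algebra_simps eval_nat_numeral simp del: foldr_Cons)
    fix t :: real assume "\<bar>t\<bar> \<le> 1"
    then have n: "norm (?p t - z) \<le> \<delta>" by (rule near')
    note S = S_bounds[OF near[OF n]]
    have b: "\<bar>f (?p t)\<bar> \<le> \<Phi>" "\<bar>?f1 t\<bar> \<le> \<Phi> * (S R * norm \<xi>)" "\<bar>?f2 t\<bar> \<le> \<Phi> * (S R * norm \<xi>)\<^sup>2"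
      "\<bar>?f3 t\<bar> \<le> \<Phi> * (S R * norm \<xi>) ^ 3" "\<bar>?f4 t\<bar> \<le> \<Phi> * (S R * norm \<xi>) ^ 4"
      using f_bound[OF n, of "[]"] f_bound[OF n, of "[?u]"] f_bound[OF n, of "[?u, ?u]"]
        f_bound[OF n, of "[?u, ?u, ?u]"] f_bound[OF n, of "[?u, ?u, ?u, ?u]"]
      by (auto simp: eval_nat_numeral mult_ac)
    show "\<bar>?g4 t\<bar> \<le> 43 * \<Phi> * (S R * norm \<xi>) ^ 4 * \<Psi>"
      by (rule exp_deriv4_bound[OF b S(3) S(4)]) (use q_bound[OF n] in auto)
  qed
  then show ?thesis by (simp add: gvv_def mult_ac)
qed

context
  fixes x v a \<xi> :: "real^'n"
  assumes near': "\<And>t. \<bar>t\<bar> \<le> 1 \<Longrightarrow> norm ((x, v + t *\<^sub>R \<xi>) - z) \<le> \<delta>"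
begin

text \<open>Removes the velocity shift from \<open>gx\<close>. The even combination is used with a =
  w, which carries a factor h, so an error |xi|^2 is affordable; the odd one is used with a = b, of
  order h^(3/2), and supplies the missing |xi|.\<close>

lemma expansion_xv:
  shows "\<bar>gx f a (x, v + \<xi>) + gx f a (x, v - \<xi>) - 2 * gx f a (x, v)\<bar> \<le> 14 * \<Phi> * \<Psi> * (S R * norm a) * (S R * norm \<xi>)\<^sup>2"
    and "\<bar>gx f a (x, v + \<xi>) - gx f a (x, v - \<xi>)\<bar> \<le> 10 * \<Phi> * \<Psi> * (S R * norm a) * (S R * norm \<xi>)"
proof -
  let ?p = "\<lambda>t. (x, v + t *\<^sub>R \<xi>)"
  let ?u = "(0, \<xi>) :: 'n phase" and ?ax = "(a, 0) :: 'n phase"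
  let ?f0 = "\<lambda>t. f (?p t)" and ?f1 = "\<lambda>t. dir_deriv [?u] f (?p t)" and ?f2 = "\<lambda>t. dir_deriv [?u, ?u] f (?p t)"
    and ?da = "\<lambda>t. dir_deriv [?ax] f (?p t)"
    and ?db = "\<lambda>t. dir_deriv [?u, ?ax] f (?p t)" and ?dc = "\<lambda>t. dir_deriv [?u, ?u, ?ax] f (?p t)"
  let ?Q = "\<lambda>t. qx a (?p t)" and ?Q1 = "qxv a \<xi> x"
  let ?P = "\<lambda>t. qv \<xi> (?p t)" and ?c = "qvv \<xi>"
  \<comment> \<open>\<open>gx\<close> is r0 exp q, and r1, r2 are the velocity derivatives of r0. No
    second velocity derivative of \<open>qx a\<close> occurs, as it is affine in the
    velocity.\<close>
  let ?r0 = "\<lambda>t. ?da t + ?f0 t * ?Q t" and ?r1 = "\<lambda>t. ?db t + ?f1 t * ?Q t + ?f0 t * ?Q1"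
    and ?r2 = "\<lambda>t. ?dc t + ?f2 t * ?Q t + 2 * (?f1 t * ?Q1)"
  let ?g0 = "\<lambda>t. ?r0 t * exp (q (?p t))"
  let ?g1 = "\<lambda>t. (?r1 t + ?r0 t * ?P t) * exp (q (?p t))"
  let ?g2 = "\<lambda>t. (?r2 t + 2 * ?r1 t * ?P t + ?r0 t * ((?P t)\<^sup>2 + ?c)) * exp (q (?p t))"
  let ?\<eta> = "S R * norm \<xi>" and ?X = "\<Phi> * (S R * norm a)"
  have d0: "(?f0 has_real_derivative ?f1 t) (at t)" for t
    using f_line_v[of "[]" x v \<xi> t] by simp
  have d1: "(?f1 has_real_derivative ?f2 t) (at t)"
    "(?da has_real_derivative ?db t) (at t)" "(?db has_real_derivative ?dc t) (at t)" for t
    by (rule f_line_v; simp)+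
  note d = d0 d1 q_deriv(3,4)[where x=x and v=v and \<xi>=\<xi>] q_deriv(5)[where a=a and x=x and v=v and \<xi>=\<xi>]
  have g0: "(?g0 has_real_derivative ?g1 t) (at t)" for t
    by (auto intro!: derivative_eq_intros d simp: algebra_simps simp del: foldr_Cons)
  have g1: "(?g1 has_real_derivative ?g2 t) (at t)" for t
    by (auto intro!: derivative_eq_intros d simp: algebra_simps power2_eq_square simp del: foldr_Cons)
  \<comment> \<open>Counting summands gives 2, 3 and 4. Hence 4 + 2 * 3 + 2 * 2 = 14 in the even
    bound, and 2 * (3 + 2) = 10 in the odd one.\<close>
  have b: "\<bar>?r0 t\<bar> \<le> 2 * ?X" "\<bar>?r1 t\<bar> \<le> 3 * ?X * ?\<eta>" "\<bar>?r2 t\<bar> \<le> 4 * ?X * ?\<eta>\<^sup>2"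
    "\<bar>?P t\<bar> \<le> ?\<eta>" "\<bar>?c\<bar> \<le> ?\<eta>\<^sup>2" "exp (q (?p t)) \<le> \<Psi>" if "\<bar>t\<bar> \<le> 1" for t
  proof -
    have n: "norm (?p t - z) \<le> \<delta>" using that by (rule near')
    note S = S_bounds[OF near[OF n]]
    show "\<bar>?P t\<bar> \<le> ?\<eta>" "\<bar>?c\<bar> \<le> ?\<eta>\<^sup>2" "exp (q (?p t)) \<le> \<Psi>"
      using S q_bound[OF n] by auto
    have fb: "\<bar>?f0 t\<bar> \<le> \<Phi>" "\<bar>?f1 t\<bar> \<le> \<Phi> * ?\<eta>" "\<bar>?f2 t\<bar> \<le> \<Phi> * ?\<eta>\<^sup>2"
      "\<bar>?da t\<bar> \<le> ?X" "\<bar>?db t\<bar> \<le> ?X * ?\<eta>" "\<bar>?dc t\<bar> \<le> ?X * ?\<eta>\<^sup>2"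
      using f_bound[OF n, of "[]"] f_bound[OF n, of "[?u]"] f_bound[OF n, of "[?u, ?u]"]
        f_bound[OF n, of "[?ax]"] f_bound[OF n, of "[?u, ?ax]"] f_bound[OF n, of "[?u, ?u, ?ax]"]
      by (auto simp: power2_eq_square mult_ac)
    have "\<bar>?f0 t * ?Q t\<bar> \<le> ?X" by (intro abs_mult_le fb S)
    then show "\<bar>?r0 t\<bar> \<le> 2 * ?X" using fb(4) by linarith
    have "\<bar>?f1 t * ?Q t\<bar> \<le> \<Phi> * ?\<eta> * (S R * norm a)" by (intro abs_mult_le fb S)
    moreover have Q1: "\<bar>?f0 t * ?Q1\<bar> \<le> \<Phi> * ((S R * norm a) * ?\<eta>)" by (intro abs_mult_le fb S)
    moreover have "\<Phi> * ?\<eta> * (S R * norm a) = ?X * ?\<eta>" "\<Phi> * ((S R * norm a) * ?\<eta>) = ?X * ?\<eta>"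
      by simp_all
    ultimately show "\<bar>?r1 t\<bar> \<le> 3 * ?X * ?\<eta>" using fb(5) by linarith
    have "\<bar>?f2 t * ?Q t\<bar> \<le> \<Phi> * ?\<eta>\<^sup>2 * (S R * norm a)" by (intro abs_mult_le fb S)
    moreover have Q1: "\<bar>?f1 t * ?Q1\<bar> \<le> \<Phi> * ?\<eta> * ((S R * norm a) * ?\<eta>)" by (intro abs_mult_le fb S)
    moreover have "\<Phi> * ?\<eta>\<^sup>2 * (S R * norm a) = ?X * ?\<eta>\<^sup>2" "\<Phi> * ?\<eta> * ((S R * norm a) * ?\<eta>) = ?X * ?\<eta>\<^sup>2"
      by (simp_all add: power2_eq_square)
    ultimately show "\<bar>?r2 t\<bar> \<le> 4 * ?X * ?\<eta>\<^sup>2" using fb(6) by linarith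
  qed
  have "\<bar>?g0 1 + ?g0 (- 1) - 2 * ?g0 0\<bar> \<le> (4 + 2 * 3 + 2 * 2) * ?X * ?\<eta>\<^sup>2 * \<Psi>"
    by (rule taylor2_symmetric_bound[OF g0 g1], rule exp_deriv2_bound) (use b in auto)
  then show "\<bar>gx f a (x, v + \<xi>) + gx f a (x, v - \<xi>) - 2 * gx f a (x, v)\<bar> \<le> 14 * \<Phi> * \<Psi> * (S R * norm a) * (S R * norm \<xi>)\<^sup>2"
    by (simp add: gx_def mult_ac)
  have "\<bar>?g0 1 - ?g0 (- 1)\<bar> \<le> 2 * (5 * ?X * ?\<eta> * \<Psi>)"
  proof (rule mvt_symmetric_bound[OF g0])
    fix t :: real assume t: "\<bar>t\<bar> \<le> 1"
    have "\<bar>?r0 t * ?P t\<bar> \<le> 2 * ?X * ?\<eta>" by (intro abs_mult_le b t)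
    then have "\<bar>?r1 t + ?r0 t * ?P t\<bar> \<le> 5 * ?X * ?\<eta>" using b(2)[OF t] by linarith
    then show "\<bar>?g1 t\<bar> \<le> 5 * ?X * ?\<eta> * \<Psi>" by (rule abs_mult_le) (use b(6)[OF t] in simp)
  qed
  then show "\<bar>gx f a (x, v + \<xi>) - gx f a (x, v - \<xi>)\<bar> \<le> 10 * \<Phi> * \<Psi> * (S R * norm a) * (S R * norm \<xi>)"
    by (simp add: gx_def mult_ac)
qed

end

lemma linear_gx: "linear (\<lambda>a. gx f a z')"
proof -
  have l: "linear (\<lambda>u. partial_deriv u f z')"
    using linear_partial_deriv[OF dir_deriv_differentiable[OF f, of "[]"]] by simp
  have "linear (\<lambda>a::real^'n. (a, 0 :: real^'n))"
    by (auto simp: linear_iff)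
  from linear_compose[OF this l] have "linear (\<lambda>a. dir_deriv [(a, 0)] f z')"
    by (simp add: o_def)
  then show ?thesis using linear_qx[of z'] unfolding gx_def
    by (auto simp: linear_iff algebra_simps simp del: foldr_Cons)
qed

text \<open>The error splits into five parts: a position remainder at each reflected point, the
  symmetric velocity remainder, and the variation of \<open>gx\<close> with velocity for the shifts
  h w and b. Linearity of \<open>gx\<close> separates the last two into the even and the odd
  combination.\<close>

lemma expansion:
  fixes b \<xi> y w :: "real^'n"
  assumes z: "z = (y, w)" and h: "0 \<le> h" and \<delta>: "norm (h *\<^sub>R w) + norm b + norm \<xi> \<le> \<delta>"
  shows "\<bar>f (y + (h *\<^sub>R w + b), w + \<xi>) * exp (q (y + (h *\<^sub>R w + b), w + \<xi>))
      + f (y + (h *\<^sub>R w - b), w - \<xi>) * exp (q (y + (h *\<^sub>R w - b), w - \<xi>))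
      - 2 * (f z * exp (q z)) - gvv f \<xi> z - 2 * h * gx f w z\<bar>
    \<le> \<Phi> * \<Psi> * (5 / 2 * ((S R * norm (h *\<^sub>R w + b))\<^sup>2 + (S R * norm (h *\<^sub>R w - b))\<^sup>2) + 43 / 12 * (S R * norm \<xi>) ^ 4
       + 14 * h * (S R * norm w) * (S R * norm \<xi>)\<^sup>2 + 10 * (S R * norm b) * (S R * norm \<xi>))"
proof -
  have near_v: "norm ((y, w + t *\<^sub>R \<xi>) - z) \<le> \<delta>" if "\<bar>t\<bar> \<le> 1" for t
  proof -
    have "norm ((y, w + t *\<^sub>R \<xi>) - z) = \<bar>t\<bar> * norm \<xi>" by (simp add: z norm_Pair)
    also have "\<dots> \<le> 1 * norm \<xi>" using that by (intro mult_right_mono) auto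
    finally show ?thesis using \<delta> norm_ge_zero[of "h *\<^sub>R w"] norm_ge_zero[of b] by linarith
  qed
  have near_x: "norm ((y + t *\<^sub>R a, w + \<xi>') - z) \<le> \<delta>"
    if "\<bar>t\<bar> \<le> 1" "norm a \<le> norm (h *\<^sub>R w) + norm b" "norm \<xi>' = norm \<xi>" for t a and \<xi>' :: "real^'n"
  proof -
    have "norm ((y + t *\<^sub>R a, w + \<xi>') - z) \<le> norm (t *\<^sub>R a) + norm \<xi>'"
      unfolding z using norm_Pair_le[of "t *\<^sub>R a" \<xi>'] by simp
    also have "norm (t *\<^sub>R a) \<le> norm a" using that(1) by (simp add: mult_left_le_one_le)
    finally show ?thesis using that \<delta> by simp
  qed
  have 1: "\<bar>f (y + (h *\<^sub>R w + b), w + \<xi>) * exp (q (y + (h *\<^sub>R w + b), w + \<xi>)) - f (y, w + \<xi>) * exp (q (y, w + \<xi>)) - gx f (h *\<^sub>R w + b) (y, w + \<xi>)\<bar>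
     \<le> 5 / 2 * \<Phi> * \<Psi> * (S R * norm (h *\<^sub>R w + b))\<^sup>2"
    by (rule expansion_x, rule near_x) (auto intro: norm_triangle_ineq simp del: norm_scaleR)
  have 2: "\<bar>f (y + (h *\<^sub>R w - b), w - \<xi>) * exp (q (y + (h *\<^sub>R w - b), w - \<xi>)) - f (y, w - \<xi>) * exp (q (y, w - \<xi>)) - gx f (h *\<^sub>R w - b) (y, w - \<xi>)\<bar>
     \<le> 5 / 2 * \<Phi> * \<Psi> * (S R * norm (h *\<^sub>R w - b))\<^sup>2"
  proof (rule expansion_x)
    show "norm ((y + t *\<^sub>R (h *\<^sub>R w - b), w - \<xi>) - z) \<le> \<delta>" if "\<bar>t\<bar> \<le> 1" for t
      using near_x[OF that norm_triangle_ineq4, of "- \<xi>"] by simp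
  qed
  note 3 = expansion_vv[of y w \<xi>, OF near_v, folded z]
  note 4 = expansion_xv(1)[of y w \<xi> w, OF near_v, folded z]
  note 5 = expansion_xv(2)[of y w \<xi> b, OF near_v, folded z]
  have l: "gx f (h *\<^sub>R w + b) z' = h * gx f w z' + gx f b z'" "gx f (h *\<^sub>R w - b) z' = h * gx f w z' - gx f b z'" for z'
    using linear_add[OF linear_gx] linear_diff[OF linear_gx] linear_scale[OF linear_gx] by simp_all
  have h4: "\<bar>h * (gx f w (y, w + \<xi>) + gx f w (y, w - \<xi>) - 2 * gx f w z)\<bar> \<le> h * (14 * \<Phi> * \<Psi> * (S R * norm w) * (S R * norm \<xi>)\<^sup>2)"
  proof -
    have "\<bar>h\<bar> \<le> h" using h by simp
    from abs_mult_le[OF this 4] show ?thesis .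
  qed
  from abs_sum5_le[OF 1 2 3 h4 5] show ?thesis
    unfolding l by (simp add: algebra_simps)
qed

end

end

subsection \<open>The standard Gaussian measure\<close>

text \<open>A product over coordinates, so that integrals of product functions factor. On phase
  space a single standard Gaussian vector drives position and velocity noise together.\<close>

definition gauss_density :: "'a::euclidean_space \<Rightarrow> real" where
  "gauss_density x = (\<Prod>b\<in>Basis. std_normal_density (x \<bullet> b))"

definition gauss :: "'a::euclidean_space measure" where
  "gauss = density lborel (\<lambda>x. ennreal (gauss_density x))"

lemma gauss_density_measurable [measurable]: "gauss_density \<in> borel_measurable borel"
  unfolding gauss_density_def by measurable

lemma gauss_density_nonneg [simp]: "0 \<le> gauss_density x"
  unfolding gauss_density_def by (intro prod_nonneg) simp

lemma sets_gauss [measurable_cong, simp]: "sets gauss = sets borel"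
  by (simp add: gauss_def)

lemma space_gauss [simp]: "space gauss = UNIV"
  by (simp add: gauss_def)

lemma gauss_density_eq:
  "gauss_density (x::'a::euclidean_space) = (1 / sqrt (2 * pi)) ^ DIM('a) * exp (- (norm x)\<^sup>2 / 2)"
proof -
  have "gauss_density x = (\<Prod>b\<in>(Basis::'a set). (1 / sqrt (2 * pi)) * exp (- (x \<bullet> b)\<^sup>2 / 2))"
    by (simp add: gauss_density_def std_normal_density_def)
  also have "\<dots> = (1 / sqrt (2 * pi)) ^ DIM('a) * exp (\<Sum>b\<in>Basis. - (x \<bullet> b)\<^sup>2 / 2)"
    by (simp only: prod.distrib exp_sum[OF finite_Basis] prod_constant)
  also have "(\<Sum>b\<in>Basis. - (x \<bullet> b)\<^sup>2 / 2) = - (norm x)\<^sup>2 / 2"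
    unfolding power2_norm_eq_inner
    by (subst euclidean_inner) (simp add: power2_eq_square sum_divide_distrib sum_negf)
  finally show ?thesis .
qed

lemma nn_integral_gauss:
  assumes "F \<in> borel_measurable borel"
  shows "(\<integral>\<^sup>+x. F x \<partial>gauss) = (\<integral>\<^sup>+x. ennreal (gauss_density x) * F x \<partial>lborel)"
  unfolding gauss_def using assms by (subst nn_integral_density) auto

lemma nn_integral_gauss_prod:
  fixes f :: "'a::euclidean_space \<Rightarrow> real \<Rightarrow> real"
  assumes [measurable]: "\<And>b. b \<in> Basis \<Longrightarrow> f b \<in> borel_measurable borel"
    and nn: "\<And>b x. b \<in> Basis \<Longrightarrow> 0 \<le> f b x"
  shows "(\<integral>\<^sup>+x. ennreal (\<Prod>b\<in>Basis. f b (x \<bullet> b)) \<partial>gauss) =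
    (\<Prod>b\<in>Basis. \<integral>\<^sup>+x. ennreal (std_normal_density x * f b x) \<partial>lborel)"
proof -
  have "(\<integral>\<^sup>+x. ennreal (\<Prod>b\<in>Basis. f b (x \<bullet> b)) \<partial>gauss) =
      (\<integral>\<^sup>+x. (\<Prod>b\<in>Basis. ennreal (std_normal_density (x \<bullet> b) * f b (x \<bullet> b))) \<partial>lborel)"
    using nn by (subst nn_integral_gauss)
      (auto intro!: nn_integral_cong simp: gauss_density_def ennreal_mult[symmetric] prod_nonneg prod_ennreal prod.distrib)
  also have "\<dots> = (\<Prod>b\<in>Basis. \<integral>\<^sup>+x. ennreal (std_normal_density x * f b x) \<partial>lborel)"
    by (rule nn_integral_lborel_prod) auto
  finally show ?thesis .
qed

lemma nn_integral_std_normal: "(\<integral>\<^sup>+x. ennreal (std_normal_density x) \<partial>lborel) = 1"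
  by (subst nn_integral_eq_integral) (auto simp: integrable_std_normal_moment[of 0, simplified] integral_std_normal_moment_even[of 0, simplified])

interpretation gauss: prob_space "gauss :: 'a::euclidean_space measure"
proof
  have "emeasure (gauss :: 'a measure) UNIV = (\<integral>\<^sup>+x. ennreal (\<Prod>b\<in>(Basis::'a set). (\<lambda>_ _. 1) b (x \<bullet> b)) \<partial>gauss)"
    using nn_integral_indicator[of UNIV "gauss :: 'a measure"] by simp
  also have "\<dots> = 1"
    by (subst nn_integral_gauss_prod) (auto simp: nn_integral_std_normal)
  finally show "emeasure (gauss :: 'a measure) (space gauss) = 1" by simp
qed

text \<open>The common dominating function of the noise integrals. The exponent 1/4 is below the 1/2
  of the Gaussian density; per coordinate the product is sqrt 2 times the normal density of variance
  2.\<close>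

lemma integrable_gauss_exp: "integrable (gauss :: 'a::euclidean_space measure) (\<lambda>x. exp ((norm x)\<^sup>2 / 4))"
proof (rule integrableI_bounded)
  have e: "exp ((norm x)\<^sup>2 / 4) = (\<Prod>b\<in>Basis. exp ((x \<bullet> b)\<^sup>2 / 4))" for x :: 'a
    unfolding exp_sum[OF finite_Basis, symmetric] power2_norm_eq_inner
    by (subst euclidean_inner) (simp add: power2_eq_square sum_divide_distrib)
  have n: "std_normal_density x * exp (x\<^sup>2 / 4) = sqrt 2 * normal_density 0 (sqrt 2) x" for x :: real
    by (simp add: normal_density_def exp_add[symmetric] real_sqrt_mult field_simps)
  have "(\<integral>\<^sup>+x. ennreal (norm (exp ((norm (x::'a))\<^sup>2 / 4))) \<partial>gauss)
      = (\<Prod>b\<in>(Basis::'a set). \<integral>\<^sup>+x. ennreal (std_normal_density x * exp (x\<^sup>2 / 4)) \<partial>lborel)"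
    unfolding real_norm_def abs_exp_cancel unfolding e by (rule nn_integral_gauss_prod) auto
  also have "\<dots> < \<infinity>"
    unfolding n by (subst nn_integral_eq_integral)
      (auto intro!: integrable_mult_right simp: less_top[symmetric] ennreal_prod_eq_top ennreal_power)
  finally show "(\<integral>\<^sup>+x. ennreal (norm (exp ((norm (x::'a))\<^sup>2 / 4))) \<partial>gauss) < \<infinity>" .
qed measurable

text \<open>Coordinate reflections preserve Lebesgue measure and the norm. All signs negative gives
  the symmetrisation of the expansion; a single negative sign makes the mixed second moments
  vanish.\<close>

lemma gauss_reflect:
  fixes c :: "'a::euclidean_space \<Rightarrow> real" and F :: "'a \<Rightarrow> real"
  assumes c: "\<And>b. b \<in> Basis \<Longrightarrow> \<bar>c b\<bar> = 1" and [measurable]: "F \<in> borel_measurable borel"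
  shows "(\<integral>x. F (\<Sum>b\<in>Basis. (c b * (x \<bullet> b)) *\<^sub>R b) \<partial>gauss) = (\<integral>x. F x \<partial>gauss)"
proof -
  let ?T = "\<lambda>x::'a. \<Sum>b\<in>Basis. (c b * (x \<bullet> b)) *\<^sub>R b"
  have c0: "c b \<noteq> 0" if "b \<in> Basis" for b
    using c[OF that] by auto
  have l: "(lborel :: 'a measure) = distr lborel borel ?T"
    using lborel_affine_euclidean[of c 0, OF c0] c by (simp add: density_1)
  have c2: "c b * c b = 1" if "b \<in> Basis" for b
    using c[OF that] by (metis abs_mult_self_eq mult_1)
  have g: "gauss_density (?T x) = gauss_density x" for x
  proof -
    have "(norm (?T x))\<^sup>2 = (norm x)\<^sup>2"
    proof -
      have "(c b * (x \<bullet> b)) * (c b * (x \<bullet> b)) = (x \<bullet> b) * (x \<bullet> b)" if "b \<in> Basis" for b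
        using c2[OF that] by (metis mult.assoc mult.left_commute mult_1)
      then have "?T x \<bullet> ?T x = x \<bullet> x"
        by (subst (1 2) euclidean_inner) (auto intro!: sum.cong)
      then show ?thesis by (simp only: power2_norm_eq_inner)
    qed
    then show ?thesis unfolding gauss_density_eq by simp
  qed
  have "(\<integral>x. F x \<partial>gauss) = (\<integral>x. gauss_density x * F x \<partial>lborel)"
    unfolding gauss_def by (subst integral_density) auto
  also have "\<dots> = (\<integral>x. gauss_density (?T x) * F (?T x) \<partial>lborel)"
  proof -
    have "(\<integral>x. gauss_density x * F x \<partial>lborel) = (\<integral>x. gauss_density x * F x \<partial>distr lborel borel ?T)"
      by (rule arg_cong[where f="\<lambda>M. \<integral>x. gauss_density x * F x \<partial>M", OF l])
    also have "\<dots> = (\<integral>x. gauss_density (?T x) * F (?T x) \<partial>lborel)"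
      by (rule integral_distr) auto
    finally show ?thesis .
  qed
  also have "\<dots> = (\<integral>x. F (?T x) \<partial>gauss)"
    unfolding gauss_def g by (subst integral_density) auto
  finally show ?thesis by simp
qed

lemma gauss_uminus:
  fixes F :: "'a::euclidean_space \<Rightarrow> real"
  assumes "F \<in> borel_measurable borel"
  shows "(\<integral>x. F (- x) \<partial>gauss) = (\<integral>x. F x \<partial>gauss)"
proof -
  have "(\<Sum>b\<in>Basis. (- 1 * (x \<bullet> b)) *\<^sub>R b) = - x" for x :: 'a
    by (simp add: sum_negf euclidean_representation)
  then show ?thesis using gauss_reflect[of "\<lambda>_. - 1" F] assms by simp
qed

lemma square_le_exp: "(r::real)\<^sup>2 \<le> 4 * exp (r\<^sup>2 / 4)"
  using exp_ge_add_one_self[of "r\<^sup>2 / 4"] by linarith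

lemma integrable_gauss_quadratic:
  fixes F :: "'a::euclidean_space \<Rightarrow> real"
  assumes [measurable]: "F \<in> borel_measurable borel" and F: "\<And>x. \<bar>F x\<bar> \<le> K * (norm x)\<^sup>2"
  shows "integrable gauss F"
proof (rule Bochner_Integration.integrable_bound)
  show "integrable gauss (\<lambda>x::'a. \<bar>K\<bar> * (4 * exp ((norm x)\<^sup>2 / 4)))"
    by (intro integrable_mult_right integrable_gauss_exp)
  show "AE x in gauss. norm (F x) \<le> norm (\<bar>K\<bar> * (4 * exp ((norm x)\<^sup>2 / 4)))"
  proof (rule AE_I2)
    fix x :: 'a
    have "\<bar>F x\<bar> \<le> \<bar>K\<bar> * (norm x)\<^sup>2"
      by (rule order_trans[OF F]) (simp add: mult_right_mono)
    also have "\<dots> \<le> \<bar>K\<bar> * (4 * exp ((norm x)\<^sup>2 / 4))"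
      by (intro mult_left_mono square_le_exp) simp
    finally show "norm (F x) \<le> norm (\<bar>K\<bar> * (4 * exp ((norm x)\<^sup>2 / 4)))" by simp
  qed
qed simp

lemma integrable_gauss_inner:
  fixes b c :: "'a::euclidean_space"
  assumes "b \<in> Basis" "c \<in> Basis"
  shows "integrable gauss (\<lambda>x. (x \<bullet> b) * (x \<bullet> c))"
proof (rule integrable_gauss_quadratic)
  fix x
  show "\<bar>(x \<bullet> b) * (x \<bullet> c)\<bar> \<le> 1 * (norm x)\<^sup>2"
    unfolding abs_mult power2_eq_square mult_1
    by (intro mult_mono Basis_le_norm assms) auto
qed simp

lemma gauss_second_moment:
  fixes b c :: "'a::euclidean_space"
  assumes b: "b \<in> Basis" and c: "c \<in> Basis"
  shows "(\<integral>x. (x \<bullet> b) * (x \<bullet> c) \<partial>gauss) = (if b = c then 1 else 0)"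
proof (cases "b = c")
  case True
  have i: "integrable gauss (\<lambda>x::'a. (x \<bullet> b) * (x \<bullet> b))"
    by (rule integrable_gauss_inner[OF b b])
  have m: "(\<integral>\<^sup>+x. ennreal (std_normal_density x * x\<^sup>2) \<partial>lborel) = 1"
    using integrable_std_normal_moment[of 2] integral_std_normal_moment_even[of 1]
    by (subst nn_integral_eq_integral) auto
  have "(\<integral>\<^sup>+x. ennreal ((x \<bullet> b) * (x \<bullet> b)) \<partial>gauss) =
      (\<integral>\<^sup>+x. ennreal (\<Prod>d\<in>(Basis::'a set). (\<lambda>d t. if d = b then t\<^sup>2 else 1) d (x \<bullet> d)) \<partial>gauss)"
    by (intro nn_integral_cong arg_cong[where f=ennreal])
       (simp add: b power2_eq_square prod.If_cases Int_absorb1 Collect_conv_if)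
  also have "\<dots> = (\<Prod>d\<in>(Basis::'a set). \<integral>\<^sup>+x. ennreal (std_normal_density x * (if d = b then x\<^sup>2 else 1)) \<partial>lborel)"
    by (rule nn_integral_gauss_prod) auto
  also have "\<dots> = 1"
  proof (rule prod.neutral, rule ballI)
    fix d
    show "(\<integral>\<^sup>+x. ennreal (std_normal_density x * (if d = b then x\<^sup>2 else 1)) \<partial>lborel) = 1"
      using m nn_integral_std_normal by (cases "d = b") auto
  qed
  finally have "ennreal (\<integral>x. (x \<bullet> b) * (x \<bullet> b) \<partial>gauss) = 1"
    using nn_integral_eq_integral[OF i] by simp
  then show ?thesis using True by (simp add: ennreal_eq_1)
next
  case False
  let ?T = "\<lambda>x::'a. \<Sum>d\<in>Basis. ((if d = b then - 1 else 1) * (x \<bullet> d)) *\<^sub>R d"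
  have T: "?T x \<bullet> d = (if d = b then - 1 else 1) * (x \<bullet> d)" if "d \<in> Basis" for x d
    using that by simp
  have "(\<integral>x. (?T x \<bullet> b) * (?T x \<bullet> c) \<partial>gauss) = (\<integral>x. (x \<bullet> b) * (x \<bullet> c) \<partial>gauss)"
    by (rule gauss_reflect[of _ "\<lambda>x. (x \<bullet> b) * (x \<bullet> c)"]) auto
  then have "- (\<integral>x. (x \<bullet> b) * (x \<bullet> c) \<partial>gauss) = (\<integral>x. (x \<bullet> b) * (x \<bullet> c) \<partial>gauss)"
    unfolding T[OF b] T[OF c] using False by simp
  then show ?thesis using False by simp
qed

text \<open>Identity covariance turns the mean of a quadratic form into its trace; this is how the
  Laplacian in velocity arises.\<close>

lemma gauss_bilinear:
  fixes B :: "'a::euclidean_space \<Rightarrow> 'a \<Rightarrow> real"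
  assumes B: "bilinear B"
  shows "integrable gauss (\<lambda>x. B x x)" "(\<integral>x. B x x \<partial>gauss) = (\<Sum>b\<in>Basis. B b b)"
proof -
  have e: "B x x = (\<Sum>b\<in>Basis. \<Sum>c\<in>Basis. B b c * ((x \<bullet> b) * (x \<bullet> c)))" for x
  proof -
    have "B x x = B (\<Sum>b\<in>Basis. (x \<bullet> b) *\<^sub>R b) (\<Sum>c\<in>Basis. (x \<bullet> c) *\<^sub>R c)"
      by (simp add: euclidean_representation)
    also have "\<dots> = (\<Sum>(b, c)\<in>Basis \<times> Basis. B ((x \<bullet> b) *\<^sub>R b) ((x \<bullet> c) *\<^sub>R c))"
      by (rule bilinear_sum[OF B])
    also have "\<dots> = (\<Sum>b\<in>Basis. \<Sum>c\<in>Basis. B b c * ((x \<bullet> b) * (x \<bullet> c)))"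
      unfolding sum.cartesian_product[symmetric]
      by (simp add: bilinear_lmul[OF B] bilinear_rmul[OF B] mult_ac)
    finally show ?thesis .
  qed
  have i: "integrable gauss (\<lambda>x. (x \<bullet> b) * (x \<bullet> c))" if "b \<in> Basis" "c \<in> Basis" for b c :: 'a
    by (rule integrable_gauss_inner[OF that])
  show "integrable gauss (\<lambda>x. B x x)"
    unfolding e by (intro Bochner_Integration.integrable_sum integrable_mult_right i)
  have "(\<integral>x. B x x \<partial>gauss) = (\<Sum>b\<in>Basis. \<Sum>c\<in>Basis. B b c * (\<integral>x. (x \<bullet> b) * (x \<bullet> c) \<partial>gauss))"
    unfolding e
    by (subst Bochner_Integration.integral_sum)
       (auto intro!: Bochner_Integration.integrable_sum integrable_mult_right i sum.cong simp: Bochner_Integration.integral_sum i)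
  also have "\<dots> = (\<Sum>b\<in>Basis. B b b)"
    by (intro sum.cong refl) (simp add: gauss_second_moment if_distrib cong: if_cong)
  finally show "(\<integral>x. B x x \<partial>gauss) = (\<Sum>b\<in>Basis. B b b)" .
qed

subsection \<open>The kernel as the law of an affine image of the Gaussian\<close>

text \<open>The affine map is triangular: \<open>q\<close> drives the velocity and, through half a
  step, the position; \<open>p\<close> adds the independent residual. Position and velocity noise
  are thus correlated, and their joint sign change is the symmetry exploited.\<close>

definition kinetic_step :: "real \<Rightarrow> real \<Rightarrow> real \<Rightarrow> 'n::finite phase \<Rightarrow> 'n phase \<Rightarrow> 'n phase" where
  "kinetic_step \<gamma> \<beta> h = (\<lambda>(y, w) (p, q).
     let \<xi> = sqrt (2 * \<gamma> * h / \<beta>) *\<^sub>R q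
     in (y + h *\<^sub>R w + (h / 2) *\<^sub>R \<xi> + sqrt (\<gamma> * h ^ 3 / (6 * \<beta>)) *\<^sub>R p, w + \<xi>))"

lemma nn_integral_lborel_affine:
  fixes H :: "'a::euclidean_space \<Rightarrow> ennreal"
  assumes "c \<noteq> 0" and [measurable]: "H \<in> borel_measurable borel"
  shows "(\<integral>\<^sup>+x. H x \<partial>lborel) = ennreal (\<bar>c\<bar> ^ DIM('a)) * (\<integral>\<^sup>+x. H (t + c *\<^sub>R x) \<partial>lborel)"
  by (subst lborel_affine[OF assms(1), of t])
     (simp add: nn_integral_density nn_integral_distr nn_integral_cmult)

lemma kinetic_step_measurable [measurable]: "kinetic_step \<gamma> \<beta> h yw \<in> borel_measurable borel"
  unfolding kinetic_step_def Let_def case_prod_beta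
  by (intro borel_measurable_continuous_onI continuous_intros)

lemma G_kernel_measurable: "(\<lambda>(z, yw). G_kernel \<gamma> \<beta> h z yw) \<in> borel_measurable (borel \<Otimes>\<^sub>M borel)"
  unfolding G_kernel_def case_prod_beta borel_prod
  by (intro borel_measurable_continuous_onI continuous_on_mult continuous_on_exp continuous_on_diff
      continuous_on_power continuous_on_norm continuous_intros)

lemma G_kernel_measurable1 [measurable]: "(\<lambda>z. G_kernel \<gamma> \<beta> h z yw) \<in> borel_measurable borel"
  using measurable_compose[OF measurable_Pair2'[of yw borel borel] G_kernel_measurable] by simp

lemma G_kernel_nonneg: "\<beta> > 0 \<Longrightarrow> \<gamma> > 0 \<Longrightarrow> 0 \<le> G_kernel \<gamma> \<beta> h z yw"
  by (simp add: G_kernel_def case_prod_beta)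

text \<open>The prefactor is the Jacobian determinant of the affine map. It turns the kernel's
  constant into the Gaussian one because c1 c2 = gamma h^2 / (beta sqrt 3).\<close>

lemma G_kernel_kinetic_step:
  fixes yw :: "'n::finite phase"
  assumes "\<gamma> > 0" "\<beta> > 0" "h > 0"
  shows "sqrt (\<gamma> * h ^ 3 / (6 * \<beta>)) ^ CARD('n) * sqrt (2 * \<gamma> * h / \<beta>) ^ CARD('n) * G_kernel \<gamma> \<beta> h (kinetic_step \<gamma> \<beta> h yw pq) yw
    = gauss_density pq"
proof -
  obtain y w p q where [simp]: "yw = (y, w)" "pq = (p, q)" by (metis surj_pair)
  define c1 where "c1 = sqrt (\<gamma> * h ^ 3 / (6 * \<beta>))"
  define c2 where "c2 = sqrt (2 * \<gamma> * h / \<beta>)"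
  have c1: "c1\<^sup>2 = \<gamma> * h ^ 3 / (6 * \<beta>)" and c2: "c2\<^sup>2 = 2 * \<gamma> * h / \<beta>"
    using assms by (auto simp: c1_def c2_def)
  have "c1 * c2 = sqrt ((\<gamma> / \<beta> * h\<^sup>2)\<^sup>2 / 3)"
    unfolding c1_def c2_def real_sqrt_mult[symmetric]
    by (rule arg_cong[where f=sqrt]) (use assms in \<open>simp add: power2_eq_square power3_eq_cube mult_ac\<close>)
  also have "\<dots> = \<gamma> / \<beta> * h\<^sup>2 / sqrt 3"
    using assms by (simp add: real_sqrt_divide)
  finally have cc: "c1 * c2 = \<gamma> / \<beta> * h\<^sup>2 / sqrt 3" .
  \<comment> \<open>The kernel is centred at y + (h/2) (v + w), which for v = w + xi equals y + h w
    + (h/2) xi, so only the residual noise remains.\<close>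
  have x: "y + h *\<^sub>R w + (h / 2) *\<^sub>R (c2 *\<^sub>R q) + c1 *\<^sub>R p - y - (h / 2) *\<^sub>R (w + c2 *\<^sub>R q + w) = c1 *\<^sub>R p"
  proof -
    have "h *\<^sub>R w = (h / 2) *\<^sub>R w + (h / 2) *\<^sub>R w"
      by (simp flip: scaleR_add_left)
    then show ?thesis by (simp add: scaleR_add_right)
  qed
  have e: "- (3 * \<beta> / (\<gamma> * h ^ 3)) * (norm (c1 *\<^sub>R p))\<^sup>2 - \<beta> / (4 * \<gamma> * h) * (norm (c2 *\<^sub>R q))\<^sup>2 = - (norm pq)\<^sup>2 / 2"
  proof -
    have "3 * \<beta> / (\<gamma> * h ^ 3) * (\<gamma> * h ^ 3 / (6 * \<beta>)) = 1 / 2" "\<beta> / (4 * \<gamma> * h) * (2 * \<gamma> * h / \<beta>) = 1 / 2"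
      using assms by auto
    then have "3 * \<beta> / (\<gamma> * h ^ 3) * (norm (c1 *\<^sub>R p))\<^sup>2 = 1 / 2 * (norm p)\<^sup>2"
      "\<beta> / (4 * \<gamma> * h) * (norm (c2 *\<^sub>R q))\<^sup>2 = 1 / 2 * (norm q)\<^sup>2"
      by (simp_all only: norm_scaleR power_mult_distrib power2_abs c1 c2 mult.assoc[symmetric])
    then show ?thesis by (simp add: norm_Pair)
  qed
  have "c1 ^ CARD('n) * c2 ^ CARD('n) * (3 powr (real CARD('n) / 2) * (\<beta> / \<gamma>) ^ CARD('n) / (2 * pi * h\<^sup>2) ^ CARD('n))
      = (c1 * c2 * sqrt 3 * (\<beta> / \<gamma>) / (2 * pi * h\<^sup>2)) ^ CARD('n)"
  proof -
    have "(3::real) powr (real CARD('n) / 2) = (3 powr (1 / 2)) powr real CARD('n)"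
      by (simp add: powr_powr)
    also have "\<dots> = sqrt 3 ^ CARD('n)"
      by (simp add: powr_half_sqrt powr_realpow)
    finally show ?thesis
      by (simp add: power_mult_distrib power_divide)
  qed
  also have "c1 * c2 * sqrt 3 * (\<beta> / \<gamma>) / (2 * pi * h\<^sup>2) = 1 / (2 * pi)"
    unfolding cc using assms by (simp add: divide_simps)
  also have "(1 / (2 * pi)) ^ CARD('n) = (1 / sqrt (2 * pi)) ^ DIM('n phase)"
  proof -
    have "(1 / (2 * pi)) = (1 / sqrt (2 * pi))\<^sup>2"
      by (simp add: power_divide)
    then have "(1 / (2 * pi)) ^ CARD('n) = ((1 / sqrt (2 * pi))\<^sup>2) ^ CARD('n)"
      by (rule arg_cong)
    also have "\<dots> = (1 / sqrt (2 * pi)) ^ (2 * CARD('n))"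
      by (rule power_mult[symmetric])
    also have "2 * CARD('n) = DIM('n phase)"
      by simp
    finally show ?thesis .
  qed
  finally have k: "c1 ^ CARD('n) * c2 ^ CARD('n) * (3 powr (real CARD('n) / 2) * (\<beta> / \<gamma>) ^ CARD('n) / (2 * pi * h\<^sup>2) ^ CARD('n))
      = (1 / sqrt (2 * pi)) ^ DIM('n phase)" .
  have st: "kinetic_step \<gamma> \<beta> h (y, w) (p, q) = (y + h *\<^sub>R w + (h / 2) *\<^sub>R (c2 *\<^sub>R q) + c1 *\<^sub>R p, w + c2 *\<^sub>R q)"
    by (simp only: kinetic_step_def prod.case Let_def c1_def c2_def)
  have "G_kernel \<gamma> \<beta> h (kinetic_step \<gamma> \<beta> h yw pq) yw =
     3 powr (real CARD('n) / 2) * (\<beta> / \<gamma>) ^ CARD('n) / (2 * pi * h\<^sup>2) ^ CARD('n) * exp (- (norm pq)\<^sup>2 / 2)"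
    unfolding \<open>yw = (y, w)\<close> st[folded \<open>pq = (p, q)\<close>] G_kernel_def prod.case x e[symmetric]
    by (simp only: add_diff_cancel_left')
  then show ?thesis
    unfolding gauss_density_eq k[symmetric] c1_def[symmetric] c2_def[symmetric]
    by (simp only: mult.assoc)
qed

text \<open>Two affine substitutions: the velocity first and then, for each fixed velocity noise,
  the position, whose translation depends on that noise.\<close>

lemma nn_integral_G_kernel:
  fixes F :: "'n::finite phase \<Rightarrow> ennreal"
  assumes pos: "\<gamma> > 0" "\<beta> > 0" "h > 0" and [measurable]: "F \<in> borel_measurable borel"
  shows "(\<integral>\<^sup>+z. ennreal (G_kernel \<gamma> \<beta> h z yw) * F z \<partial>lborel) = (\<integral>\<^sup>+pq. F (kinetic_step \<gamma> \<beta> h yw pq) \<partial>gauss)"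
proof -
  obtain y w where yw [simp]: "yw = (y, w)" by (metis surj_pair)
  define c1 where "c1 = sqrt (\<gamma> * h ^ 3 / (6 * \<beta>))"
  define c2 where "c2 = sqrt (2 * \<gamma> * h / \<beta>)"
  have c: "c1 > 0" "c2 > 0" using pos by (auto simp: c1_def c2_def)
  define H where "H = (\<lambda>z. ennreal (G_kernel \<gamma> \<beta> h z yw) * F z)"
  have [measurable]: "H \<in> borel_measurable borel" unfolding H_def by measurable
  have [measurable]: "H \<in> borel_measurable (borel \<Otimes>\<^sub>M borel)" by (simp add: borel_prod)
  have st: "kinetic_step \<gamma> \<beta> h yw (p, q) = (y + h *\<^sub>R w + (h / 2) *\<^sub>R (c2 *\<^sub>R q) + c1 *\<^sub>R p, w + c2 *\<^sub>R q)" for p q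
    by (simp add: kinetic_step_def c1_def c2_def Let_def)
  have "(\<integral>\<^sup>+z. H z \<partial>lborel) = (\<integral>\<^sup>+v. \<integral>\<^sup>+x. H (x, v) \<partial>lborel \<partial>lborel)"
    unfolding lborel_prod[symmetric] by (rule lborel_pair.nn_integral_snd[symmetric]) simp
  also have "\<dots> = ennreal (c2 ^ CARD('n)) * (\<integral>\<^sup>+q. \<integral>\<^sup>+x. H (x, w + c2 *\<^sub>R q) \<partial>lborel \<partial>lborel)"
    by (subst nn_integral_lborel_affine[of c2 _ w]) (use c in auto)
  also have "\<dots> = ennreal (c2 ^ CARD('n)) * (\<integral>\<^sup>+q. ennreal (c1 ^ CARD('n)) *
      (\<integral>\<^sup>+p. H (kinetic_step \<gamma> \<beta> h yw (p, q)) \<partial>lborel) \<partial>lborel)"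
  proof -
    have "(\<integral>\<^sup>+x. H (x, w + c2 *\<^sub>R q) \<partial>lborel) = ennreal (c1 ^ CARD('n)) * (\<integral>\<^sup>+p. H (kinetic_step \<gamma> \<beta> h yw (p, q)) \<partial>lborel)" for q
      unfolding st
      by (subst nn_integral_lborel_affine[of c1 _ "y + h *\<^sub>R w + (h / 2) *\<^sub>R (c2 *\<^sub>R q)"]) (use c in auto)
    then show ?thesis by simp
  qed
  also have "\<dots> = (\<integral>\<^sup>+q. \<integral>\<^sup>+p. ennreal (c1 ^ CARD('n)) * ennreal (c2 ^ CARD('n)) * H (kinetic_step \<gamma> \<beta> h yw (p, q)) \<partial>lborel \<partial>lborel)"
  proof -
    have [measurable]: "(\<lambda>z. H (kinetic_step \<gamma> \<beta> h yw z)) \<in> borel_measurable (borel \<Otimes>\<^sub>M borel)"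
      unfolding borel_prod by measurable
    show ?thesis
      by (simp add: nn_integral_cmult mult.assoc mult.left_commute del: yw)
  qed
  also have "\<dots> = (\<integral>\<^sup>+pq. ennreal (c1 ^ CARD('n)) * ennreal (c2 ^ CARD('n)) * H (kinetic_step \<gamma> \<beta> h yw pq) \<partial>lborel)"
    unfolding lborel_prod[symmetric] by (rule lborel_pair.nn_integral_snd) (simp add: borel_prod lborel_prod)
  also have "\<dots> = (\<integral>\<^sup>+pq. ennreal (gauss_density pq) * F (kinetic_step \<gamma> \<beta> h yw pq) \<partial>lborel)"
    unfolding H_def G_kernel_kinetic_step[OF pos, folded c1_def c2_def, of yw, symmetric]
    using c by (simp add: ennreal_mult G_kernel_nonneg[OF pos(2,1)] mult.assoc)
  also have "\<dots> = (\<integral>\<^sup>+pq. F (kinetic_step \<gamma> \<beta> h yw pq) \<partial>gauss)"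
    by (subst nn_integral_gauss) auto
  finally show ?thesis unfolding H_def .
qed

lemma G_op_eq_gauss:
  fixes g :: "'n::finite phase \<Rightarrow> real"
  assumes pos: "\<gamma> > 0" "\<beta> > 0" "h > 0" and g [measurable]: "g \<in> borel_measurable borel"
  shows "G_op \<gamma> \<beta> h g yw = (\<integral>\<^sup>+pq. ennreal (g (kinetic_step \<gamma> \<beta> h yw pq)) \<partial>gauss)"
proof -
  have "G_op \<gamma> \<beta> h g yw = (\<integral>\<^sup>+z. ennreal (G_kernel \<gamma> \<beta> h z yw) * ennreal (g z) \<partial>lborel)"
    unfolding G_op_def by (simp add: ennreal_mult' G_kernel_nonneg[OF pos(2,1)])
  then show ?thesis using nn_integral_G_kernel[OF pos, of "\<lambda>z. ennreal (g z)"] by simp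
qed

text \<open>Upgrades the identity for nonnegative integrands to one of measures, from which
  integrability and integrals of signed functions transfer.\<close>

lemma density_G_kernel:
  assumes pos: "\<gamma> > 0" "\<beta> > 0" "h > 0"
  shows "density lborel (\<lambda>z. ennreal (G_kernel \<gamma> \<beta> h z yw)) = distr gauss borel (kinetic_step \<gamma> \<beta> h yw)"
proof (rule measure_eqI)
  fix A assume "A \<in> sets (density lborel (\<lambda>z. ennreal (G_kernel \<gamma> \<beta> h z yw)))"
  then have [measurable]: "A \<in> sets borel" by simp
  show "emeasure (density lborel (\<lambda>z. ennreal (G_kernel \<gamma> \<beta> h z yw))) A = emeasure (distr gauss borel (kinetic_step \<gamma> \<beta> h yw)) A"
  proof -
    have "emeasure (distr gauss borel (kinetic_step \<gamma> \<beta> h yw)) A = (\<integral>\<^sup>+z. indicator A z \<partial>distr gauss borel (kinetic_step \<gamma> \<beta> h yw))"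
      by simp
    also have "\<dots> = (\<integral>\<^sup>+pq. indicator A (kinetic_step \<gamma> \<beta> h yw pq) \<partial>gauss)"
      by (rule nn_integral_distr) measurable
    finally show ?thesis
      using nn_integral_G_kernel[OF pos, of "indicator A" yw] by (simp add: emeasure_density)
  qed
qed simp

lemma integral_G_kernel:
  fixes g :: "'n::finite phase \<Rightarrow> real"
  assumes pos: "\<gamma> > 0" "\<beta> > 0" "h > 0" and g [measurable]: "g \<in> borel_measurable borel"
  shows "(\<integral>z. G_kernel \<gamma> \<beta> h z yw * g z \<partial>lborel) = (\<integral>pq. g (kinetic_step \<gamma> \<beta> h yw pq) \<partial>gauss)"
  using integral_density[of g lborel "\<lambda>z. G_kernel \<gamma> \<beta> h z yw"] integral_distr[of "kinetic_step \<gamma> \<beta> h yw" gauss borel g]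
    G_kernel_nonneg[OF pos(2,1), of h _ yw] density_G_kernel[OF pos, of yw] by simp

lemma integrable_G_kernel:
  fixes g :: "'n::finite phase \<Rightarrow> real"
  assumes pos: "\<gamma> > 0" "\<beta> > 0" "h > 0" and g [measurable]: "g \<in> borel_measurable borel"
    and int: "integrable gauss (\<lambda>pq. g (kinetic_step \<gamma> \<beta> h yw pq))"
  shows "integrable lborel (\<lambda>z. G_kernel \<gamma> \<beta> h z yw * g z)"
  using int integrable_density[of g lborel "\<lambda>z. G_kernel \<gamma> \<beta> h z yw"] integrable_distr_eq[of "kinetic_step \<gamma> \<beta> h yw" gauss borel g]
    G_kernel_nonneg[OF pos(2,1), of h _ yw] density_G_kernel[OF pos, of yw] by simp

subsection \<open>Growth of the weights along one step\<close>

text \<open>x^N / N! is one term of the exponential series, and completing the square bounds x by 1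
  / (4 eps) + eps x^2.\<close>

lemma power_le_exp_square:
  assumes "\<epsilon> > 0"
  obtains C :: real where "C > 0" "\<And>x. x \<ge> 0 \<Longrightarrow> x ^ N \<le> C * exp (\<epsilon> * x\<^sup>2)"
proof
  let ?C = "fact N * exp (1 / (4 * \<epsilon>))"
  show "?C > 0" by simp
  fix x :: real assume x: "x \<ge> 0"
  have "x ^ N / fact N \<le> exp x"
  proof -
    have "(\<Sum>n\<in>{N}. x ^ n / fact n) \<le> (\<Sum>n. x ^ n / fact n)"
      using x summable_exp_generic[of x] by (intro sum_le_suminf) (auto simp: divide_inverse mult.commute)
    then show ?thesis by (simp add: exp_def divide_inverse mult.commute)
  qed
  then have "x ^ N \<le> fact N * exp x" by (simp add: field_simps)
  also have "x \<le> 1 / (4 * \<epsilon>) + \<epsilon> * x\<^sup>2"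
  proof -
    have "0 \<le> (2 * \<epsilon> * x - 1)\<^sup>2 / (4 * \<epsilon>)" using assms by simp
    also have "\<dots> = 1 / (4 * \<epsilon>) + \<epsilon> * x\<^sup>2 - x"
      using assms by (simp add: field_simps power2_eq_square)
    finally show ?thesis by simp
  qed
  finally show "x ^ N \<le> ?C * exp (\<epsilon> * x\<^sup>2)"
    by (simp add: exp_add[symmetric] mult.assoc)
qed

lemma weight_eq: "weight \<theta> z = exp (\<theta> * (1 + (norm z)\<^sup>2))"
  by (cases z) (simp add: weight_def norm_Pair)

definition velocity_noise :: "real \<Rightarrow> real \<Rightarrow> real \<Rightarrow> 'n::finite phase \<Rightarrow> real^'n" where
  "velocity_noise \<gamma> \<beta> h \<omega> = sqrt (2 * \<gamma> * h / \<beta>) *\<^sub>R snd \<omega>"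

definition position_noise :: "real \<Rightarrow> real \<Rightarrow> real \<Rightarrow> 'n::finite phase \<Rightarrow> real^'n" where
  "position_noise \<gamma> \<beta> h \<omega> = (h / 2) *\<^sub>R velocity_noise \<gamma> \<beta> h \<omega> + sqrt (\<gamma> * h ^ 3 / (6 * \<beta>)) *\<^sub>R fst \<omega>"

lemma kinetic_step_eq:
  "kinetic_step \<gamma> \<beta> h z \<omega> =
    (fst z + (h *\<^sub>R snd z + position_noise \<gamma> \<beta> h \<omega>), snd z + velocity_noise \<gamma> \<beta> h \<omega>)"
  by (cases z; cases \<omega>) (simp add: kinetic_step_def position_noise_def velocity_noise_def Let_def)

lemma noise_uminus:
  "velocity_noise \<gamma> \<beta> h (- \<omega>) = - velocity_noise \<gamma> \<beta> h \<omega>"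
  "position_noise \<gamma> \<beta> h (- \<omega>) = - position_noise \<gamma> \<beta> h \<omega>"
  by (simp_all add: velocity_noise_def position_noise_def)

text \<open>A displacement bound that is the same for \<open>\<omega>\<close> and
  \<open>- \<omega>\<close>; as a sum of norms it also covers every intermediate point of the two
  reflected moves.\<close>

definition step_radius :: "real \<Rightarrow> real \<Rightarrow> real \<Rightarrow> 'n::finite phase \<Rightarrow> 'n phase \<Rightarrow> real" where
  "step_radius \<gamma> \<beta> h z \<omega> =
    norm (h *\<^sub>R snd z) + norm (position_noise \<gamma> \<beta> h \<omega>) + norm (velocity_noise \<gamma> \<beta> h \<omega>)"

lemma step_radius_nonneg: "0 \<le> step_radius \<gamma> \<beta> h z \<omega>"
  by (simp add: step_radius_def)

lemma norm_kinetic_step_diff: "norm (kinetic_step \<gamma> \<beta> h z \<omega> - z) \<le> step_radius \<gamma> \<beta> h z \<omega>"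
proof -
  have "kinetic_step \<gamma> \<beta> h z \<omega> - z = (h *\<^sub>R snd z + position_noise \<gamma> \<beta> h \<omega>, velocity_noise \<gamma> \<beta> h \<omega>)"
    by (cases z) (simp add: kinetic_step_eq)
  then have "norm (kinetic_step \<gamma> \<beta> h z \<omega> - z)
      \<le> norm (h *\<^sub>R snd z + position_noise \<gamma> \<beta> h \<omega>) + norm (velocity_noise \<gamma> \<beta> h \<omega>)"
    using norm_Pair_le by simp
  also have "\<dots> \<le> step_radius \<gamma> \<beta> h z \<omega>"
    unfolding step_radius_def by (rule add_right_mono[OF norm_triangle_ineq])
  finally show ?thesis .
qed

lemma noise_bounds:
  assumes pos: "\<gamma> > 0" "\<beta> > 0"
  obtains c :: real where "c \<ge> 1"
    "\<And>h (\<omega>::'n::finite phase). 0 < h \<Longrightarrow> h \<le> 1 \<Longrightarrow> norm (velocity_noise \<gamma> \<beta> h \<omega>) \<le> c * sqrt h * norm \<omega>"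
    "\<And>h (\<omega>::'n::finite phase). 0 < h \<Longrightarrow> h \<le> 1 \<Longrightarrow> norm (position_noise \<gamma> \<beta> h \<omega>) \<le> c * (h * sqrt h) * norm \<omega>"
proof
  let ?a = "sqrt (2 * \<gamma> / \<beta>)" and ?b = "sqrt (\<gamma> / (6 * \<beta>))"
  let ?c = "1 + ?a + ?b"
  have ab: "0 \<le> ?a" "0 \<le> ?b" using pos by auto
  then show "?c \<ge> 1" by simp
  fix h :: real and \<omega> :: "'n phase" assume h: "0 < h" "h \<le> 1"
  obtain p q where \<omega>: "\<omega> = (p, q)" by (cases \<omega>)
  have pq: "norm p \<le> norm \<omega>" "norm q \<le> norm \<omega>"
    unfolding \<omega> by (rule norm_fst_le norm_snd_le)+
  have v: "norm (velocity_noise \<gamma> \<beta> h \<omega>) = ?a * sqrt h * norm q"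
    using h pos by (simp add: velocity_noise_def \<omega> real_sqrt_mult real_sqrt_divide)
  also have "\<dots> \<le> ?a * sqrt h * norm \<omega>"
    using pq ab h by (intro mult_left_mono) auto
  finally have v': "norm (velocity_noise \<gamma> \<beta> h \<omega>) \<le> ?a * sqrt h * norm \<omega>" .
  also have "\<dots> \<le> ?c * sqrt h * norm \<omega>"
    using ab h by (intro mult_right_mono) auto
  finally show "norm (velocity_noise \<gamma> \<beta> h \<omega>) \<le> ?c * sqrt h * norm \<omega>" .
  have s: "sqrt (\<gamma> * h ^ 3 / (6 * \<beta>)) = ?b * (h * sqrt h)"
  proof -
    have "\<gamma> * h ^ 3 / (6 * \<beta>) = \<gamma> / (6 * \<beta>) * (h\<^sup>2 * h)"
      by (simp add: power2_eq_square power3_eq_cube)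
    then show ?thesis
      using h by (simp only: real_sqrt_mult) simp
  qed
  have "norm (position_noise \<gamma> \<beta> h \<omega>) \<le> norm ((h / 2) *\<^sub>R velocity_noise \<gamma> \<beta> h \<omega>) + norm (sqrt (\<gamma> * h ^ 3 / (6 * \<beta>)) *\<^sub>R p)"
    unfolding position_noise_def \<omega> by (simp add: norm_triangle_ineq del: norm_scaleR)
  also have "\<dots> = h / 2 * norm (velocity_noise \<gamma> \<beta> h \<omega>) + ?b * (h * sqrt h) * norm p"
    using h pos by (simp add: s)
  also have "\<dots> \<le> h * (?a * sqrt h * norm \<omega>) + ?b * (h * sqrt h) * norm \<omega>"
    using pq ab h v' by (intro add_mono mult_mono) auto
  also have "\<dots> \<le> ?c * (h * sqrt h) * norm \<omega>"
    using h by (simp add: algebra_simps)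
  finally show "norm (position_noise \<gamma> \<beta> h \<omega>) \<le> ?c * (h * sqrt h) * norm \<omega>" .
qed

text \<open>With s = sqrt h and rho = 1 + |z| + |omega| the radius is O(s rho), so the exponent
  gains at most L s rho^2. For small s this is (eps/6) rho^2; the polynomial factor costs another
  eps/6, and rho^2 <= 3 (1 + |z|^2 + |omega|^2) turns the sum into eps. The fourth power of rho is
  the one produced by the Taylor remainder.\<close>

lemma step_growth:
  fixes K \<theta> \<epsilon> :: real
  assumes pos: "\<gamma> > 0" "\<beta> > 0" "\<theta> \<ge> 0" "\<epsilon> > 0" "K \<ge> 0"
  obtains h0 C c where "0 < h0" "h0 \<le> 1" "0 < C"
    "\<And>h (z::'n::finite phase) \<omega> \<delta> R. 0 < h \<Longrightarrow> h \<le> h0 \<Longrightarrow> \<delta> = step_radius \<gamma> \<beta> h z \<omega> \<Longrightarrow> R = 1 + norm z + \<delta> \<Longrightarrow>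
      exp (\<theta> * (1 + (norm z + \<delta>)\<^sup>2)) * exp (2 * K * R * \<delta>) * (R ^ N * (1 + norm z + norm \<omega>) ^ 4)
        \<le> C * exp ((\<theta> + \<epsilon>) * (1 + (norm z)\<^sup>2)) * exp (\<epsilon> * (norm \<omega>)\<^sup>2)"
    "c \<ge> 1"
    "\<And>h (\<omega>::'n::finite phase). 0 < h \<Longrightarrow> h \<le> h0 \<Longrightarrow> norm (velocity_noise \<gamma> \<beta> h \<omega>) \<le> c * sqrt h * norm \<omega>"
    "\<And>h (\<omega>::'n::finite phase). 0 < h \<Longrightarrow> h \<le> h0 \<Longrightarrow> norm (position_noise \<gamma> \<beta> h \<omega>) \<le> c * (h * sqrt h) * norm \<omega>"
proof -
  obtain c where c: "c \<ge> 1"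
    "\<And>h (\<omega>::'n phase). 0 < h \<Longrightarrow> h \<le> 1 \<Longrightarrow> norm (velocity_noise \<gamma> \<beta> h \<omega>) \<le> c * sqrt h * norm \<omega>"
    "\<And>h (\<omega>::'n phase). 0 < h \<Longrightarrow> h \<le> 1 \<Longrightarrow> norm (position_noise \<gamma> \<beta> h \<omega>) \<le> c * (h * sqrt h) * norm \<omega>"
    using noise_bounds[OF pos(1,2)] by metis
  obtain C1 where C1: "C1 > 0" "\<And>x. x \<ge> 0 \<Longrightarrow> x ^ (N + 4) \<le> C1 * exp (\<epsilon> / 6 * x\<^sup>2)"
    using power_le_exp_square[of "\<epsilon> / 6" "N + 4"] pos by auto
  \<comment> \<open>The coefficients of s rho^2 in \<open>e1\<close>, multiplied by
    \<open>\<theta>\<close>, and in \<open>e2\<close> below; the 1 keeps it positive.\<close>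
  define L where "L = 8 * \<theta> * c\<^sup>2 + 12 * K * c\<^sup>2 + 1"
  have L: "L > 0" using pos by (simp add: L_def add_nonneg_pos)
  \<comment> \<open>A bound on sqrt h, which is the small parameter here; the admissible step size
    is its square.\<close>
  define s0 where "s0 = min 1 (\<epsilon> / (6 * L))"
  have s0: "0 < s0" "s0 \<le> 1" "s0 * L \<le> \<epsilon> / 6"
    using L pos by (auto simp: s0_def min_def field_simps)
  have h1: "h \<le> 1" if "h \<le> s0\<^sup>2" for h
    using that power_le_one[of s0 2] s0 by linarith
  show ?thesis
  proof (rule that[of "s0\<^sup>2" "(3 * c) ^ N * C1" c])
    show "0 < s0\<^sup>2" "s0\<^sup>2 \<le> 1" "0 < (3 * c) ^ N * C1" "c \<ge> 1"
      using s0 C1 c(1) by (auto intro: power_le_one)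
    show "norm (velocity_noise \<gamma> \<beta> h \<omega>) \<le> c * sqrt h * norm \<omega>"
      "norm (position_noise \<gamma> \<beta> h \<omega>) \<le> c * (h * sqrt h) * norm \<omega>"
      if "0 < h" "h \<le> s0\<^sup>2" for h and \<omega> :: "'n phase"
      using c that h1 by auto
    fix h \<delta> R and z \<omega> :: "'n phase"
    assume h: "0 < h" "h \<le> s0\<^sup>2" and \<delta>: "\<delta> = step_radius \<gamma> \<beta> h z \<omega>" and R: "R = 1 + norm z + \<delta>"
    define s where "s = sqrt h"
    define \<rho> where "\<rho> = 1 + norm z + norm \<omega>"
    have s: "0 < s" "s \<le> s0" "s \<le> 1" "h = s * s"
    proof -
      show "0 < s" "h = s * s" using h by (simp_all add: s_def)
      show "s \<le> s0" using h s0 by (simp add: s_def real_le_lsqrt)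
      then show "s \<le> 1" using s0 by linarith
    qed
    have \<rho>: "1 \<le> \<rho>" "norm z \<le> \<rho>" by (auto simp: \<rho>_def)
    have \<delta>0: "0 \<le> \<delta>" unfolding \<delta> by (rule step_radius_nonneg)
    have \<delta>1: "\<delta> \<le> 2 * c * s * \<rho>"
    proof -
      have n: "norm (snd z) \<le> norm z" by (cases z) (simp add: norm_snd_le)
      have ss: "s * s \<le> s" using s by simp
      have "norm (h *\<^sub>R snd z) = s * s * norm (snd z)" using s by simp
      also have "\<dots> \<le> s * norm z" using ss s n by (intro mult_mono) auto
      also have "\<dots> \<le> 2 * c * s * norm z" using s c(1) by (intro mult_right_mono) auto
      finally have 1: "norm (h *\<^sub>R snd z) \<le> 2 * c * s * norm z" .
      have 2: "norm (velocity_noise \<gamma> \<beta> h \<omega>) \<le> c * s * norm \<omega>"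
        using c(2)[OF h(1) h1[OF h(2)], of \<omega>] by (simp add: s_def)
      have "h * s \<le> s" using s h1[OF h(2)] mult_right_mono[of h 1 s] by simp
      then have "c * (h * s) * norm \<omega> \<le> c * s * norm \<omega>"
        using c(1) by (intro mult_right_mono mult_left_mono) auto
      then have 3: "norm (position_noise \<gamma> \<beta> h \<omega>) \<le> c * s * norm \<omega>"
        using c(3)[OF h(1) h1[OF h(2)], of \<omega>] unfolding s_def by linarith
      have "\<delta> \<le> 2 * c * s * norm z + 2 * (c * s * norm \<omega>)"
        using 1 2 3 unfolding \<delta> step_radius_def by linarith
      also have "\<dots> \<le> 2 * c * s * \<rho>" using c(1) s by (simp add: \<rho>_def algebra_simps)
      finally show ?thesis .
    qed
    have \<delta>2: "\<delta> \<le> 2 * c * \<rho>"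
    proof -
      have "s * (2 * c * \<rho>) \<le> 1 * (2 * c * \<rho>)"
        using s(3) c(1) \<rho> by (intro mult_right_mono) auto
      moreover have "2 * c * s * \<rho> = s * (2 * c * \<rho>)" by simp
      ultimately show ?thesis using \<delta>1 by linarith
    qed
    have R1: "0 \<le> R" "R \<le> 3 * c * \<rho>"
    proof -
      show "0 \<le> R" using R \<delta>0 by simp
      have "1 + norm z \<le> \<rho>" by (simp add: \<rho>_def)
      also have "\<dots> \<le> c * \<rho>" using c(1) \<rho> by simp
      finally show "R \<le> 3 * c * \<rho>" using R \<delta>2 by simp
    qed
    have c2: "c \<le> c\<^sup>2" using c(1) by (simp add: power2_eq_square)
    have e1: "2 * norm z * \<delta> + \<delta>\<^sup>2 \<le> 8 * c\<^sup>2 * s * \<rho>\<^sup>2"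
    proof -
      have "norm z * \<delta> \<le> \<rho> * (2 * c * s * \<rho>)" using \<rho> \<delta>0 \<delta>1 by (intro mult_mono) auto
      also have "\<dots> = 2 * c * (s * \<rho>\<^sup>2)" by (simp add: power2_eq_square)
      also have "\<dots> \<le> 2 * c\<^sup>2 * (s * \<rho>\<^sup>2)" using c2 s by (intro mult_right_mono) auto
      finally have a: "norm z * \<delta> \<le> 2 * c\<^sup>2 * (s * \<rho>\<^sup>2)" .
      have "\<delta>\<^sup>2 \<le> (2 * c * \<rho>) * (2 * c * s * \<rho>)"
        unfolding power2_eq_square using \<delta>0 \<delta>1 \<delta>2 c(1) \<rho> by (intro mult_mono) auto
      also have "\<dots> = 4 * c\<^sup>2 * (s * \<rho>\<^sup>2)" by (simp add: power2_eq_square)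
      finally show ?thesis using a by (simp add: mult.assoc)
    qed
    have e2: "2 * K * R * \<delta> \<le> 12 * K * c\<^sup>2 * s * \<rho>\<^sup>2"
    proof -
      have "R * \<delta> \<le> (3 * c * \<rho>) * (2 * c * s * \<rho>)"
        using R1 \<delta>0 \<delta>1 c(1) \<rho> by (intro mult_mono) auto
      then have "2 * K * (R * \<delta>) \<le> 2 * K * ((3 * c * \<rho>) * (2 * c * s * \<rho>))"
        using pos by (intro mult_left_mono) auto
      then show ?thesis by (simp add: power2_eq_square mult_ac)
    qed
    have \<rho>2: "\<rho>\<^sup>2 \<le> 3 * (1 + (norm z)\<^sup>2 + (norm \<omega>)\<^sup>2)"
      using zero_le_power2[of "1 - norm z"] zero_le_power2[of "1 - norm \<omega>"] zero_le_power2[of "norm z - norm \<omega>"]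
      unfolding \<rho>_def by (simp add: power2_eq_square algebra_simps)
    have "\<theta> * (1 + (norm z + \<delta>)\<^sup>2) + 2 * K * R * \<delta>
       = \<theta> * (1 + (norm z)\<^sup>2) + \<theta> * (2 * norm z * \<delta> + \<delta>\<^sup>2) + 2 * K * R * \<delta>"
      by (simp add: power2_eq_square algebra_simps)
    also have "\<dots> \<le> \<theta> * (1 + (norm z)\<^sup>2) + \<theta> * (8 * c\<^sup>2 * s * \<rho>\<^sup>2) + 12 * K * c\<^sup>2 * s * \<rho>\<^sup>2"
      using e2 mult_left_mono[OF e1 pos(3)] by linarith
    also have "\<dots> \<le> \<theta> * (1 + (norm z)\<^sup>2) + (s * L) * \<rho>\<^sup>2"
      using s by (simp add: L_def algebra_simps)
    also have "(s * L) * \<rho>\<^sup>2 \<le> \<epsilon> / 6 * \<rho>\<^sup>2"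
    proof -
      have "s * L \<le> \<epsilon> / 6" using mult_right_mono[OF s(2) less_imp_le[OF L]] s0(3) by linarith
      then show ?thesis by (rule mult_right_mono) simp
    qed
    finally have "exp (\<theta> * (1 + (norm z + \<delta>)\<^sup>2) + 2 * K * R * \<delta>) \<le> exp (\<theta> * (1 + (norm z)\<^sup>2) + \<epsilon> / 6 * \<rho>\<^sup>2)"
      by simp
    moreover have "R ^ N * \<rho> ^ 4 \<le> (3 * c) ^ N * C1 * exp (\<epsilon> / 6 * \<rho>\<^sup>2)"
    proof -
      have "R ^ N * \<rho> ^ 4 \<le> (3 * c * \<rho>) ^ N * \<rho> ^ 4"
        using R1 \<rho> by (intro mult_right_mono power_mono) auto
      also have "\<dots> = (3 * c) ^ N * \<rho> ^ (N + 4)" by (simp add: power_mult_distrib power_add)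
      also have "\<dots> \<le> (3 * c) ^ N * (C1 * exp (\<epsilon> / 6 * \<rho>\<^sup>2))"
        using C1(2)[of \<rho>] \<rho> c(1) by (intro mult_left_mono) auto
      finally show ?thesis by (simp add: mult.assoc)
    qed
    ultimately have "exp (\<theta> * (1 + (norm z + \<delta>)\<^sup>2) + 2 * K * R * \<delta>) * (R ^ N * \<rho> ^ 4)
       \<le> exp (\<theta> * (1 + (norm z)\<^sup>2) + \<epsilon> / 6 * \<rho>\<^sup>2) * ((3 * c) ^ N * C1 * exp (\<epsilon> / 6 * \<rho>\<^sup>2))"
      by (rule mult_mono) (use R1 \<rho> in auto)
    also have "\<dots> = (3 * c) ^ N * C1 * exp (\<theta> * (1 + (norm z)\<^sup>2) + \<epsilon> / 3 * \<rho>\<^sup>2)"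
      by (simp add: exp_add[symmetric])
    also have "\<dots> \<le> (3 * c) ^ N * C1 * exp ((\<theta> + \<epsilon>) * (1 + (norm z)\<^sup>2) + \<epsilon> * (norm \<omega>)\<^sup>2)"
    proof -
      have "\<epsilon> / 3 * \<rho>\<^sup>2 \<le> \<epsilon> / 3 * (3 * (1 + (norm z)\<^sup>2 + (norm \<omega>)\<^sup>2))"
        using \<rho>2 pos by (intro mult_left_mono) auto
      then have "\<theta> * (1 + (norm z)\<^sup>2) + \<epsilon> / 3 * \<rho>\<^sup>2 \<le> (\<theta> + \<epsilon>) * (1 + (norm z)\<^sup>2) + \<epsilon> * (norm \<omega>)\<^sup>2"
        by (simp add: algebra_simps)
      then show ?thesis using C1(1) c(1) by (intro mult_left_mono) auto
    qed
    finally show "exp (\<theta> * (1 + (norm z + \<delta>)\<^sup>2)) * exp (2 * K * R * \<delta>) * (R ^ N * (1 + norm z + norm \<omega>) ^ 4)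
        \<le> (3 * c) ^ N * C1 * exp ((\<theta> + \<epsilon>) * (1 + (norm z)\<^sup>2)) * exp (\<epsilon> * (norm \<omega>)\<^sup>2)"
      by (simp add: exp_add \<rho>_def mult.assoc)
  qed
qed

subsection \<open>The one-step expectation\<close>

text \<open>A real bound \<open>F\<close> in place of the extended norm, so that the constant
  function 1 can be a test function with F = 1.\<close>

definition weight_bounded :: "real \<Rightarrow> real \<Rightarrow> ('n::finite phase \<Rightarrow> real) \<Rightarrow> bool" where
  "weight_bounded \<theta> F f \<longleftrightarrow> C_k 4 f \<and> 0 \<le> F \<and>
    (\<forall>bs z. set bs \<subseteq> Basis \<longrightarrow> length bs \<le> 4 \<longrightarrow> \<bar>dir_deriv bs f z\<bar> \<le> F * weight \<theta> z)"

lemma weight_boundedD: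
  assumes "weight_bounded \<theta> F f"
  shows "C_k 4 f" "0 \<le> F"
    "set bs \<subseteq> Basis \<Longrightarrow> length bs \<le> 4 \<Longrightarrow> \<bar>dir_deriv bs f z\<bar> \<le> F * weight \<theta> z"
  using assms unfolding weight_bounded_def by blast+

lemma weight_mono:
  assumes "0 \<le> \<theta>" "norm (z' - z) \<le> \<delta>"
  shows "weight \<theta> z' \<le> exp (\<theta> * (1 + (norm z + \<delta>)\<^sup>2))"
proof -
  have "norm z' \<le> norm z + \<delta>" using assms(2) norm_triangle_sub[of z' z] by simp
  then have "(norm z')\<^sup>2 \<le> (norm z + \<delta>)\<^sup>2" by (intro power_mono) auto
  then show ?thesis unfolding weight_eq using assms(1) by (simp add: mult_left_mono)
qed

lemma weight_ge_1: "0 \<le> \<theta> \<Longrightarrow> 1 \<le> weight \<theta> z"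
  by (simp add: weight_eq)

lemma continuous_measurable: "C_k k f \<Longrightarrow> f \<in> borel_measurable borel"
  by (rule borel_measurable_continuous_onI[OF C_k_continuous])

text \<open>By the noise scaling every term is O(h^2); lower powers of S, c and rho are raised to
  the fourth. The total is 5/2 * 8 + 43/12 + 14 + 10 < 48.\<close>

lemma remainder_terms_le:
  fixes S c \<rho> h :: real
  assumes S: "1 \<le> S" and c: "1 \<le> c" and \<rho>: "1 \<le> \<rho>" and h: "0 < h" "h \<le> 1"
    and w: "0 \<le> w" "w \<le> \<rho>" and x: "0 \<le> x" "x \<le> c * sqrt h * \<rho>" and b: "0 \<le> b" "b \<le> c * (h * sqrt h) * \<rho>"
    and a: "0 \<le> a1" "a1 \<le> h * w + b" "0 \<le> a2" "a2 \<le> h * w + b"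
  shows "5 / 2 * ((S * a1)\<^sup>2 + (S * a2)\<^sup>2) + 43 / 12 * (S * x) ^ 4 + 14 * h * (S * w) * (S * x)\<^sup>2 + 10 * (S * b) * (S * x)
    \<le> 48 * (S ^ 4 * c ^ 4 * (h\<^sup>2 * \<rho> ^ 4))"
proof -
  define s where "s = sqrt h"
  have s: "0 < s" "s \<le> 1" "h = s\<^sup>2" using h by (auto simp: s_def)
  define X where "X = S ^ 4 * c ^ 4 * (h\<^sup>2 * \<rho> ^ 4)"
  have h4: "h\<^sup>2 = s ^ 4" by (simp add: s(3) flip: power_mult)
  have pw: "S\<^sup>2 \<le> S ^ 4" "S ^ 3 \<le> S ^ 4" "c\<^sup>2 \<le> c ^ 4" "\<rho>\<^sup>2 \<le> \<rho> ^ 4" "\<rho> ^ 3 \<le> \<rho> ^ 4"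
    using S c \<rho> by (auto intro: power_increasing)
  \<comment> \<open>The noise part of the displacement, O(h^(3/2)), is estimated by O(h), the order
    of the drift h w.\<close>
  have a': "(S * a)\<^sup>2 \<le> 4 * X" if "0 \<le> a" "a \<le> h * w + b" for a
  proof -
    have "h * w \<le> c * h * \<rho>"
      using mult_mono[of h "c * h" w \<rho>] w h c by simp
    moreover have "c * (h * s) * \<rho> \<le> c * h * \<rho>"
      using s h c \<rho> by (intro mult_right_mono mult_left_mono) (auto simp: mult_le_cancel_left1)
    ultimately have "a \<le> 2 * (c * h * \<rho>)" using that b(2) unfolding s_def by linarith
    then have "(S * a)\<^sup>2 \<le> (S * (2 * (c * h * \<rho>)))\<^sup>2"
      using that S by (intro power_mono mult_left_mono) auto
    also have "\<dots> = 4 * (S\<^sup>2 * c\<^sup>2 * (h\<^sup>2 * \<rho>\<^sup>2))" by (simp add: power_mult_distrib)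
    also have "\<dots> \<le> 4 * X"
      unfolding X_def using pw S c h \<rho> by (intro mult_left_mono mult_mono) auto
    finally show ?thesis .
  qed
  have 1: "(S * x) ^ 4 \<le> X"
  proof -
    have "(S * x) ^ 4 \<le> (S * (c * s * \<rho>)) ^ 4"
      using x S unfolding s_def by (intro power_mono mult_left_mono) auto
    also have "\<dots> = X" by (simp add: X_def h4 power_mult_distrib)
    finally show ?thesis .
  qed
  have 2: "h * (S * w) * (S * x)\<^sup>2 \<le> X"
  proof -
    have "h * (S * w) * (S * x)\<^sup>2 \<le> h * (S * \<rho>) * (S * (c * s * \<rho>))\<^sup>2"
      using x S w h \<rho> unfolding s_def by (intro power_mono mult_mono mult_left_mono) auto
    also have "\<dots> = S ^ 3 * c\<^sup>2 * (h\<^sup>2 * \<rho> ^ 3)" by (simp add: h4 s(3) power_mult_distrib eval_nat_numeral)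
    also have "\<dots> \<le> X"
      unfolding X_def using pw S c h \<rho> by (intro mult_left_mono mult_mono) auto
    finally show ?thesis .
  qed
  have 3: "(S * b) * (S * x) \<le> X"
  proof -
    have "(S * b) * (S * x) \<le> (S * (c * (h * s) * \<rho>)) * (S * (c * s * \<rho>))"
      using x S b h c \<rho> unfolding s_def by (intro mult_mono mult_left_mono) auto
    also have "\<dots> = S\<^sup>2 * c\<^sup>2 * (h\<^sup>2 * \<rho>\<^sup>2)" by (simp add: s(3) eval_nat_numeral)
    also have "\<dots> \<le> X"
      unfolding X_def using pw S c h \<rho> by (intro mult_left_mono mult_mono) auto
    finally show ?thesis .
  qed
  have "0 \<le> X" unfolding X_def using S c \<rho> h by simp
  moreover have "14 * h * (S * w) * (S * x)\<^sup>2 \<le> 14 * X" "10 * (S * b) * (S * x) \<le> 10 * X"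
    using 2 3 by (simp_all add: mult.assoc)
  moreover have "5 / 2 * (A1 + A2) + 43 / 12 * B + D + E \<le> 48 * Y"
    if "A1 \<le> 4 * Y" "A2 \<le> 4 * Y" "B \<le> Y" "D \<le> 14 * Y" "E \<le> 10 * Y" "0 \<le> Y" for A1 A2 B D E Y :: real
    using that by (simp add: field_simps)
  ultimately show ?thesis
    using a'[OF a(1,2)] a'[OF a(3,4)] 1 unfolding X_def[symmetric] by blast
qed

context potential
begin

abbreviation step :: "real \<Rightarrow> 'n phase \<Rightarrow> 'n phase \<Rightarrow> 'n phase" where
  "step \<equiv> kinetic_step \<gamma> \<beta>"

text \<open>The Gaussian form of G_h psi; \<open>tilted h f\<close> is that of G_h (f psi).\<close>

abbreviation normalizer :: "real \<Rightarrow> 'n phase \<Rightarrow> real" where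
  "normalizer h z \<equiv> (\<integral>\<omega>. exp (q (step h z \<omega>)) \<partial>gauss)"

abbreviation tilted :: "real \<Rightarrow> ('n phase \<Rightarrow> real) \<Rightarrow> 'n phase \<Rightarrow> real" where
  "tilted h f z \<equiv> (\<integral>\<omega>. f (step h z \<omega>) * exp (q (step h z \<omega>)) \<partial>gauss)"

lemma K_le_S: "1 \<le> R \<Longrightarrow> K \<le> S R"
  using K_ge_1 one_le_power[of R "M + 1"] mult_left_mono[of 1 "R ^ (M + 1)" K] by (simp add: S_def)

text \<open>Passing to arbitrary directions costs one factor \<open>DIM('n phase)\<close> per
  direction, which each \<open>S R\<close> absorbs.\<close>

lemma dir_deriv_near_bound:
  fixes f :: "'n phase \<Rightarrow> real"
  assumes f: "weight_bounded \<theta> F f" and \<theta>: "0 \<le> \<theta>" and R: "1 \<le> R"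
    and near: "norm (z' - z) \<le> \<delta>" and us: "length us \<le> 4"
  shows "\<bar>dir_deriv us f z'\<bar> \<le> (F * exp (\<theta> * (1 + (norm z + \<delta>)\<^sup>2))) * prod_list (map (\<lambda>u. S R * norm u) us)"
proof -
  note fD = weight_boundedD[OF f]
  have D: "real DIM('n phase) \<le> S R"
    using DIM_le_K K_le_S[OF R] by linarith
  have "\<bar>dir_deriv us f z'\<bar> \<le> F * weight \<theta> z' * real DIM('n phase) ^ length us * prod_list (map norm us)"
    by (rule dir_deriv_bound[OF fD(1)]) (use fD(3) us in auto)
  also have "\<dots> = (F * weight \<theta> z') * (real DIM('n phase) ^ length us * prod_list (map norm us))" by simp
  also have "\<dots> \<le> (F * exp (\<theta> * (1 + (norm z + \<delta>)\<^sup>2))) * prod_list (map (\<lambda>u. S R * norm u) us)"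
  proof (rule mult_mono)
    show "F * weight \<theta> z' \<le> F * exp (\<theta> * (1 + (norm z + \<delta>)\<^sup>2))"
      using weight_mono[OF \<theta> near] fD(2) by (rule mult_left_mono)
    show "real DIM('n phase) ^ length us * prod_list (map norm us) \<le> prod_list (map (\<lambda>u. S R * norm u) us)"
    proof (induction us)
      case (Cons u us)
      have "real DIM('n phase) ^ length (u # us) * prod_list (map norm (u # us))
          = (real DIM('n phase) * norm u) * (real DIM('n phase) ^ length us * prod_list (map norm us))"
        by (simp add: mult_ac)
      also have "\<dots> \<le> (S R * norm u) * prod_list (map (\<lambda>u. S R * norm u) us)"
        using D Cons.IH by (intro mult_mono) (auto intro!: mult_nonneg_nonneg prod_list_nonneg intro: order_trans[of 0 "real DIM('n phase)"])
      finally show ?case by simp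
    qed simp
    show "0 \<le> real DIM('n phase) ^ length us * prod_list (map norm us)"
      by (intro mult_nonneg_nonneg prod_list_nonneg) auto
  qed (use fD(2) in auto)
  finally show ?thesis .
qed

lemma exp_q_near_bound:
  assumes "norm (z' - z) \<le> \<delta>" "R = 1 + norm z + \<delta>"
  shows "exp (q z') \<le> exp (q z) * exp (2 * K * R * \<delta>)"
  using q_lipschitz[OF assms(1), of R] assms(2) by (simp add: abs_le_iff flip: exp_add)

text \<open>The absolute value in the first exponent controls psi(Z) / psi(z) and its reciprocal at
  once; the reciprocal is what the denominator needs. The second bound keeps exp (q z) as a factor,
  so that the remainder is relative to psi(z). The cap on eps makes the noise factor
  integrable.\<close>

lemma step_bounds:
  assumes \<theta>: "0 \<le> \<theta>" and \<epsilon>: "0 < \<epsilon>" "\<epsilon> \<le> 1 / 4"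
  obtains h0 C0 where "0 < h0" "h0 \<le> 1" "0 < C0"
    "\<And>h z \<omega>. 0 < h \<Longrightarrow> h \<le> h0 \<Longrightarrow>
      weight \<theta> (step h z \<omega>) * exp \<bar>q (step h z \<omega>) - q z\<bar>
        \<le> C0 * exp ((\<theta> + \<epsilon>) * (1 + (norm z)\<^sup>2)) * exp ((norm \<omega>)\<^sup>2 / 4)"
    "\<And>h z \<omega> F f. 0 < h \<Longrightarrow> h \<le> h0 \<Longrightarrow> weight_bounded \<theta> F f \<Longrightarrow>
      \<bar>f (step h z \<omega>) * exp (q (step h z \<omega>))
        + f (step h z (- \<omega>)) * exp (q (step h z (- \<omega>)))
        - 2 * (f z * exp (q z)) - gvv f (velocity_noise \<gamma> \<beta> h \<omega>) z - 2 * h * gx f (snd z) z\<bar>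
      \<le> C0 * h\<^sup>2 * F * exp (q z) * exp ((\<theta> + \<epsilon>) * (1 + (norm z)\<^sup>2)) * exp ((norm \<omega>)\<^sup>2 / 4)"
proof -
  obtain h0 C c where h0: "0 < h0" "h0 \<le> 1" "0 < C" and c: "c \<ge> 1" and
    grow: "\<And>h (z::'n phase) \<omega> \<delta> R. 0 < h \<Longrightarrow> h \<le> h0 \<Longrightarrow> \<delta> = step_radius \<gamma> \<beta> h z \<omega> \<Longrightarrow> R = 1 + norm z + \<delta> \<Longrightarrow>
      exp (\<theta> * (1 + (norm z + \<delta>)\<^sup>2)) * exp (2 * K * R * \<delta>) * (R ^ (4 * (M + 1)) * (1 + norm z + norm \<omega>) ^ 4)
        \<le> C * exp ((\<theta> + \<epsilon>) * (1 + (norm z)\<^sup>2)) * exp (\<epsilon> * (norm \<omega>)\<^sup>2)" and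
    noise: "\<And>h (\<omega>::'n phase). 0 < h \<Longrightarrow> h \<le> h0 \<Longrightarrow> norm (velocity_noise \<gamma> \<beta> h \<omega>) \<le> c * sqrt h * norm \<omega>"
    "\<And>h (\<omega>::'n phase). 0 < h \<Longrightarrow> h \<le> h0 \<Longrightarrow> norm (position_noise \<gamma> \<beta> h \<omega>) \<le> c * (h * sqrt h) * norm \<omega>"
    by (rule step_growth[where N="4 * (M + 1)" and K=K, OF pos(1,2) \<theta> \<epsilon>(1) order_trans[OF zero_le_one K_ge_1]])
       (rule that; assumption)
  have \<epsilon>_exp: "exp (\<epsilon> * (norm \<omega>)\<^sup>2) \<le> exp ((norm \<omega>)\<^sup>2 / 4)" for \<omega> :: "'n phase"
    using mult_right_mono[OF \<epsilon>(2) zero_le_power2[of "norm \<omega>"]] by simp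
  have grow': "exp (\<theta> * (1 + (norm z + \<delta>)\<^sup>2)) * exp (2 * K * R * \<delta>) * (R ^ (4 * (M + 1)) * (1 + norm z + norm \<omega>) ^ 4)
        \<le> C * exp ((\<theta> + \<epsilon>) * (1 + (norm z)\<^sup>2)) * exp ((norm \<omega>)\<^sup>2 / 4)"
    if "0 < h" "h \<le> h0" "\<delta> = step_radius \<gamma> \<beta> h z \<omega>" "R = 1 + norm z + \<delta>" for h \<delta> R and z \<omega> :: "'n phase"
    by (rule order_trans[OF grow[OF that]]) (use \<epsilon>_exp h0 in \<open>auto intro!: mult_left_mono\<close>)
  define C0 where "C0 = max C (48 * (K ^ 4 * c ^ 4) * C)"
  have C0: "0 < C0" "C \<le> C0" "48 * (K ^ 4 * c ^ 4) * C \<le> C0" using h0 by (auto simp: C0_def)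
  show ?thesis
  proof (rule that[OF h0(1,2) C0(1)])
    fix h and z \<omega> :: "'n phase" assume h: "0 < h" "h \<le> h0"
    define \<delta> where "\<delta> = step_radius \<gamma> \<beta> h z \<omega>"
    define R where "R = 1 + norm z + \<delta>"
    let ?z = "step h z \<omega>"
    have n: "norm (?z - z) \<le> \<delta>" unfolding \<delta>_def by (rule norm_kinetic_step_diff)
    have \<delta>0: "0 \<le> \<delta>" unfolding \<delta>_def by (rule step_radius_nonneg)
    \<comment> \<open>The polynomial factor of the growth bound is at least 1, so the same bound
      also serves the quantity without it.\<close>
    have "1 \<le> R ^ (4 * (M + 1))" "1 \<le> (1 + norm z + norm \<omega>) ^ 4"
      using \<delta>0 by (auto intro!: one_le_power simp: R_def)
    then have one: "1 \<le> R ^ (4 * (M + 1)) * (1 + norm z + norm \<omega>) ^ 4"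
      using mult_mono[of 1 "R ^ (4 * (M + 1))" 1 "(1 + norm z + norm \<omega>) ^ 4"] by simp
    have "weight \<theta> ?z * exp \<bar>q ?z - q z\<bar> \<le> exp (\<theta> * (1 + (norm z + \<delta>)\<^sup>2)) * exp (2 * K * R * \<delta>)"
      using weight_mono[OF \<theta> n] q_lipschitz[OF n, of R] by (intro mult_mono) (auto simp: R_def)
    also have "\<dots> \<le> exp (\<theta> * (1 + (norm z + \<delta>)\<^sup>2)) * exp (2 * K * R * \<delta>) * (R ^ (4 * (M + 1)) * (1 + norm z + norm \<omega>) ^ 4)"
      using one by simp
    also have "\<dots> \<le> C * exp ((\<theta> + \<epsilon>) * (1 + (norm z)\<^sup>2)) * exp ((norm \<omega>)\<^sup>2 / 4)"
      by (rule grow'[OF h \<delta>_def R_def])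
    also have "\<dots> \<le> C0 * exp ((\<theta> + \<epsilon>) * (1 + (norm z)\<^sup>2)) * exp ((norm \<omega>)\<^sup>2 / 4)"
      using C0 by (intro mult_right_mono) auto
    finally show "weight \<theta> ?z * exp \<bar>q ?z - q z\<bar> \<le> C0 * exp ((\<theta> + \<epsilon>) * (1 + (norm z)\<^sup>2)) * exp ((norm \<omega>)\<^sup>2 / 4)" .
  next
    fix h F and z \<omega> :: "'n phase" and f :: "'n phase \<Rightarrow> real"
    assume h: "0 < h" "h \<le> h0" and f: "weight_bounded \<theta> F f"
    define \<delta> where "\<delta> = step_radius \<gamma> \<beta> h z \<omega>"
    define R where "R = 1 + norm z + \<delta>"
    define \<rho> where "\<rho> = 1 + norm z + norm \<omega>"
    define b where "b = position_noise \<gamma> \<beta> h \<omega>"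
    define \<xi> where "\<xi> = velocity_noise \<gamma> \<beta> h \<omega>"
    obtain y w where z: "z = (y, w)" by (cases z)
    have \<delta>0: "0 \<le> \<delta>" unfolding \<delta>_def by (rule step_radius_nonneg)
    have R1: "1 \<le> R" using \<delta>0 by (simp add: R_def)
    have F: "0 \<le> F" using weight_boundedD(2)[OF f] .
    have \<rho>: "1 \<le> \<rho>" "norm w \<le> \<rho>" "norm \<omega> \<le> \<rho>"
    proof -
      have "norm w \<le> norm z" unfolding z by (rule norm_snd_le)
      then show "1 \<le> \<rho>" "norm w \<le> \<rho>" "norm \<omega> \<le> \<rho>"
        using norm_ge_zero[of \<omega>] norm_ge_zero[of z] unfolding \<rho>_def by linarith+
    qed
    have sz: "snd z = w" by (simp add: z)
    have step: "step h z \<omega> = (y + (h *\<^sub>R w + b), w + \<xi>)"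
      "step h z (- \<omega>) = (y + (h *\<^sub>R w - b), w - \<xi>)"
      by (simp_all add: kinetic_step_eq noise_uminus z b_def \<xi>_def)
    let ?\<Phi> = "F * exp (\<theta> * (1 + (norm z + \<delta>)\<^sup>2))" and ?\<Psi> = "exp (q z) * exp (2 * K * R * \<delta>)"
    let ?T = "5 / 2 * ((S R * norm (h *\<^sub>R w + b))\<^sup>2 + (S R * norm (h *\<^sub>R w - b))\<^sup>2) + 43 / 12 * (S R * norm \<xi>) ^ 4
       + 14 * h * (S R * norm w) * (S R * norm \<xi>)\<^sup>2 + 10 * (S R * norm b) * (S R * norm \<xi>)"
    have S1: "1 \<le> S R" using K_ge_1 K_le_S[OF R1] by linarith
    have T: "?T \<le> 48 * (S R ^ 4 * c ^ 4 * (h\<^sup>2 * \<rho> ^ 4))"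
    proof (rule remainder_terms_le[OF S1 c \<rho>(1)])
      show "norm \<xi> \<le> c * sqrt h * \<rho>"
        unfolding \<xi>_def by (rule order_trans[OF noise(1)[OF h]]) (use c h \<rho> in \<open>auto intro!: mult_left_mono\<close>)
      show "norm b \<le> c * (h * sqrt h) * \<rho>"
        unfolding b_def by (rule order_trans[OF noise(2)[OF h]]) (use c h \<rho> in \<open>auto intro!: mult_left_mono\<close>)
      show "norm (h *\<^sub>R w + b) \<le> h * norm w + norm b"
        using norm_triangle_ineq[of "h *\<^sub>R w" b] h by simp
      show "norm (h *\<^sub>R w - b) \<le> h * norm w + norm b"
        using norm_triangle_ineq4[of "h *\<^sub>R w" b] h by simp
    qed (use h h0 \<rho> in auto)
    have "\<bar>f (step h z \<omega>) * exp (q (step h z \<omega>))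
        + f (step h z (- \<omega>)) * exp (q (step h z (- \<omega>)))
        - 2 * (f z * exp (q z)) - gvv f \<xi> z - 2 * h * gx f (snd z) z\<bar> \<le> ?\<Phi> * ?\<Psi> * ?T"
      unfolding step sz
    proof (rule expansion[OF weight_boundedD(1)[OF f] _ _ _ z])
      show "norm (h *\<^sub>R w) + norm b + norm \<xi> \<le> \<delta>"
        by (simp add: \<delta>_def step_radius_def sz b_def \<xi>_def)
      show "1 + norm z + \<delta> \<le> R" by (simp add: R_def)
    qed (use dir_deriv_near_bound[OF f \<theta> R1, of _ z \<delta>] exp_q_near_bound[of _ z \<delta> R] h in \<open>auto simp: R_def\<close>)
    also have "\<dots> \<le> ?\<Phi> * ?\<Psi> * (48 * (S R ^ 4 * c ^ 4 * (h\<^sup>2 * \<rho> ^ 4)))"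
      using T F by (intro mult_left_mono) auto
    \<comment> \<open>\<open>S R ^ 4\<close> contributes R^(4 (M + 1)), the power for which the
      growth bound was instantiated.\<close>
    also have "\<dots> = (48 * (K ^ 4 * c ^ 4)) * h\<^sup>2 * F * exp (q z) *
        (exp (\<theta> * (1 + (norm z + \<delta>)\<^sup>2)) * exp (2 * K * R * \<delta>) * (R ^ (4 * (M + 1)) * \<rho> ^ 4))"
      unfolding S_def power_mult_distrib power_mult[symmetric] by (simp add: mult_ac)
    also have "\<dots> \<le> (48 * (K ^ 4 * c ^ 4)) * h\<^sup>2 * F * exp (q z) * (C * exp ((\<theta> + \<epsilon>) * (1 + (norm z)\<^sup>2)) * exp ((norm \<omega>)\<^sup>2 / 4))"
      unfolding \<rho>_def using F K_ge_1 c by (intro mult_left_mono grow'[OF h \<delta>_def R_def]) auto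
    also have "\<dots> = (48 * (K ^ 4 * c ^ 4) * C) * (h\<^sup>2 * F * exp (q z) * exp ((\<theta> + \<epsilon>) * (1 + (norm z)\<^sup>2)) * exp ((norm \<omega>)\<^sup>2 / 4))"
      by simp
    also have "\<dots> \<le> C0 * (h\<^sup>2 * F * exp (q z) * exp ((\<theta> + \<epsilon>) * (1 + (norm z)\<^sup>2)) * exp ((norm \<omega>)\<^sup>2 / 4))"
      using C0(3) F by (intro mult_right_mono) auto
    finally show "\<bar>f (step h z \<omega>) * exp (q (step h z \<omega>))
        + f (step h z (- \<omega>)) * exp (q (step h z (- \<omega>)))
        - 2 * (f z * exp (q z)) - gvv f (velocity_noise \<gamma> \<beta> h \<omega>) z - 2 * h * gx f (snd z) z\<bar>
      \<le> C0 * h\<^sup>2 * F * exp (q z) * exp ((\<theta> + \<epsilon>) * (1 + (norm z)\<^sup>2)) * exp ((norm \<omega>)\<^sup>2 / 4)"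
      by (simp add: \<xi>_def mult.assoc)
  qed
qed

section \<open>Measurability of \<open>q\<close> and the Gaussian mean of the second velocity
  derivative\<close>

lemma q_continuous: "continuous_on UNIV q"
proof -
  have V': "continuous_on UNIV (\<lambda>z::'n phase. V (fst z))" "continuous_on UNIV (\<lambda>z::'n phase. dir_deriv [b] V (fst z))" for b
    using C_k_continuous[OF V] C_k_continuous[OF C_k_dir_deriv[OF V, of "[b]"]]
    by (auto intro!: continuous_on_compose2[OF _ continuous_on_fst[OF continuous_on_id]])
  have e: "dir_deriv [v] V x = (\<Sum>b\<in>Basis. (v \<bullet> b) * dir_deriv [b] V x)" for x v
    using dir_deriv_basis_sum[OF V, of "[]" v x] by simp
  have "q = (\<lambda>z. - (l * V (fst z) + \<beta> / \<gamma> * (\<Sum>b\<in>Basis. (snd z \<bullet> b) * dir_deriv [b] V (fst z)) + \<beta> / 2 * (snd z \<bullet> snd z)) / 2)"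
    unfolding q_def case_prod_beta e[symmetric] by (rule refl)
  then show ?thesis
    by (simp only:) (intro continuous_on_divide continuous_on_minus continuous_on_add continuous_on_mult continuous_on_sum
      continuous_on_inner continuous_on_snd continuous_on_id continuous_on_const V'; simp)
qed

lemma q_measurable [measurable]: "q \<in> borel_measurable borel"
  by (rule borel_measurable_continuous_onI[OF q_continuous])

text \<open>The polarisation of \<open>gvv\<close> with exp q divided out: the Gaussian trace
  formula asks for a bilinear form.\<close>

definition vform :: "('n phase \<Rightarrow> real) \<Rightarrow> 'n phase \<Rightarrow> real^'n \<Rightarrow> real^'n \<Rightarrow> real" where
  "vform f z u v = dir_deriv [(0, u), (0, v)] f z + dir_deriv [(0, u)] f z * qv v z
     + dir_deriv [(0, v)] f z * qv u z + f z * (qv u z * qv v z - \<beta> * (u \<bullet> v) / 2)"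

lemma gvv_vform: "gvv f \<xi> z = vform f z \<xi> \<xi> * exp (q z)"
  by (simp add: gvv_def vform_def qvv_def power2_eq_square algebra_simps del: foldr_Cons)

lemma bilinear_vform:
  assumes f: "C_k 4 f"
  shows "bilinear (vform f z)"
proof -
  have emb: "linear (\<lambda>u::real^'n. (0 :: real^'n, u))"
    by (auto simp: linear_iff)
  have l1: "linear (\<lambda>u. dir_deriv [(0, u)] f z)"
    using linear_compose[OF emb linear_partial_deriv[OF dir_deriv_differentiable[OF f, of "[]"]]]
    by (simp add: o_def)
  have l2: "linear (\<lambda>u. dir_deriv [(0, u), (0, v)] f z)" for v
    using linear_compose[OF emb linear_partial_deriv[OF dir_deriv_differentiable[OF f, of "[(0, v)]"]]]
    by (simp add: o_def)
  have sym: "vform f z u v = vform f z v u" for u v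
  proof -
    have "dir_deriv [(0, u), (0, v)] f = dir_deriv [(0, v), (0, u)] f"
      by (rule dir_deriv_perm[OF f]) auto
    then show ?thesis by (simp add: vform_def inner_commute algebra_simps del: foldr_Cons)
  qed
  have lin: "linear (\<lambda>u. vform f z u v)" for v
    using l1 l2[of v] linear_qv[of z] unfolding vform_def
    by (auto simp: linear_iff algebra_simps add_divide_distrib diff_divide_distrib simp del: foldr_Cons)
  moreover have "linear (vform f z u)" for u
  proof -
    have "vform f z u = (\<lambda>v. vform f z v u)" using sym by blast
    then show ?thesis using lin[of u] by simp
  qed
  ultimately show ?thesis
    unfolding bilinear_def by blast
qed

text \<open>The kinetic generator written with \<open>q\<close>: 2 (gamma/beta) times
  \<open>qv b\<close> is minus the b-component of the drift U.\<close>

definition generator_form :: "('n phase \<Rightarrow> real) \<Rightarrow> 'n phase \<Rightarrow> real" where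
  "generator_form f z = dir_deriv [(snd z, 0)] f z + \<gamma> / \<beta> * (\<Sum>b\<in>Basis. dir_deriv [(0, b), (0, b)] f z + 2 * dir_deriv [(0, b)] f z * qv b z)"

text \<open>This is D0 psi / psi: the sum collects the squared velocity gradient and the velocity
  Laplacian of \<open>q\<close>, the latter giving -beta/2 per direction.\<close>

definition zeroth_order :: "'n phase \<Rightarrow> real" where
  "zeroth_order z = qx (snd z) z + \<gamma> / \<beta> * (\<Sum>b\<in>Basis. (qv b z)\<^sup>2 - \<beta> / 2)"

text \<open>The product rule for D0 (f psi): the cross term joins D0 f to form the generator, and
  the remaining term is f D0 psi.\<close>

lemma generator_form_decomp:
  "gx f (snd z) z + \<gamma> / \<beta> * (\<Sum>b\<in>Basis. vform f z b b) * exp (q z)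
    = exp (q z) * (generator_form f z + f z * zeroth_order z)"
proof -
  have "(\<Sum>b\<in>Basis. vform f z b b) = (\<Sum>b\<in>Basis. dir_deriv [(0, b), (0, b)] f z + 2 * dir_deriv [(0, b)] f z * qv b z)
      + f z * (\<Sum>b\<in>Basis. (qv b z)\<^sup>2 - \<beta> / 2)"
    unfolding sum_distrib_left sum.distrib[symmetric]
    by (intro sum.cong refl) (simp add: vform_def inner_same_Basis power2_eq_square algebra_simps del: foldr_Cons)
  then show ?thesis
    by (simp add: gx_def generator_form_def zeroth_order_def algebra_simps del: foldr_Cons)
qed

text \<open>The form involves the velocity half of the noise only, whose variance 2 gamma h / beta
  multiplies the trace.\<close>

lemma gauss_velocity_form:
  assumes f: "C_k 4 f" and h: "0 \<le> h"
  shows "integrable gauss (\<lambda>\<omega>. gvv f (velocity_noise \<gamma> \<beta> h \<omega>) z)"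
    "(\<integral>\<omega>. gvv f (velocity_noise \<gamma> \<beta> h \<omega>) z \<partial>gauss) = 2 * h * (\<gamma> / \<beta> * (\<Sum>b\<in>Basis. vform f z b b) * exp (q z))"
proof -
  note B = bilinear_vform[OF f, of z]
  have B': "bilinear (\<lambda>\<omega> \<omega>' :: 'n phase. vform f z (snd \<omega>) (snd \<omega>'))"
    unfolding bilinear_def
    by (auto simp: linear_iff bilinear_ladd[OF B] bilinear_radd[OF B] bilinear_lmul[OF B] bilinear_rmul[OF B])
  have e: "gvv f (velocity_noise \<gamma> \<beta> h \<omega>) z = 2 * h * (\<gamma> / \<beta>) * exp (q z) * vform f z (snd \<omega>) (snd \<omega>)" for \<omega>
    using h pos by (simp add: gvv_vform velocity_noise_def bilinear_lmul[OF B] bilinear_rmul[OF B] mult.assoc[symmetric])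
  show "integrable gauss (\<lambda>\<omega>. gvv f (velocity_noise \<gamma> \<beta> h \<omega>) z)"
    unfolding e by (intro integrable_mult_right gauss_bilinear(1)[OF B'])
  \<comment> \<open>The phase-space basis splits into position and velocity vectors; the former
    contribute zero.\<close>
  have "(\<Sum>b\<in>(Basis :: 'n phase set). vform f z (snd b) (snd b)) = (\<Sum>b\<in>Basis. vform f z b b)"
  proof -
    have "inj_on (\<lambda>u. (u, 0 :: real^'n)) (Basis :: (real^'n) set)" "inj_on (\<lambda>v. (0 :: real^'n, v)) (Basis :: (real^'n) set)"
      by (auto intro!: inj_onI)
    moreover have "(\<lambda>u. (u, 0 :: real^'n)) ` Basis \<inter> (\<lambda>v. (0 :: real^'n, v)) ` (Basis :: (real^'n) set) = {}"
      using nonzero_Basis by auto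
    ultimately show ?thesis
      unfolding Basis_prod_def by (simp add: sum.union_disjoint sum.reindex bilinear_lzero[OF B])
  qed
  then show "(\<integral>\<omega>. gvv f (velocity_noise \<gamma> \<beta> h \<omega>) z \<partial>gauss) = 2 * h * (\<gamma> / \<beta> * (\<Sum>b\<in>Basis. vform f z b b) * exp (q z))"
    unfolding e by (simp add: gauss_bilinear(2)[OF B'])
qed

end

section \<open>The constant function 1 as a test function\<close>

lemma partial_deriv_const: "partial_deriv u (\<lambda>_. c) = (\<lambda>_. 0)"
  by (rule ext, rule partial_deriv_eqI) (rule has_derivative_const)

lemma C_k_const: "C_k k (\<lambda>_. c)"
  by (induction k arbitrary: c) (auto simp: partial_deriv_const)

lemma dir_deriv_const: "us \<noteq> [] \<Longrightarrow> dir_deriv us (\<lambda>_. c) = (\<lambda>_. 0)"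
proof (induction us)
  case (Cons u us)
  then show ?case by (cases "us = []") (simp_all add: partial_deriv_const)
qed simp

lemma weight_bounded_one:
  assumes "0 \<le> \<theta>"
  shows "weight_bounded \<theta> 1 (\<lambda>_. 1)"
  unfolding weight_bounded_def
proof (intro conjI allI impI)
  fix bs :: "'a phase list" and z
  show "\<bar>dir_deriv bs (\<lambda>_. 1) z\<bar> \<le> 1 * weight \<theta> z"
    using weight_ge_1[OF assms, of z] by (cases "bs = []") (simp_all add: dir_deriv_const)
qed (simp_all add: C_k_const del: C_k.simps)

context potential
begin

text \<open>Integrates the symmetric pointwise expansion. Since omega and -omega have the same law,
  the mean of the symmetric sum is twice the wanted one, and the noise factor integrates to a
  constant.\<close>

lemma one_step_expansion:
  assumes \<theta>: "0 \<le> \<theta>" and \<epsilon>: "0 < \<epsilon>" "\<epsilon> \<le> 1 / 4"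
  obtains h0 A where "0 < h0" "h0 \<le> 1" "0 < A"
    "\<And>h z. 0 < h \<Longrightarrow> h \<le> h0 \<Longrightarrow>
      integrable gauss (\<lambda>\<omega>. weight \<theta> (step h z \<omega>) * exp \<bar>q (step h z \<omega>) - q z\<bar>)"
    "\<And>h z. 0 < h \<Longrightarrow> h \<le> h0 \<Longrightarrow>
      (\<integral>\<omega>. weight \<theta> (step h z \<omega>) * exp \<bar>q (step h z \<omega>) - q z\<bar> \<partial>gauss)
        \<le> A * exp ((\<theta> + \<epsilon>) * (1 + (norm z)\<^sup>2))"
    "\<And>h z F f. 0 < h \<Longrightarrow> h \<le> h0 \<Longrightarrow> weight_bounded \<theta> F f \<Longrightarrow>
      \<bar>tilted h f z
        - exp (q z) * (f z + h * (generator_form f z + f z * zeroth_order z))\<bar>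
      \<le> A * h\<^sup>2 * F * exp (q z) * exp ((\<theta> + \<epsilon>) * (1 + (norm z)\<^sup>2))"
    "\<And>h z F f. 0 < h \<Longrightarrow> h \<le> h0 \<Longrightarrow> weight_bounded \<theta> F f \<Longrightarrow>
      integrable gauss (\<lambda>\<omega>. f (step h z \<omega>) * exp (q (step h z \<omega>)))"
    "\<And>h z F f. 0 < h \<Longrightarrow> h \<le> h0 \<Longrightarrow> weight_bounded \<theta> F f \<Longrightarrow>
      tilted h (\<lambda>z. \<bar>f z\<bar>) z
        \<le> A * F * exp (q z) * exp ((\<theta> + \<epsilon>) * (1 + (norm z)\<^sup>2))"
proof -
  obtain h0 C0 where h0: "0 < h0" "h0 \<le> 1" "0 < C0" and
    weak: "\<And>h z \<omega>. 0 < h \<Longrightarrow> h \<le> h0 \<Longrightarrow>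
      weight \<theta> (step h z \<omega>) * exp \<bar>q (step h z \<omega>) - q z\<bar>
        \<le> C0 * exp ((\<theta> + \<epsilon>) * (1 + (norm z)\<^sup>2)) * exp ((norm \<omega>)\<^sup>2 / 4)" and
    strong: "\<And>h z \<omega> F f. 0 < h \<Longrightarrow> h \<le> h0 \<Longrightarrow> weight_bounded \<theta> F f \<Longrightarrow>
      \<bar>f (step h z \<omega>) * exp (q (step h z \<omega>))
        + f (step h z (- \<omega>)) * exp (q (step h z (- \<omega>)))
        - 2 * (f z * exp (q z)) - gvv f (velocity_noise \<gamma> \<beta> h \<omega>) z - 2 * h * gx f (snd z) z\<bar>
      \<le> C0 * h\<^sup>2 * F * exp (q z) * exp ((\<theta> + \<epsilon>) * (1 + (norm z)\<^sup>2)) * exp ((norm \<omega>)\<^sup>2 / 4)"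
    by (rule step_bounds[OF assms]) (rule that; assumption)
  define c where "c = (\<integral>x. exp ((norm x)\<^sup>2 / 4) \<partial>(gauss :: 'n phase measure))"
  have c: "1 \<le> c"
  proof -
    have "(\<integral>x. 1 \<partial>(gauss :: 'n phase measure)) \<le> c"
      unfolding c_def by (intro integral_mono integrable_gauss_exp) auto
    then show ?thesis by (simp add: gauss.prob_space[simplified])
  qed
  let ?E = "\<lambda>z. exp ((\<theta> + \<epsilon>) * (1 + (norm z)\<^sup>2))"
  have w_meas [measurable]: "weight \<theta> \<in> borel_measurable borel"
    unfolding weight_eq[abs_def] by measurable
  have gauss_bound: "integrable gauss g" "(\<integral>\<omega>. \<bar>g \<omega>\<bar> \<partial>gauss) \<le> A * c"
    if [measurable]: "g \<in> borel_measurable borel" and g: "\<And>\<omega>. \<bar>g \<omega>\<bar> \<le> A * exp ((norm \<omega>)\<^sup>2 / 4)" for g :: "'n phase \<Rightarrow> real" and A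
  proof -
    have A: "integrable gauss (\<lambda>\<omega>::'n phase. A * exp ((norm \<omega>)\<^sup>2 / 4))"
      by (intro integrable_mult_right integrable_gauss_exp)
    show 1: "integrable gauss g"
      by (rule Bochner_Integration.integrable_bound[OF A]) (use g in \<open>auto intro!: order_trans[OF g abs_ge_self]\<close>)
    have "(\<integral>\<omega>. \<bar>g \<omega>\<bar> \<partial>gauss) \<le> (\<integral>\<omega>. A * exp ((norm (\<omega>::'n phase))\<^sup>2 / 4) \<partial>gauss)"
      by (intro integral_mono A) (use 1 g in auto)
    then show "(\<integral>\<omega>. \<bar>g \<omega>\<bar> \<partial>gauss) \<le> A * c" by (simp add: c_def)
  qed
  \<comment> \<open>The symmetrised error is twice the wanted one; the factor 2 is given
    away.\<close>
  have half: "2 * \<bar>x\<bar> \<le> y \<Longrightarrow> \<bar>x\<bar> \<le> y" for x y :: real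
    by linarith
  have f_bound: "\<bar>f (step h z \<omega>) * exp (q (step h z \<omega>))\<bar>
      \<le> (C0 * F * exp (q z) * ?E z) * exp ((norm \<omega>)\<^sup>2 / 4)"
    if h: "0 < h" "h \<le> h0" and f: "weight_bounded \<theta> F f" for h z \<omega> F f
  proof -
    let ?z = "step h z \<omega>"
    have "\<bar>f ?z\<bar> \<le> F * weight \<theta> ?z" using weight_boundedD(3)[OF f, of "[]" ?z] by simp
    moreover have "exp (q ?z) \<le> exp (q z) * exp \<bar>q ?z - q z\<bar>" by (simp flip: exp_add)
    ultimately have "\<bar>f ?z * exp (q ?z)\<bar> \<le> (F * weight \<theta> ?z) * (exp (q z) * exp \<bar>q ?z - q z\<bar>)"
      by (intro abs_mult_le) simp_all
    also have "\<dots> = F * exp (q z) * (weight \<theta> ?z * exp \<bar>q ?z - q z\<bar>)" by simp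
    also have "\<dots> \<le> F * exp (q z) * (C0 * ?E z * exp ((norm \<omega>)\<^sup>2 / 4))"
      using weak[OF h] weight_boundedD(2)[OF f] by (intro mult_left_mono) auto
    finally show ?thesis by (simp add: mult_ac)
  qed
  have f_meas: "(\<lambda>\<omega>. f (step h z \<omega>) * exp (q (step h z \<omega>))) \<in> borel_measurable borel"
    if f: "weight_bounded \<theta> F f" for h z F f
  proof -
    have [measurable]: "f \<in> borel_measurable borel"
      by (rule continuous_measurable[OF weight_boundedD(1)[OF f]])
    show ?thesis by measurable
  qed
  show ?thesis
  proof (rule that[of h0 "C0 * c"])
    show "0 < h0" "h0 \<le> 1" "0 < C0 * c" using h0 c by auto
    fix h z assume h: "0 < h" "h \<le> h0"
    have wm: "(\<lambda>\<omega>. weight \<theta> (step h z \<omega>) * exp \<bar>q (step h z \<omega>) - q z\<bar>) \<in> borel_measurable borel"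
      by measurable
    have wn: "0 \<le> weight \<theta> z'" for z' :: "'n phase" by (simp add: weight_eq)
    have wb: "\<bar>weight \<theta> (step h z \<omega>) * exp \<bar>q (step h z \<omega>) - q z\<bar>\<bar>
      \<le> (C0 * ?E z) * exp ((norm \<omega>)\<^sup>2 / 4)" for \<omega>
      using weak[OF h, of z \<omega>] wn by simp
    show "integrable gauss (\<lambda>\<omega>. weight \<theta> (step h z \<omega>) * exp \<bar>q (step h z \<omega>) - q z\<bar>)"
      by (rule gauss_bound(1)[OF wm wb])
    show "(\<integral>\<omega>. weight \<theta> (step h z \<omega>) * exp \<bar>q (step h z \<omega>) - q z\<bar> \<partial>gauss) \<le> C0 * c * ?E z"
      using gauss_bound(2)[OF wm wb] wn by (simp add: mult_ac)
    fix F and f :: "'n phase \<Rightarrow> real" assume f: "weight_bounded \<theta> F f"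
    note fm = f_meas[OF f, of h z] and fb = f_bound[OF h f, of z]
    show "integrable gauss (\<lambda>\<omega>. f (step h z \<omega>) * exp (q (step h z \<omega>)))"
      by (rule gauss_bound(1)[OF fm fb])
    show "tilted h (\<lambda>z. \<bar>f z\<bar>) z \<le> C0 * c * F * exp (q z) * ?E z"
      using gauss_bound(2)[OF fm fb] by (simp add: abs_mult mult_ac)
    define G where "G = (\<lambda>\<omega>. f (step h z \<omega>) * exp (q (step h z \<omega>)))"
    define v where "v = \<gamma> / \<beta> * (\<Sum>b\<in>Basis. vform f z b b) * exp (q z)"
    define S' where "S' = (\<lambda>\<omega>. G \<omega> + G (- \<omega>) - 2 * (f z * exp (q z)) - gvv f (velocity_noise \<gamma> \<beta> h \<omega>) z - 2 * h * gx f (snd z) z)"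
    have G: "G \<in> borel_measurable borel" "integrable gauss G" "integrable gauss (\<lambda>\<omega>. G (- \<omega>))"
    proof -
      show m: "G \<in> borel_measurable borel" using fm by (simp add: G_def)
      show "integrable gauss G" unfolding G_def by (rule gauss_bound(1)[OF fm fb])
      have m': "(\<lambda>\<omega>. G (- \<omega>)) \<in> borel_measurable borel" using m by measurable
      have "\<bar>G (- \<omega>)\<bar> \<le> (C0 * F * exp (q z) * ?E z) * exp ((norm \<omega>)\<^sup>2 / 4)" for \<omega>
        using fb[of "- \<omega>"] by (simp add: G_def)
      then show "integrable gauss (\<lambda>\<omega>. G (- \<omega>))" by (rule gauss_bound(1)[OF m'])
    qed
    note vf = gauss_velocity_form[OF weight_boundedD(1)[OF f] less_imp_le[OF h(1)], of z, folded v_def]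
    have S_int: "integrable gauss S'" unfolding S'_def using G vf(1) by auto
    have "(\<integral>\<omega>. S' \<omega> \<partial>gauss) = (\<integral>\<omega>. G \<omega> \<partial>gauss) + (\<integral>\<omega>. G (- \<omega>) \<partial>gauss) - 2 * (f z * exp (q z)) - 2 * h * v - 2 * h * gx f (snd z) z"
      unfolding S'_def using G vf by (simp add: gauss.prob_space[simplified])
    also have "(\<integral>\<omega>. G (- \<omega>) \<partial>gauss) = (\<integral>\<omega>. G \<omega> \<partial>gauss)" by (rule gauss_uminus[OF G(1)])
    finally have "(\<integral>\<omega>. S' \<omega> \<partial>gauss) = 2 * ((\<integral>\<omega>. G \<omega> \<partial>gauss) - f z * exp (q z) - h * (gx f (snd z) z + v))"
      by (simp add: algebra_simps)
    also have "gx f (snd z) z + v = exp (q z) * (generator_form f z + f z * zeroth_order z)"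
      unfolding v_def by (rule generator_form_decomp)
    finally have S_eq: "(\<integral>\<omega>. S' \<omega> \<partial>gauss) = 2 * ((\<integral>\<omega>. G \<omega> \<partial>gauss) - exp (q z) * (f z + h * (generator_form f z + f z * zeroth_order z)))"
      by (simp add: algebra_simps)
    have "\<bar>S' \<omega>\<bar> \<le> (C0 * h\<^sup>2 * F * exp (q z) * ?E z) * exp ((norm \<omega>)\<^sup>2 / 4)" for \<omega>
      using strong[OF h f, of z \<omega>] by (simp add: S'_def G_def)
    moreover have "S' \<in> borel_measurable borel" using borel_measurable_integrable[OF S_int] by simp
    ultimately have S_le: "(\<integral>\<omega>. \<bar>S' \<omega>\<bar> \<partial>gauss) \<le> (C0 * h\<^sup>2 * F * exp (q z) * ?E z) * c"
      by (intro gauss_bound(2))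
    have "2 * \<bar>(\<integral>\<omega>. G \<omega> \<partial>gauss) - exp (q z) * (f z + h * (generator_form f z + f z * zeroth_order z))\<bar> = \<bar>\<integral>\<omega>. S' \<omega> \<partial>gauss\<bar>"
      unfolding S_eq by (simp only: abs_mult abs_numeral)
    also have "\<dots> \<le> (\<integral>\<omega>. \<bar>S' \<omega>\<bar> \<partial>gauss)" by (rule integral_abs_bound)
    also note S_le
    finally have "2 * \<bar>(\<integral>\<omega>. G \<omega> \<partial>gauss) - exp (q z) * (f z + h * (generator_form f z + f z * zeroth_order z))\<bar> \<le> (C0 * h\<^sup>2 * F * exp (q z) * ?E z) * c" .
    then have "\<bar>(\<integral>\<omega>. G \<omega> \<partial>gauss) - exp (q z) * (f z + h * (generator_form f z + f z * zeroth_order z))\<bar> \<le> (C0 * h\<^sup>2 * F * exp (q z) * ?E z) * c"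
      by (rule half)
    then show "\<bar>tilted h f z
        - exp (q z) * (f z + h * (generator_form f z + f z * zeroth_order z))\<bar> \<le> C0 * c * h\<^sup>2 * F * exp (q z) * ?E z"
      by (simp add: G_def mult_ac)
  qed
qed

section \<open>Growth of the first-order coefficients and the quotient of expectations\<close>

lemma qv_bound: "\<bar>qv \<xi> z\<bar> \<le> K * (1 + norm z) * norm \<xi>"
  by (cases z) (simp add: S_bounds(8))

lemma qx_bound: "\<bar>qx a z\<bar> \<le> K * (1 + norm z) * norm a"
  by (cases z) (simp add: S_bounds(7))

lemma norm_snd_le': "norm (snd z) \<le> norm (z :: 'n phase)"
  by (cases z) (simp add: norm_snd_le)

text \<open>Linear growth here and quadratic growth of \<open>zeroth_order\<close> produce the
  factor (1 + |z|)^3 in the quotient estimate.\<close>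

lemma generator_form_bound:
  assumes f: "weight_bounded \<theta> F f"
  shows "\<bar>generator_form f z\<bar> \<le> (K + \<gamma> / \<beta> * real CARD('n) * (1 + 2 * K)) * (F * weight \<theta> z * (1 + norm z))"
proof -
  let ?W = "F * weight \<theta> z" and ?p = "1 + norm z"
  have W0: "0 \<le> ?W" using weight_boundedD(2)[OF f] by (simp add: weight_eq)
  have K0: "0 \<le> K" using K_ge_1 by simp
  have b: "\<bar>dir_deriv [(0, b), (0, b)] f z + 2 * dir_deriv [(0, b)] f z * qv b z\<bar> \<le> (1 + 2 * K) * (?W * ?p)"
    if "b \<in> Basis" for b :: "real^'n"
  proof -
    have "(0, b) \<in> (Basis :: 'n phase set)" using that by (simp add: Basis_prod_def)
    then have d: "\<bar>dir_deriv [(0, b)] f z\<bar> \<le> ?W" "\<bar>dir_deriv [(0, b), (0, b)] f z\<bar> \<le> ?W"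
      using weight_boundedD(3)[OF f, of "[(0, b)]" z] weight_boundedD(3)[OF f, of "[(0, b), (0, b)]" z] by simp_all
    have "\<bar>qv b z\<bar> \<le> K * ?p" using qv_bound[of b z] that by simp
    then have "\<bar>dir_deriv [(0, b)] f z * qv b z\<bar> \<le> ?W * (K * ?p)" by (rule abs_mult_le[OF d(1)])
    moreover have "?W \<le> ?W * ?p" using W0 by (simp add: mult_le_cancel_left1)
    ultimately have "\<bar>dir_deriv [(0, b), (0, b)] f z + 2 * (dir_deriv [(0, b)] f z * qv b z)\<bar> \<le> ?W * ?p + 2 * (?W * (K * ?p))"
      using d(2) by linarith
    then show ?thesis by (simp only: algebra_simps)
  qed
  have "\<bar>\<Sum>b\<in>Basis. dir_deriv [(0, b), (0, b)] f z + 2 * dir_deriv [(0, b)] f z * qv b z\<bar>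
      \<le> (\<Sum>b\<in>(Basis :: (real^'n) set). (1 + 2 * K) * (?W * ?p))"
    by (rule order_trans[OF sum_abs sum_mono]) (rule b)
  also have "\<dots> = real CARD('n) * ((1 + 2 * K) * (?W * ?p))" by simp
  finally have 1: "\<bar>\<gamma> / \<beta> * (\<Sum>b\<in>Basis. dir_deriv [(0, b), (0, b)] f z + 2 * dir_deriv [(0, b)] f z * qv b z)\<bar>
      \<le> \<gamma> / \<beta> * (real CARD('n) * ((1 + 2 * K) * (?W * ?p)))"
    using pos by (intro abs_mult_le) simp_all
  have "\<bar>dir_deriv [(snd z, 0)] f z\<bar> \<le> ?W * real DIM('n phase) ^ 1 * prod_list (map norm [(snd z, 0 :: real^'n)])"
    by (rule dir_deriv_bound[OF weight_boundedD(1)[OF f]]) (use weight_boundedD(3)[OF f] in auto)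
  also have "\<dots> = ?W * real DIM('n phase) * norm (snd z)" by (simp add: norm_Pair)
  also have "\<dots> \<le> ?W * K * ?p"
    using DIM_le_K norm_snd_le'[of z]
    by (intro mult_mono[OF mult_left_mono[OF _ W0]] mult_nonneg_nonneg[OF W0 K0]) auto
  finally have 2: "\<bar>dir_deriv [(snd z, 0)] f z\<bar> \<le> ?W * K * ?p" .
  have "\<bar>generator_form f z\<bar> \<le> ?W * K * ?p + \<gamma> / \<beta> * (real CARD('n) * ((1 + 2 * K) * (?W * ?p)))"
    unfolding generator_form_def by (rule order_trans[OF abs_triangle_ineq add_mono[OF 2 1]])
  then show ?thesis by (simp only: algebra_simps)
qed

lemma zeroth_order_bound:
  "\<bar>zeroth_order z\<bar> \<le> (K + \<gamma> / \<beta> * real CARD('n) * (K\<^sup>2 + \<beta>)) * (1 + norm z)\<^sup>2"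
proof -
  let ?p = "1 + norm z"
  have K0: "0 \<le> K" using K_ge_1 by simp
  have p2: "1 \<le> ?p\<^sup>2" by (rule one_le_power) simp
  have b: "\<bar>(qv b z)\<^sup>2 - \<beta> / 2\<bar> \<le> (K\<^sup>2 + \<beta>) * ?p\<^sup>2" if "b \<in> Basis" for b :: "real^'n"
  proof -
    have "\<bar>qv b z\<bar> \<le> K * ?p" using qv_bound[of b z] that by simp
    from power_mono[OF this, of 2] have "(qv b z)\<^sup>2 \<le> K\<^sup>2 * ?p\<^sup>2" by (simp add: power_mult_distrib)
    moreover have "\<beta> / 2 \<le> \<beta> * ?p\<^sup>2"
    proof -
      have "\<beta> / 2 \<le> \<beta> * 1" using pos by simp
      also have "\<dots> \<le> \<beta> * ?p\<^sup>2" using p2 pos by (intro mult_left_mono) auto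
      finally show ?thesis .
    qed
    moreover have "0 \<le> (qv b z)\<^sup>2" "0 < \<beta>" using pos by simp_all
    ultimately have "\<bar>(qv b z)\<^sup>2 - \<beta> / 2\<bar> \<le> K\<^sup>2 * ?p\<^sup>2 + \<beta> * ?p\<^sup>2" by linarith
    then show ?thesis by (simp only: algebra_simps)
  qed
  have "\<bar>\<Sum>b\<in>Basis. (qv b z)\<^sup>2 - \<beta> / 2\<bar> \<le> (\<Sum>b\<in>(Basis :: (real^'n) set). (K\<^sup>2 + \<beta>) * ?p\<^sup>2)"
    by (rule order_trans[OF sum_abs sum_mono]) (rule b)
  also have "\<dots> = real CARD('n) * ((K\<^sup>2 + \<beta>) * ?p\<^sup>2)" by simp
  finally have 1: "\<bar>\<gamma> / \<beta> * (\<Sum>b\<in>Basis. (qv b z)\<^sup>2 - \<beta> / 2)\<bar> \<le> \<gamma> / \<beta> * (real CARD('n) * ((K\<^sup>2 + \<beta>) * ?p\<^sup>2))"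
    using pos by (intro abs_mult_le) simp_all
  have "\<bar>qx (snd z) z\<bar> \<le> K * ?p * norm (snd z)" by (rule qx_bound)
  also have "\<dots> \<le> K * ?p * ?p"
    using K0 norm_snd_le'[of z] by (intro mult_left_mono) auto
  finally have 2: "\<bar>qx (snd z) z\<bar> \<le> K * ?p\<^sup>2" by (simp add: power2_eq_square)
  have "\<bar>zeroth_order z\<bar> \<le> K * ?p\<^sup>2 + \<gamma> / \<beta> * (real CARD('n) * ((K\<^sup>2 + \<beta>) * ?p\<^sup>2))"
    unfolding zeroth_order_def by (rule order_trans[OF abs_triangle_ineq add_mono[OF 2 1]])
  then show ?thesis by (simp only: algebra_simps)
qed

lemma generator_form_one: "generator_form (\<lambda>_. 1) z = 0"
  by (simp add: generator_form_def dir_deriv_const del: foldr_Cons)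

text \<open>With P, Q the two expectations and L, k the first-order coefficients, P - (f + h L) Q is
  O(h^2), since h f k cancels against the expansion of Q. Dividing by Q costs one more growth factor
  exp ((theta + eps) (1 + |z|^2)).\<close>

lemma ratio_expansion:
  assumes \<theta>: "0 \<le> \<theta>" "\<theta> < \<theta>'"
  obtains h0 A where "0 < h0" "h0 \<le> 1" "0 < A"
    "\<And>h z. 0 < h \<Longrightarrow> h \<le> h0 \<Longrightarrow> integrable gauss (\<lambda>\<omega>. exp (q (step h z \<omega>)))"
    "\<And>h z. 0 < h \<Longrightarrow> h \<le> h0 \<Longrightarrow> 0 < normalizer h z"
    "\<And>h z F f. 0 < h \<Longrightarrow> h \<le> h0 \<Longrightarrow> weight_bounded \<theta> F f \<Longrightarrow>
      \<bar>tilted h f z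
        / normalizer h z - f z - h * generator_form f z\<bar>
      \<le> A * h\<^sup>2 * F * ((weight \<theta> z)\<^sup>2 * weight \<theta>' z)"
    "\<And>h z F f. 0 < h \<Longrightarrow> h \<le> h0 \<Longrightarrow> weight_bounded \<theta> F f \<Longrightarrow>
      integrable gauss (\<lambda>\<omega>. f (step h z \<omega>) * exp (q (step h z \<omega>)))"
    "\<And>h z F f. 0 < h \<Longrightarrow> h \<le> h0 \<Longrightarrow> weight_bounded \<theta> F f \<Longrightarrow>
      tilted h (\<lambda>z. \<bar>f z\<bar>) z
        / normalizer h z \<le> A * F * ((weight \<theta> z)\<^sup>2 * weight \<theta>' z)"
    "\<And>z F f. weight_bounded \<theta> F f \<Longrightarrow> \<bar>generator_form f z\<bar> \<le> A * F * ((weight \<theta> z)\<^sup>2 * weight \<theta>' z)"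
proof -
  \<comment> \<open>The gap theta' - theta is cut into four shares: the two factors
    \<open>?E\<close> take one each and the cubic polynomial takes two. The cap 1/4 is for the
    integrability of the noise factor.\<close>
  define \<epsilon> where "\<epsilon> = min ((\<theta>' - \<theta>) / 4) (1 / 4)"
  have \<epsilon>: "0 < \<epsilon>" "\<epsilon> \<le> 1 / 4" "4 * \<epsilon> \<le> \<theta>' - \<theta>" using \<theta> by (auto simp: \<epsilon>_def min_def)
  let ?E = "\<lambda>z::'n phase. exp ((\<theta> + \<epsilon>) * (1 + (norm z)\<^sup>2))"
  obtain h0 C1 where h0: "0 < h0" "h0 \<le> 1" and C1: "0 < C1" and
    wi: "\<And>h z. 0 < h \<Longrightarrow> h \<le> h0 \<Longrightarrow> integrable gauss (\<lambda>\<omega>. weight \<theta> (step h z \<omega>) * exp \<bar>q (step h z \<omega>) - q z\<bar>)" and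
    wb: "\<And>h z. 0 < h \<Longrightarrow> h \<le> h0 \<Longrightarrow> (\<integral>\<omega>. weight \<theta> (step h z \<omega>) * exp \<bar>q (step h z \<omega>) - q z\<bar> \<partial>gauss) \<le> C1 * ?E z" and
    ex: "\<And>h z F f. 0 < h \<Longrightarrow> h \<le> h0 \<Longrightarrow> weight_bounded \<theta> F f \<Longrightarrow>
      \<bar>tilted h f z
        - exp (q z) * (f z + h * (generator_form f z + f z * zeroth_order z))\<bar> \<le> C1 * h\<^sup>2 * F * exp (q z) * ?E z" and
    fi: "\<And>h z F f. 0 < h \<Longrightarrow> h \<le> h0 \<Longrightarrow> weight_bounded \<theta> F f \<Longrightarrow>
      integrable gauss (\<lambda>\<omega>. f (step h z \<omega>) * exp (q (step h z \<omega>)))" and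
    fb: "\<And>h z F f. 0 < h \<Longrightarrow> h \<le> h0 \<Longrightarrow> weight_bounded \<theta> F f \<Longrightarrow>
      tilted h (\<lambda>z. \<bar>f z\<bar>) z \<le> C1 * F * exp (q z) * ?E z"
    by (rule one_step_expansion[OF \<theta>(1) \<epsilon>(1,2)]) (rule that; assumption)
  obtain C2 where C2: "C2 > 0" "\<And>x. x \<ge> 0 \<Longrightarrow> x ^ 3 \<le> C2 * exp (\<epsilon> * x\<^sup>2)"
    using power_le_exp_square[OF \<epsilon>(1), of 3] by auto
  define K2 where "K2 = K + \<gamma> / \<beta> * real CARD('n) * (1 + 2 * K)"
  define K3 where "K3 = K + \<gamma> / \<beta> * real CARD('n) * (K\<^sup>2 + \<beta>)"
  have K23: "0 \<le> K2" "0 \<le> K3"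
    using K_ge_1 pos by (auto simp: K2_def K3_def intro!: add_nonneg_nonneg mult_nonneg_nonneg)
  \<comment> \<open>One \<open>?E\<close> belongs to the remainder, the other to the reciprocal of
    the normaliser, and \<open>weight \<theta>\<close> comes from f. Hence the exponent 3 theta + 4
    eps, which is at most 2 theta + theta'.\<close>
  have total: "?E z * ?E z * weight \<theta> z * (1 + norm z) ^ 3 \<le> C2 * ((weight \<theta> z)\<^sup>2 * weight \<theta>' z)" for z :: "'n phase"
  proof -
    have "(1 + norm z)\<^sup>2 \<le> 2 * (1 + (norm z)\<^sup>2)"
      using zero_le_power2[of "1 - norm z"] by (simp add: power2_eq_square algebra_simps)
    then have "\<epsilon> * (1 + norm z)\<^sup>2 \<le> \<epsilon> * (2 * (1 + (norm z)\<^sup>2))"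
      using \<epsilon> by (intro mult_left_mono) auto
    also have "\<epsilon> * (2 * (1 + (norm z)\<^sup>2)) = 2 * \<epsilon> * (1 + (norm z)\<^sup>2)" by simp
    finally have "exp (\<epsilon> * (1 + norm z)\<^sup>2) \<le> exp (2 * \<epsilon> * (1 + (norm z)\<^sup>2))"
      by (simp only: exp_le_cancel_iff)
    then have "C2 * exp (\<epsilon> * (1 + norm z)\<^sup>2) \<le> C2 * exp (2 * \<epsilon> * (1 + (norm z)\<^sup>2))"
      using C2(1) by (intro mult_left_mono) auto
    then have "(1 + norm z) ^ 3 \<le> C2 * exp (2 * \<epsilon> * (1 + (norm z)\<^sup>2))"
      using C2(2)[of "1 + norm z"] by simp
    then have "?E z * ?E z * weight \<theta> z * (1 + norm z) ^ 3 \<le> ?E z * ?E z * weight \<theta> z * (C2 * exp (2 * \<epsilon> * (1 + (norm z)\<^sup>2)))"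
      by (intro mult_left_mono) (auto simp: weight_eq)
    also have "\<dots> = C2 * exp ((3 * \<theta> + 4 * \<epsilon>) * (1 + (norm z)\<^sup>2))"
      by (simp add: weight_eq exp_add[symmetric] algebra_simps)
    also have "\<dots> \<le> C2 * exp ((2 * \<theta> + \<theta>') * (1 + (norm z)\<^sup>2))"
      using \<epsilon>(3) C2(1) by (simp add: mult_right_mono)
    also have "exp ((2 * \<theta> + \<theta>') * (1 + (norm z)\<^sup>2)) = (weight \<theta> z)\<^sup>2 * weight \<theta>' z"
      by (simp add: weight_eq power2_eq_square exp_add[symmetric] algebra_simps)
    finally show ?thesis .
  qed
  have E1: "1 \<le> ?E z" "1 \<le> weight \<theta> z" "1 \<le> 1 + norm z" "1 \<le> (1 + norm z) ^ 3" for z :: "'n phase"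
    using \<theta> \<epsilon> by (auto intro: weight_ge_1 one_le_power)
  have qi: "integrable gauss (\<lambda>\<omega>. exp (q (step h z \<omega>)))" if "0 < h" "h \<le> h0" for h z
    using fi[OF that weight_bounded_one[OF \<theta>(1)], of z] by simp
  have lower: "exp (q z) / (C1 * ?E z) \<le> normalizer h z" if h: "0 < h" "h \<le> h0" for h z
  proof -
    define B where "B = C1 * ?E z"
    have B: "B > 0" using C1 by (simp add: B_def)
    \<comment> \<open>The AM-HM inequality: \<open>X \<ge> 2 t - t\<^sup>2 / X\<close> with \<open>t = 1 / B\<close>, integrated.\<close>
    have ptw: "2 / B - (1 / B)\<^sup>2 * (weight \<theta> (step h z \<omega>) * exp \<bar>q (step h z \<omega>) - q z\<bar>) \<le> exp (q (step h z \<omega>)) * exp (- q z)" for \<omega>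
    proof -
      define X where "X = exp (q (step h z \<omega>) - q z)"
      have X: "X > 0" by (simp add: X_def)
      have "1 / X = exp (- (q (step h z \<omega>) - q z))"
        unfolding X_def exp_minus by (simp only: inverse_eq_divide)
      also have "\<dots> \<le> 1 * exp \<bar>q (step h z \<omega>) - q z\<bar>" by simp
      \<comment> \<open>Inserting the weight, which is at least 1, makes the integrated bound
        \<open>wb\<close> applicable.\<close>
      also have "\<dots> \<le> weight \<theta> (step h z \<omega>) * exp \<bar>q (step h z \<omega>) - q z\<bar>"
        by (intro mult_right_mono E1) simp
      finally have "(1 / B)\<^sup>2 * (1 / X) \<le> (1 / B)\<^sup>2 * (weight \<theta> (step h z \<omega>) * exp \<bar>q (step h z \<omega>) - q z\<bar>)"
        by (intro mult_left_mono) auto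
      moreover have "2 / B - (1 / B)\<^sup>2 * (1 / X) \<le> X"
      proof -
        have "0 \<le> (X - 1 / B)\<^sup>2 / X" using X by simp
        also have "\<dots> = X - (2 / B - (1 / B)\<^sup>2 * (1 / X))"
          using X B by (simp add: field_simps power2_eq_square)
        finally show ?thesis by simp
      qed
      moreover have "X = exp (q (step h z \<omega>)) * exp (- q z)" by (simp add: X_def exp_diff exp_minus divide_inverse)
      ultimately show ?thesis by linarith
    qed
    have "(\<integral>\<omega>. 2 / B - (1 / B)\<^sup>2 * (weight \<theta> (step h z \<omega>) * exp \<bar>q (step h z \<omega>) - q z\<bar>) \<partial>gauss)
        \<le> (\<integral>\<omega>. exp (q (step h z \<omega>)) * exp (- q z) \<partial>gauss)"
      by (intro integral_mono ptw) (use wi[OF h, of z] qi[OF h, of z] in auto)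
    moreover have "(\<integral>\<omega>. 2 / B - (1 / B)\<^sup>2 * (weight \<theta> (step h z \<omega>) * exp \<bar>q (step h z \<omega>) - q z\<bar>) \<partial>gauss)
        = 2 / B - (1 / B)\<^sup>2 * (\<integral>\<omega>. weight \<theta> (step h z \<omega>) * exp \<bar>q (step h z \<omega>) - q z\<bar> \<partial>gauss)"
      using wi[OF h, of z] by (simp add: gauss.prob_space[simplified])
    moreover have "(1 / B)\<^sup>2 * (\<integral>\<omega>. weight \<theta> (step h z \<omega>) * exp \<bar>q (step h z \<omega>) - q z\<bar> \<partial>gauss) \<le> (1 / B)\<^sup>2 * B"
      using wb[OF h, of z] unfolding B_def by (intro mult_left_mono) auto
    moreover have "(1 / B)\<^sup>2 * B = 1 / B" using B by (simp add: power2_eq_square)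
    ultimately have "1 / B \<le> normalizer h z * exp (- q z)"
      using qi[OF h, of z] by simp
    then have "1 / B * exp (q z) \<le> normalizer h z * exp (- q z) * exp (q z)"
      by (rule mult_right_mono) simp
    then show ?thesis by (simp add: B_def mult.assoc exp_minus)
  qed
  have Qpos: "0 < normalizer h z" if h: "0 < h" "h \<le> h0" for h z
    using less_le_trans[OF _ lower[OF h, of z]] C1 by simp
  have divide_Q: "N / normalizer h z \<le> N * (C1 * ?E z) / exp (q z)"
    if h: "0 < h" "h \<le> h0" and N: "0 \<le> N" for h z N
  proof -
    have "N / normalizer h z \<le> N / (exp (q z) / (C1 * ?E z))"
      using lower[OF h, of z] Qpos[OF h, of z] C1 N by (intro divide_left_mono mult_pos_pos divide_pos_pos) auto
    then show ?thesis by simp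
  qed
  \<comment> \<open>One summand for each use of \<open>absorb\<close>: the quotient error, the bound
    for |f|, the bound for the generator.\<close>
  define A where "A = (1 + C1 * (C1 + C1 + K2 * C1 + K2 * K3) + C1 * C1 + K2) * C2"
  have Cterms: "C1 * (C1 + C1 + K2 * C1 + K2 * K3) * C2 \<le> A" "C1 * C1 * C2 \<le> A" "K2 * C2 \<le> A" "0 < A"
    using C1 C2 K23 by (auto simp: A_def intro!: mult_right_mono mult_pos_pos add_pos_nonneg)
  have absorb: "a * (?E z * ?E z * weight \<theta> z * (1 + norm z) ^ 3) * F \<le> A * F * ((weight \<theta> z)\<^sup>2 * weight \<theta>' z)"
    if "0 \<le> a" "a * C2 \<le> A" "0 \<le> F" for a F and z :: "'n phase"
  proof -
    have "a * (?E z * ?E z * weight \<theta> z * (1 + norm z) ^ 3) * F \<le> a * (C2 * ((weight \<theta> z)\<^sup>2 * weight \<theta>' z)) * F"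
      using that by (intro mult_right_mono mult_left_mono total) auto
    also have "\<dots> = (a * C2) * (((weight \<theta> z)\<^sup>2 * weight \<theta>' z) * F)" by simp
    also have "\<dots> \<le> A * (((weight \<theta> z)\<^sup>2 * weight \<theta>' z) * F)"
      using that by (intro mult_right_mono) (auto simp: weight_eq)
    finally show ?thesis by (simp add: mult_ac)
  qed
  show ?thesis
  proof (rule that[OF h0 Cterms(4) qi Qpos _ fi])
    fix h z F and f :: "'n phase \<Rightarrow> real" assume h: "0 < h" "h \<le> h0" and f: "weight_bounded \<theta> F f"
    have F: "0 \<le> F" by (rule weight_boundedD(2)[OF f])
    define Q where "Q = normalizer h z"
    define P where "P = tilted h f z"
    define e where "e = exp (q z)"
    define E where "E = ?E z"
    define W where "W = weight \<theta> z"
    define p where "p = 1 + norm z"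
    define L where "L = generator_form f z"
    define k where "k = zeroth_order z"
    have ge1: "1 \<le> E" "1 \<le> W" "1 \<le> p" "1 \<le> p ^ 3" "p \<le> p ^ 3"
      using E1[of z] self_le_power[of p 3] by (simp_all add: E_def W_def p_def)
    have e: "e > 0" by (simp add: e_def)
    have h1: "h \<le> 1" using h h0 by simp
    have RP: "\<bar>P - e * (f z + h * (L + f z * k))\<bar> \<le> C1 * h\<^sup>2 * F * e * E"
      using ex[OF h f, of z] by (simp add: P_def e_def E_def L_def k_def)
    have RQ: "\<bar>Q - e * (1 + h * k)\<bar> \<le> C1 * h\<^sup>2 * e * E"
      using ex[OF h weight_bounded_one[OF \<theta>(1)], of z] by (simp add: Q_def e_def E_def k_def generator_form_one)
    have fz: "\<bar>f z\<bar> \<le> F * W" using weight_boundedD(3)[OF f, of "[]" z] by (simp add: W_def)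
    have Lb: "\<bar>L\<bar> \<le> K2 * (F * W * p)"
      using generator_form_bound[OF f, of z] by (simp add: L_def K2_def W_def p_def)
    have kb: "\<bar>k\<bar> \<le> K3 * p\<^sup>2"
      using zeroth_order_bound[of z] by (simp add: k_def K3_def p_def)
    have hL: "\<bar>h * L\<bar> \<le> 1 * (K2 * (F * W * p))"
      by (rule abs_mult_le[OF _ Lb]) (use h h1 in simp)
    have "\<bar>f z + h * L\<bar> \<le> F * W + K2 * (F * W * p)" using fz hL by linarith
    then have t2: "\<bar>(f z + h * L) * (Q - e * (1 + h * k))\<bar> \<le> (F * W + K2 * (F * W * p)) * (C1 * h\<^sup>2 * e * E)"
      by (rule abs_mult_le[OF _ RQ])
    have "\<bar>L * k\<bar> \<le> (K2 * (F * W * p)) * (K3 * p\<^sup>2)" by (rule abs_mult_le[OF Lb kb])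
    then have t3: "\<bar>(h\<^sup>2 * e) * (L * k)\<bar> \<le> (h\<^sup>2 * e) * ((K2 * (F * W * p)) * (K3 * p\<^sup>2))"
      by (rule abs_mult_le[rotated]) (use e in simp)
    define X where "X = h\<^sup>2 * F * e * (E * W * p ^ 3)"
    have X1: "C1 * h\<^sup>2 * F * e * E \<le> C1 * X"
    proof -
      have "E * 1 * 1 \<le> E * W * p ^ 3" using ge1 by (intro mult_mono) auto
      then have "(C1 * (h\<^sup>2 * F * e)) * E \<le> (C1 * (h\<^sup>2 * F * e)) * (E * W * p ^ 3)"
        using C1 F e by (intro mult_left_mono) auto
      then show ?thesis by (simp add: X_def mult_ac)
    qed
    have X2: "(F * W + K2 * (F * W * p)) * (C1 * h\<^sup>2 * e * E) \<le> (C1 + K2 * C1) * X"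
    proof -
      have "F * W \<le> F * W * p ^ 3" "F * W * p \<le> F * W * p ^ 3"
        using mult_left_mono[OF ge1(4), of "F * W"] mult_left_mono[OF ge1(5), of "F * W"] F ge1 by simp_all
      then have "F * W + K2 * (F * W * p) \<le> F * W * p ^ 3 + K2 * (F * W * p ^ 3)"
        by (intro add_mono mult_left_mono[OF _ K23(1)])
      also have "\<dots> = (1 + K2) * (F * W * p ^ 3)" by (simp add: algebra_simps)
      finally have "F * W + K2 * (F * W * p) \<le> (1 + K2) * (F * W * p ^ 3)" .
      then have "(F * W + K2 * (F * W * p)) * (C1 * h\<^sup>2 * e * E) \<le> ((1 + K2) * (F * W * p ^ 3)) * (C1 * h\<^sup>2 * e * E)"
        using C1 e ge1 by (intro mult_right_mono) auto
      also have "\<dots> = (C1 + K2 * C1) * X" by (simp add: X_def algebra_simps)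
      finally show ?thesis .
    qed
    have X3: "(h\<^sup>2 * e) * ((K2 * (F * W * p)) * (K3 * p\<^sup>2)) \<le> (K2 * K3) * X"
    proof -
      have "(h\<^sup>2 * e) * ((K2 * (F * W * p)) * (K3 * p\<^sup>2)) = (K2 * K3 * (h\<^sup>2 * F * e * (W * p ^ 3))) * 1"
        by (simp add: power2_eq_square power3_eq_cube)
      also have "\<dots> \<le> (K2 * K3 * (h\<^sup>2 * F * e * (W * p ^ 3))) * E"
        using ge1 K23 F e by (intro mult_left_mono) auto
      finally show ?thesis by (simp add: X_def mult_ac)
    qed
    \<comment> \<open>The central cancellation: (f + h L) (1 + h k) exceeds f + h (L + f k) by
      exactly h^2 L k, so the two remainders and this product are all that is left.\<close>
    have "P - (f z + h * L) * Q = (P - e * (f z + h * (L + f z * k))) - (f z + h * L) * (Q - e * (1 + h * k)) - (h\<^sup>2 * e) * (L * k)"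
      by (simp add: algebra_simps power2_eq_square)
    then have "\<bar>P - (f z + h * L) * Q\<bar> \<le> C1 * X + (C1 + K2 * C1) * X + (K2 * K3) * X"
      using RP t2 t3 X1 X2 X3 by linarith
    then have N: "\<bar>P - (f z + h * L) * Q\<bar> \<le> (C1 + C1 + K2 * C1 + K2 * K3) * X" by (simp add: algebra_simps)
    have Q: "0 < Q" unfolding Q_def by (rule Qpos[OF h])
    have "\<bar>P / Q - f z - h * L\<bar> = \<bar>P - (f z + h * L) * Q\<bar> / Q"
    proof -
      have "P / Q - f z - h * L = (P - (f z + h * L) * Q) / Q" using Q by (simp add: field_simps)
      then show ?thesis using Q by (simp add: abs_divide)
    qed
    also have "\<dots> \<le> \<bar>P - (f z + h * L) * Q\<bar> * (C1 * E) / e"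
      unfolding Q_def E_def e_def by (rule divide_Q[OF h abs_ge_zero])
    also have "\<dots> \<le> ((C1 + C1 + K2 * C1 + K2 * K3) * X) * (C1 * E) / e"
      using N C1 ge1 e by (intro divide_right_mono mult_right_mono) auto
    also have "\<dots> = (C1 * (C1 + C1 + K2 * C1 + K2 * K3)) * (E * E * W * p ^ 3) * (h\<^sup>2 * F)"
      using e by (simp add: X_def)
    also have "\<dots> \<le> A * (h\<^sup>2 * F) * ((weight \<theta> z)\<^sup>2 * weight \<theta>' z)"
      unfolding E_def W_def p_def by (rule absorb) (use C1 K23 Cterms F in auto)
    finally show "\<bar>tilted h f z
        / normalizer h z - f z - h * generator_form f z\<bar>
      \<le> A * h\<^sup>2 * F * ((weight \<theta> z)\<^sup>2 * weight \<theta>' z)"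
      by (simp add: P_def Q_def L_def mult.assoc)
    have EW: "E * E \<le> E * E * W * p ^ 3"
      using mult_mono[of 1 W 1 "p ^ 3"] ge1 by (simp add: mult.assoc)
    have "tilted h (\<lambda>z. \<bar>f z\<bar>) z / Q
        \<le> tilted h (\<lambda>z. \<bar>f z\<bar>) z * (C1 * E) / e"
      unfolding Q_def E_def e_def by (rule divide_Q[OF h]) simp
    also have "\<dots> \<le> (C1 * F * e * E) * (C1 * E) / e"
      using fb[OF h f, of z] C1 ge1 e unfolding E_def[symmetric] e_def[symmetric]
      by (intro divide_right_mono mult_right_mono) auto
    also have "\<dots> = (C1 * C1) * (E * E) * F" using e by simp
    also have "\<dots> \<le> (C1 * C1) * (E * E * W * p ^ 3) * F"
      using EW C1 F by (intro mult_right_mono mult_left_mono) auto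
    also have "\<dots> \<le> A * F * ((weight \<theta> z)\<^sup>2 * weight \<theta>' z)"
      unfolding E_def W_def p_def by (rule absorb) (use C1 Cterms F in auto)
    finally show "tilted h (\<lambda>z. \<bar>f z\<bar>) z
        / normalizer h z \<le> A * F * ((weight \<theta> z)\<^sup>2 * weight \<theta>' z)"
      by (simp add: Q_def)
  next
    fix z F and f :: "'n phase \<Rightarrow> real" assume f: "weight_bounded \<theta> F f"
    have F: "0 \<le> F" by (rule weight_boundedD(2)[OF f])
    have "1 * 1 * weight \<theta> z * (1 + norm z) \<le> ?E z * ?E z * weight \<theta> z * (1 + norm z) ^ 3"
      using E1[of z] self_le_power[of "1 + norm z" 3] mult_mono[of 1 "?E z" 1 "?E z"]
      by (intro mult_mono) auto
    then have "K2 * (weight \<theta> z * (1 + norm z)) * F \<le> K2 * (?E z * ?E z * weight \<theta> z * (1 + norm z) ^ 3) * F"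
      using K23 F by (intro mult_right_mono mult_left_mono) auto
    also have "\<dots> \<le> A * F * ((weight \<theta> z)\<^sup>2 * weight \<theta>' z)"
      by (rule absorb) (use K23 Cterms F in auto)
    finally show "\<bar>generator_form f z\<bar> \<le> A * F * ((weight \<theta> z)\<^sup>2 * weight \<theta>' z)"
      using generator_form_bound[OF f, of z] unfolding K2_def[symmetric] by (simp add: mult_ac)
  qed
qed

end

subsection \<open>The generator and the bounds on the potential\<close>

text \<open>The generator is defined through functions of x and v separately, the expansion through
  directions in the product space; this identifies the two.\<close>

lemma slice_differentiable:
  fixes f :: "'a::euclidean_space \<times> 'b::euclidean_space \<Rightarrow> real"
  assumes "f differentiable_on UNIV"
  shows "(\<lambda>x. f (x, v)) differentiable_on UNIV" "partial_deriv a (\<lambda>x. f (x, v)) x = partial_deriv (a, 0) f (x, v)"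
    "(\<lambda>v. f (x, v)) differentiable_on UNIV" "partial_deriv b (\<lambda>v. f (x, v)) v = partial_deriv (0, b) f (x, v)"
proof -
  have f: "(f has_derivative frechet_derivative f (at z)) (at z)" for z
    using assms unfolding differentiable_on_def frechet_derivative_works[symmetric] by blast
  have 1: "((\<lambda>x. f (x, v)) has_derivative (\<lambda>a. frechet_derivative f (at (x, v)) (a, 0))) (at x)" for x v
    by (rule has_derivative_compose[where f="\<lambda>x. (x, v)" and g=f, OF _ f]) (auto intro!: derivative_eq_intros)
  have 2: "((\<lambda>v. f (x, v)) has_derivative (\<lambda>b. frechet_derivative f (at (x, v)) (0, b))) (at v)" for x v
    by (rule has_derivative_compose[where f="\<lambda>v. (x, v)" and g=f, OF _ f]) (auto intro!: derivative_eq_intros)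
  show "(\<lambda>x. f (x, v)) differentiable_on UNIV" "(\<lambda>v. f (x, v)) differentiable_on UNIV"
    unfolding differentiable_on_def differentiable_def using 1[where v=v] 2[where x=x] by blast+
  show "partial_deriv a (\<lambda>x. f (x, v)) x = partial_deriv (a, 0) f (x, v)"
    "partial_deriv b (\<lambda>v. f (x, v)) v = partial_deriv (0, b) f (x, v)"
    using partial_deriv_eqI[OF 1] partial_deriv_eqI[OF 2] by (simp_all add: partial_deriv_def)
qed

context potential
begin

lemma kinetic_generator_eq:
  assumes f: "C_k 4 f"
  shows "kinetic_generator V \<gamma> \<beta> f z = generator_form f z"
proof -
  obtain x v where z: "z = (x, v)" by (cases z)
  note d0 = dir_deriv_differentiable[OF f, of "[]", simplified]
  have d1: "partial_deriv u f differentiable_on UNIV" for u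
    using dir_deriv_differentiable[OF f, of "[u]"] by simp
  let ?U = "grad V x + \<gamma> *\<^sub>R v"
  have 1: "v \<bullet> grad (\<lambda>x'. f (x', v)) x = dir_deriv [(v, 0)] f z"
    by (simp add: inner_grad slice_differentiable d0 z)
  have 2: "laplacian (\<lambda>v'. f (x, v')) v = (\<Sum>b\<in>Basis. dir_deriv [(0, b), (0, b)] f z)"
    unfolding laplacian_def slice_differentiable(4)[OF d0, abs_def] slice_differentiable(4)[OF d1] by (simp add: z)
  have "?U \<bullet> grad (\<lambda>v'. f (x, v')) v = (\<Sum>b\<in>Basis. (?U \<bullet> b) * dir_deriv [(0, b)] f z)"
    by (subst inner_grad) (simp_all add: partial_deriv_basis_sum[OF slice_differentiable(3)[OF d0], of ?U] slice_differentiable d0 z)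
  also have "\<dots> = - (\<gamma> / \<beta> * (\<Sum>b\<in>Basis. 2 * dir_deriv [(0, b)] f z * qv b z))"
    unfolding sum_distrib_left sum_negf[symmetric]
  proof (rule sum.cong[OF refl])
    fix b :: "real^'n" assume "b \<in> Basis"
    have "dir_deriv [b] V x = b \<bullet> grad V x"
      using inner_grad[OF dir_deriv_differentiable[OF V, of "[]", simplified], of b x] by simp
    \<comment> \<open>The velocity gradient of log psi is proportional to the drift; the cross term
      of \<open>phi_ki\<close> supplies the part with grad V.\<close>
    then have "qv b z = - (\<beta> / (2 * \<gamma>)) * (?U \<bullet> b)"
      using pos unfolding z qv_def prod.case by (simp add: inner_add_left inner_add_right inner_commute field_simps del: foldr_Cons)
    then show "(?U \<bullet> b) * dir_deriv [(0, b)] f z = - (\<gamma> / \<beta> * (2 * dir_deriv [(0, b)] f z * qv b z))"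
      using pos by simp
  qed
  finally have 3: "?U \<bullet> grad (\<lambda>v'. f (x, v')) v = - (\<gamma> / \<beta> * (\<Sum>b\<in>Basis. 2 * dir_deriv [(0, b)] f z * qv b z))" .
  have "kinetic_generator V \<gamma> \<beta> f z = v \<bullet> grad (\<lambda>x'. f (x', v)) x + \<gamma> / \<beta> * laplacian (\<lambda>v'. f (x, v')) v
      - ?U \<bullet> grad (\<lambda>v'. f (x, v')) v"
    by (simp add: kinetic_generator_def D0_def drift_def z)
  also have "\<dots> = generator_form f z"
    unfolding 1 2 3 generator_form_def by (simp add: z sum.distrib distrib_left del: foldr_Cons)
  finally show ?thesis .
qed

lemma generator_form_measurable:
  assumes f: "C_k 4 f"
  shows "generator_form f \<in> borel_measurable borel"
proof -
  have c: "continuous_on UNIV (\<lambda>z. dir_deriv us f z)" if "length us \<le> 4" for us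
    using C_k_continuous[OF C_k_dir_deriv[OF f that]] .
  have e: "dir_deriv [(snd z, 0)] f z = (\<Sum>b\<in>Basis. ((snd z, 0) \<bullet> b) * dir_deriv [b] f z)" for z
    using dir_deriv_basis_sum[OF f, of "[]" "(snd z, 0)" z] by simp
  have "continuous_on UNIV (\<lambda>z::'n phase. dir_deriv [b] V (fst z))" for b
    using C_k_continuous[OF C_k_dir_deriv[OF V, of "[b]"]]
    by (auto intro!: continuous_on_compose2[OF _ continuous_on_fst[OF continuous_on_id]])
  then have qc: "continuous_on UNIV (qv b)" for b
    unfolding qv_def case_prod_beta by (intro continuous_on_divide continuous_on_minus continuous_on_add continuous_on_mult
      continuous_on_inner continuous_on_snd continuous_on_id continuous_on_const; simp)
  have "continuous_on UNIV (\<lambda>z. dir_deriv [(snd z, 0)] f z)"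
    unfolding e by (intro continuous_on_sum continuous_on_mult continuous_on_inner continuous_on_Pair continuous_on_snd
      continuous_on_id continuous_on_const c; simp)
  moreover have "continuous_on UNIV (\<lambda>z. \<gamma> / \<beta> * (\<Sum>b\<in>Basis. dir_deriv [(0, b), (0, b)] f z + 2 * dir_deriv [(0, b)] f z * qv b z))"
    by (intro continuous_on_sum continuous_on_mult continuous_on_add continuous_on_const c qc; simp)
  ultimately have "continuous_on UNIV (generator_form f)"
    unfolding generator_form_def by (rule continuous_on_add)
  then show ?thesis by (rule borel_measurable_continuous_onI)
qed

end

lemma basis_list2:
  assumes "set bs \<subseteq> (Basis :: (real^'n) set)" "length bs = 2"
  obtains i j where "bs = [axis i 1, axis j 1]"
proof -
  obtain a b where "bs = [a, b]" using assms(2) by (metis One_nat_def Suc_1 length_0_conv length_Suc_conv)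
  moreover have "\<exists>i. c = axis i 1" if "c \<in> (Basis :: (real^'n) set)" for c
    using that by (auto simp: Basis_vec_def)
  ultimately show ?thesis using assms(1) that by (metis insert_subset list.simps(15))
qed

text \<open>The gradient bound follows from the Hessian bound by the mean value theorem from the
  origin. There are finitely many multi-indices of order three, and since their constants and
  exponents are nonnegative, the sums serve as common ones.\<close>

lemma potential_exists:
  fixes V :: "real^'n \<Rightarrow> real"
  assumes pos: "\<gamma> > 0" "\<beta> > 0" "l > 0"
    and V: "C_k 3 V"
    and hess: "bounded (range (hessian V))"
    and third: "\<forall>\<mu>. set_mset \<mu> \<subseteq> Basis \<and> size \<mu> = 3 \<longrightarrow>
           (\<exists>C\<ge>0. \<exists>m\<ge>0. \<forall>x. \<bar>multi_deriv \<mu> V x\<bar> \<le> C * (1 + norm x) powr m)"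
  obtains C M where "potential V \<gamma> \<beta> l C M"
proof -
  let ?D = "real DIM(real^'n)"
  obtain B where B: "\<And>x. norm (hessian V x) \<le> B"
    using hess unfolding bounded_iff by auto
  have B0: "0 \<le> B" using norm_ge_zero B by (rule order_trans)
  have V2: "\<bar>dir_deriv [u, v] V x\<bar> \<le> (B * ?D ^ 2) * norm u * norm v" for u v x
  proof -
    have "\<bar>dir_deriv [u, v] V x\<bar> \<le> B * ?D ^ 2 * prod_list (map norm [u, v])"
    proof (rule dir_deriv_bound[OF V])
      fix bs assume "set bs \<subseteq> (Basis :: (real^'n) set)" "length bs = 2"
      then obtain i j where bs: "bs = [axis i 1, axis j 1]" by (rule basis_list2)
      have "\<bar>dir_deriv bs V x\<bar> = norm (hessian V x $ i $ j)" by (simp add: bs hessian_def)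
      also have "\<dots> \<le> norm (hessian V x $ i)" by (rule Finite_Cartesian_Product.norm_nth_le)
      also have "\<dots> \<le> norm (hessian V x)" by (rule Finite_Cartesian_Product.norm_nth_le)
      also have "\<dots> \<le> B" by (rule B)
      finally show "\<bar>dir_deriv bs V x\<bar> \<le> B" .
    qed auto
    then show ?thesis by (simp add: mult.assoc)
  qed
  define G where "G = (\<Sum>b\<in>Basis. \<bar>dir_deriv [b] V 0\<bar>)"
  have V1: "\<bar>dir_deriv [u] V x\<bar> \<le> (G * ?D + B * ?D ^ 2) * (1 + norm x) * norm u" for u x
  proof -
    have "\<bar>dir_deriv [u] V 0\<bar> \<le> G * ?D ^ 1 * prod_list (map norm [u])"
    proof (rule dir_deriv_bound[OF V])
      fix bs assume bs: "set bs \<subseteq> (Basis :: (real^'n) set)" "length bs = 1"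
      then obtain b where "bs = [b]" "b \<in> Basis" by (auto simp: length_Suc_conv)
      then show "\<bar>dir_deriv bs V 0\<bar> \<le> G"
        unfolding G_def by (auto intro!: member_le_sum)
    qed auto
    then have 1: "\<bar>dir_deriv [u] V 0\<bar> \<le> G * ?D * norm u" by simp
    obtain t where "dir_deriv [u] V (0 + x) - dir_deriv [u] V 0 = dir_deriv [x, u] V (0 + t *\<^sub>R x)"
      by (rule dir_deriv_MVT[OF V, of "[u]" 0 x]) auto
    then have "\<bar>dir_deriv [u] V x - dir_deriv [u] V 0\<bar> \<le> B * ?D ^ 2 * norm x * norm u"
      using V2[of x u "t *\<^sub>R x"] by simp
    then have "\<bar>dir_deriv [u] V x\<bar> \<le> G * ?D * norm u + B * ?D ^ 2 * norm x * norm u"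
      using 1 by linarith
    also have "\<dots> \<le> (G * ?D + B * ?D ^ 2) * (1 + norm x) * norm u"
    proof -
      have "0 \<le> G * ?D * norm x * norm u" "0 \<le> B * ?D ^ 2 * norm u"
        using B0 by (auto simp: G_def intro!: mult_nonneg_nonneg sum_nonneg)
      then show ?thesis by (simp add: algebra_simps)
    qed
    finally show ?thesis .
  qed
  define \<M> where "\<M> = {\<mu> :: (real^'n) multiset. set_mset \<mu> \<subseteq> Basis \<and> size \<mu> = 3}"
  have fin: "finite \<M>"
    by (rule finite_subset[OF _ finite_multi_indices[of 3]]) (auto simp: \<M>_def multi_indices_def)
  obtain c m where cm: "\<And>\<mu>. \<mu> \<in> \<M> \<Longrightarrow> 0 \<le> c \<mu>" "\<And>\<mu>. \<mu> \<in> \<M> \<Longrightarrow> 0 \<le> m \<mu>"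
    "\<And>\<mu> x. \<mu> \<in> \<M> \<Longrightarrow> \<bar>multi_deriv \<mu> V x\<bar> \<le> c \<mu> * (1 + norm x) powr m \<mu>"
  proof -
    have "\<forall>\<mu>\<in>\<M>. \<exists>C m. 0 \<le> C \<and> 0 \<le> m \<and> (\<forall>x. \<bar>multi_deriv \<mu> V x\<bar> \<le> C * (1 + norm x) powr m)"
      using third unfolding \<M>_def by blast
    then show ?thesis using that by (metis (no_types))
  qed
  \<comment> \<open>Rounding up gives a natural exponent and only enlarges the powers, as 1 + |x| >=
    1.\<close>
  define N where "N = nat \<lceil>\<Sum>\<mu>\<in>\<M>. m \<mu>\<rceil>"
  define H where "H = (\<Sum>\<mu>\<in>\<M>. c \<mu>)"
  have H0: "0 \<le> H" unfolding H_def by (intro sum_nonneg cm)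
  have third': "\<bar>multi_deriv \<mu> V x\<bar> \<le> H * (1 + norm x) ^ N" if "\<mu> \<in> \<M>" for \<mu> x
  proof -
    have "m \<mu> \<le> (\<Sum>\<mu>\<in>\<M>. m \<mu>)" using that fin cm by (intro member_le_sum) auto
    also have "\<dots> \<le> real N" unfolding N_def by (rule real_nat_ceiling_ge)
    finally have "(1 + norm x) powr m \<mu> \<le> (1 + norm x) powr real N" by (intro powr_mono) auto
    also have "\<dots> = (1 + norm x) ^ N"
    proof -
      have "0 < 1 + norm x" using norm_ge_zero[of x] by linarith
      then show ?thesis by (rule powr_realpow)
    qed
    finally have "c \<mu> * (1 + norm x) powr m \<mu> \<le> H * (1 + norm x) ^ N"
      using that fin cm H0 unfolding H_def by (intro mult_mono member_le_sum) auto
    then show ?thesis using cm(3)[OF that, of x] by linarith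
  qed
  have V3: "\<bar>dir_deriv [u, v, w] V x\<bar> \<le> (H * ?D ^ 3) * (1 + norm x) ^ N * norm u * norm v * norm w" for u v w x
  proof -
    have "\<bar>dir_deriv [u, v, w] V x\<bar> \<le> (H * (1 + norm x) ^ N) * ?D ^ 3 * prod_list (map norm [u, v, w])"
    proof (rule dir_deriv_bound[OF V])
      fix bs assume bs: "set bs \<subseteq> (Basis :: (real^'n) set)" "length bs = 3"
      then have "multi_deriv (mset bs) V = dir_deriv bs V" by (intro multi_deriv_mset[OF V]) simp
      then show "\<bar>dir_deriv bs V x\<bar> \<le> H * (1 + norm x) ^ N"
        using third'[of "mset bs" x] bs by (simp add: \<M>_def)
    qed auto
    then show ?thesis by (simp add: mult_ac)
  qed
  define C where "C = (G * ?D + B * ?D ^ 2) + H * ?D ^ 3"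
  have C: "B * ?D ^ 2 \<le> C" "G * ?D + B * ?D ^ 2 \<le> C" "H * ?D ^ 3 \<le> C" "0 \<le> C"
    using B0 H0 by (auto simp: C_def G_def intro!: add_nonneg_nonneg mult_nonneg_nonneg sum_nonneg)
  have "potential V \<gamma> \<beta> l C N"
  proof
    fix u v w x :: "real^'n"
    show "\<bar>dir_deriv [u] V x\<bar> \<le> C * (1 + norm x) * norm u"
      by (rule order_trans[OF V1]) (intro mult_right_mono C; simp)
    show "\<bar>dir_deriv [u, v] V x\<bar> \<le> C * norm u * norm v"
      by (rule order_trans[OF V2]) (intro mult_right_mono C; simp)
    show "\<bar>dir_deriv [u, v, w] V x\<bar> \<le> C * (1 + norm x) ^ N * norm u * norm v * norm w"
      by (rule order_trans[OF V3]) (intro mult_right_mono C; simp)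
  qed (use pos V C in auto)
  then show ?thesis by (rule that)
qed

subsection \<open>Disintegration and the consistency estimate\<close>

lemma G_kernel_measurable2 [measurable (raw)]:
  assumes "f \<in> measurable N borel" "g \<in> measurable N borel"
  shows "(\<lambda>x. G_kernel \<gamma> \<beta> h (f x) (g x)) \<in> borel_measurable N"
  using measurable_compose[OF measurable_Pair[OF assms] G_kernel_measurable] by simp

text \<open>In kernel form the parameter sits in a jointly measurable kernel, so measurability of
  parameter integrals applies.\<close>

lemma gauss_step_measurable:
  fixes g :: "'n::finite phase \<Rightarrow> real"
  assumes pos: "\<gamma> > 0" "\<beta> > 0" "h > 0" and g [measurable]: "g \<in> borel_measurable borel"
  shows "(\<lambda>yw. \<integral>\<omega>. g (kinetic_step \<gamma> \<beta> h yw \<omega>) \<partial>gauss) \<in> borel_measurable borel"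
  unfolding integral_G_kernel[OF pos g, symmetric]
  by (rule lborel.borel_measurable_lebesgue_integral) measurable

context potential
begin

lemma psi_eq': "psi V \<gamma> \<beta> l = (\<lambda>z. exp (q z))"
  by (rule ext) (rule psi_eq)

lemma normalizer_measurable: "h > 0 \<Longrightarrow> normalizer h \<in> borel_measurable borel"
  using pos by (intro gauss_step_measurable) auto

lemma G_op_psi:
  assumes "h > 0" "integrable gauss (\<lambda>\<omega>. exp (q (step h yw \<omega>)))"
  shows "G_op \<gamma> \<beta> h (psi V \<gamma> \<beta> l) yw = ennreal (normalizer h yw)"
  using assms pos unfolding psi_eq'
  by (subst G_op_eq_gauss) (auto intro!: nn_integral_eq_integral)

text \<open>Absolute integrability on the product space is checked with z integrated first, where
  the kernel integral is a Gaussian mean; \<open>dom\<close> is then what remains. The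
  almost-everywhere clause matters because the Bochner integral of a non-integrable function is 0:
  with f = 1 it shows that the values of \<open>K_op\<close> are genuine.\<close>

lemma K_op_Fubini:
  fixes f \<rho> :: "'n phase \<Rightarrow> real"
  assumes h: "h > 0"
    and Z: "\<And>yw. integrable gauss (\<lambda>\<omega>. exp (q (step h yw \<omega>)))" "\<And>yw. 0 < normalizer h yw"
    and f [measurable]: "f \<in> borel_measurable borel"
    and fi: "\<And>yw. integrable gauss (\<lambda>\<omega>. f (step h yw \<omega>) * exp (q (step h yw \<omega>)))"
    and \<rho> [measurable]: "\<rho> \<in> borel_measurable borel" and \<rho>0: "\<And>z. 0 \<le> \<rho> z"
    and dom: "integrable lborel (\<lambda>yw. \<rho> yw * (tilted h (\<lambda>z. \<bar>f z\<bar>) yw / normalizer h yw))"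
  shows "AE z in lborel. integrable lborel (\<lambda>yw. f z * exp (q z) * K_integrand V \<gamma> \<beta> l h \<rho> z yw)"
    "integrable lborel (\<lambda>z. f z * K_op V \<gamma> \<beta> l h \<rho> z)"
    "(\<integral>z. f z * K_op V \<gamma> \<beta> l h \<rho> z \<partial>lborel) =
      (\<integral>yw. \<rho> yw * (tilted h f yw / normalizer h yw) \<partial>lborel)"
proof -
  note [measurable] = normalizer_measurable[OF h]
  \<comment> \<open>G_h psi is finite, so \<open>enn2real\<close> never takes its default value at
    infinity.\<close>
  have Ki: "K_integrand V \<gamma> \<beta> l h \<rho> z yw = G_kernel \<gamma> \<beta> h z yw * (\<rho> yw / normalizer h yw)" for z yw
    using G_op_psi[OF h Z(1), of yw] Z(2)[of yw] by (simp add: K_integrand_def)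
  define H where "H = (\<lambda>yw z. f z * exp (q z) * K_integrand V \<gamma> \<beta> l h \<rho> z yw)"
  have H_alt: "H yw z = (\<rho> yw / normalizer h yw) * (G_kernel \<gamma> \<beta> h z yw * (f z * exp (q z)))" for yw z
    by (simp add: H_def Ki)
  have H_norm: "norm (H yw z) = (\<rho> yw / normalizer h yw) * (G_kernel \<gamma> \<beta> h z yw * (\<bar>f z\<bar> * exp (q z)))" for yw z
    using \<rho>0[of yw] Z(2)[of yw] G_kernel_nonneg[OF pos(2,1), of h z yw] by (simp add: H_alt abs_mult)
  have fa: "(\<lambda>z. f z * exp (q z)) \<in> borel_measurable borel" "(\<lambda>z. \<bar>f z\<bar> * exp (q z)) \<in> borel_measurable borel"
    by measurable
  have HI: "integrable (lborel \<Otimes>\<^sub>M lborel) (case_prod H)"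
  proof (rule lborel_pair.Fubini_integrable)
    show "case_prod H \<in> borel_measurable (lborel \<Otimes>\<^sub>M lborel)"
      unfolding H_alt by measurable
    have "(\<integral>z. norm (case_prod H (yw, z)) \<partial>lborel) =
        \<rho> yw * (tilted h (\<lambda>z. \<bar>f z\<bar>) yw / normalizer h yw)" for yw
      unfolding prod.case H_norm using integral_G_kernel[OF pos(1,2) h fa(2), of yw] by simp
    then show "integrable lborel (\<lambda>yw. \<integral>z. norm (case_prod H (yw, z)) \<partial>lborel)" using dom by simp
    have "integrable lborel (\<lambda>z. case_prod H (yw, z))" for yw
      unfolding prod.case H_alt by (intro integrable_mult_right integrable_G_kernel[OF pos(1,2) h fa(1) fi])
    then show "AE yw in lborel. integrable lborel (\<lambda>z. case_prod H (yw, z))" by simp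
  qed
  have HK: "(\<integral>yw. H yw z \<partial>lborel) = f z * K_op V \<gamma> \<beta> l h \<rho> z" for z
    unfolding H_def K_op_def psi_eq' by (simp add: mult.assoc)
  show "AE z in lborel. integrable lborel (\<lambda>yw. f z * exp (q z) * K_integrand V \<gamma> \<beta> l h \<rho> z yw)"
    using lborel_pair.AE_integrable_snd[OF HI] unfolding H_def .
  show "integrable lborel (\<lambda>z. f z * K_op V \<gamma> \<beta> l h \<rho> z)"
    using lborel_pair.integrable_snd[OF HI] unfolding HK .
  have "(\<integral>z. f z * K_op V \<gamma> \<beta> l h \<rho> z \<partial>lborel) = (\<integral>yw. (\<integral>z. H yw z \<partial>lborel) \<partial>lborel)"
    using lborel_pair.Fubini_integral[OF HI] unfolding HK .
  also have "\<dots> = (\<integral>yw. \<rho> yw * (tilted h f yw / normalizer h yw) \<partial>lborel)"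
    unfolding H_alt using integral_G_kernel[OF pos(1,2) h fa(1)] by simp
  finally show "(\<integral>z. f z * K_op V \<gamma> \<beta> l h \<rho> z \<partial>lborel) =
      (\<integral>yw. \<rho> yw * (tilted h f yw / normalizer h yw) \<partial>lborel)" .
qed

text \<open>Integrates the pointwise quotient estimate against the density; its right-hand side is
  already the weight of the moment.\<close>

lemma consistency_estimate:
  assumes \<theta>: "0 \<le> \<theta>" "\<theta> < \<theta>'"
  obtains h0 A where "0 < h0" "0 < A"
    "\<And>h yw. 0 < h \<Longrightarrow> h \<le> h0 \<Longrightarrow>
      0 < G_op \<gamma> \<beta> h (psi V \<gamma> \<beta> l) yw \<and> G_op \<gamma> \<beta> h (psi V \<gamma> \<beta> l) yw < \<infinity>"
    "\<And>h \<rho>. 0 < h \<Longrightarrow> h \<le> h0 \<Longrightarrow> integrable lborel \<rho> \<Longrightarrow> \<forall>z. 0 \<le> \<rho> z \<Longrightarrow>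
      AE z in lborel. integrable lborel (K_integrand V \<gamma> \<beta> l h \<rho> z)"
    "\<And>f \<rho> h. f \<in> Ck_space 4 (weight \<theta>) \<Longrightarrow> prob_density \<rho> \<Longrightarrow> moment (weight_plus \<theta> \<theta>' 0) \<rho> < \<infinity> \<Longrightarrow>
      0 < h \<Longrightarrow> h \<le> h0 \<Longrightarrow>
      integrable lborel (\<lambda>z. f z * K_op V \<gamma> \<beta> l h \<rho> z) \<and> integrable lborel (\<lambda>z. f z * \<rho> z) \<and>
      integrable lborel (\<lambda>z. kinetic_generator V \<gamma> \<beta> f z * \<rho> z) \<and>
      consistency_residual (K_op V \<gamma> \<beta> l) (kinetic_generator V \<gamma> \<beta>) h f \<rho>
        \<le> A * h\<^sup>2 * enn2real (Ck_norm 4 (weight \<theta>) f) * enn2real (moment (weight_plus \<theta> \<theta>' 0) \<rho>)"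
proof -
  obtain h0 A where h0: "0 < h0" "h0 \<le> 1" and A: "0 < A" and
    Zi: "\<And>h z. 0 < h \<Longrightarrow> h \<le> h0 \<Longrightarrow> integrable gauss (\<lambda>\<omega>. exp (q (step h z \<omega>)))" and
    Zp: "\<And>h z. 0 < h \<Longrightarrow> h \<le> h0 \<Longrightarrow> 0 < normalizer h z" and
    ex: "\<And>h z F f. 0 < h \<Longrightarrow> h \<le> h0 \<Longrightarrow> weight_bounded \<theta> F f \<Longrightarrow>
      \<bar>tilted h f z
        / normalizer h z - f z - h * generator_form f z\<bar>
      \<le> A * h\<^sup>2 * F * ((weight \<theta> z)\<^sup>2 * weight \<theta>' z)" and
    fi: "\<And>h z F f. 0 < h \<Longrightarrow> h \<le> h0 \<Longrightarrow> weight_bounded \<theta> F f \<Longrightarrow>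
      integrable gauss (\<lambda>\<omega>. f (step h z \<omega>) * exp (q (step h z \<omega>)))" and
    fb: "\<And>h z F f. 0 < h \<Longrightarrow> h \<le> h0 \<Longrightarrow> weight_bounded \<theta> F f \<Longrightarrow>
      tilted h (\<lambda>z. \<bar>f z\<bar>) z
        / normalizer h z \<le> A * F * ((weight \<theta> z)\<^sup>2 * weight \<theta>' z)" and
    gb: "\<And>z F f. weight_bounded \<theta> F f \<Longrightarrow> \<bar>generator_form f z\<bar> \<le> A * F * ((weight \<theta> z)\<^sup>2 * weight \<theta>' z)"
    by (rule ratio_expansion[OF \<theta>]) (rule that; assumption)
  show ?thesis
  proof (rule that[OF h0(1) A])
    fix h yw assume h: "0 < h" "h \<le> h0"
    show "0 < G_op \<gamma> \<beta> h (psi V \<gamma> \<beta> l) yw \<and> G_op \<gamma> \<beta> h (psi V \<gamma> \<beta> l) yw < \<infinity>"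
      unfolding G_op_psi[OF h(1) Zi[OF h]] using Zp[OF h] by simp
  next
    fix h and \<rho> :: "'n phase \<Rightarrow> real" assume h: "0 < h" "h \<le> h0" and \<rho>: "integrable lborel \<rho>" "\<forall>z. 0 \<le> \<rho> z"
    have m: "\<rho> \<in> borel_measurable borel" using borel_measurable_integrable[OF \<rho>(1)] by simp
    \<comment> \<open>For f = 1 the dominating function is the density itself, so its integrability
      is the whole condition.\<close>
    have "(\<lambda>yw. \<rho> yw * ((\<integral>\<omega>. \<bar>1::real\<bar> * exp (q (step h yw \<omega>)) \<partial>gauss) / normalizer h yw)) = \<rho>"
      using Zp[OF h] by (auto simp: fun_eq_iff less_imp_neq[symmetric])
    then have "AE z in lborel. integrable lborel (\<lambda>yw. 1 * exp (q z) * K_integrand V \<gamma> \<beta> l h \<rho> z yw)"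
      using \<rho> Zi[OF h] by (intro K_op_Fubini(1)[OF h(1) Zi[OF h] Zp[OF h] _ _ m]) auto
    then show "AE z in lborel. integrable lborel (K_integrand V \<gamma> \<beta> l h \<rho> z)"
      by (rule AE_mp) (auto intro!: AE_I2)
  next
    fix f \<rho> :: "'n phase \<Rightarrow> real" and h
    assume f: "f \<in> Ck_space 4 (weight \<theta> :: 'n phase \<Rightarrow> real)" and \<rho>: "prob_density \<rho>"
      and mom: "moment (weight_plus \<theta> \<theta>' 0) \<rho> < \<infinity>" and h: "0 < h" "h \<le> h0"
    define F where "F = enn2real (Ck_norm 4 (weight \<theta>) f)"
    define \<Omega> where "\<Omega> = (\<lambda>z::'n phase. (weight \<theta> z)\<^sup>2 * weight \<theta>' z)"
    have wf: "weight_bounded \<theta> F f"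
      unfolding weight_bounded_def F_def
      using f Ck_norm_basis_bound[OF f] by (auto simp: Ck_space_def weight_eq)
    have F: "0 \<le> F" by (simp add: F_def)
    have \<rho>i: "integrable lborel \<rho>" and \<rho>0: "\<And>z. 0 \<le> \<rho> z"
      using \<rho> by (auto simp: prob_density_def)
    have \<rho>m [measurable]: "\<rho> \<in> borel_measurable borel" using borel_measurable_integrable[OF \<rho>i] by simp
    have fC: "C_k 4 f" by (rule weight_boundedD(1)[OF wf])
    have fm [measurable]: "f \<in> borel_measurable borel" by (rule continuous_measurable[OF fC])
    note gm [measurable] = generator_form_measurable[OF fC]
    note [measurable] = normalizer_measurable[OF h(1)]
    have [measurable]: "\<Omega> \<in> borel_measurable borel" unfolding \<Omega>_def weight_eq by measurable
    have \<Omega>0: "0 \<le> \<Omega> z" for z by (simp add: \<Omega>_def weight_eq)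
    \<comment> \<open>With exponent 0 the polynomial factor is 1 and the weight reduces to W^2
      W_+.\<close>
    have wp: "weight_plus \<theta> \<theta>' 0 = \<Omega>" by (auto simp: weight_plus_def \<Omega>_def)
    have \<Omega>i: "integrable lborel (\<lambda>z. \<Omega> z * \<rho> z)"
      using mom \<rho>0 \<Omega>0 unfolding moment_def wp by (intro integrableI_nonneg) auto
    have mom_eq: "enn2real (moment (weight_plus \<theta> \<theta>' 0) \<rho>) = (\<integral>z. \<Omega> z * \<rho> z \<partial>lborel)"
      unfolding moment_def wp using \<rho>0 \<Omega>0 by (subst nn_integral_eq_integral[OF \<Omega>i]) (auto intro!: integral_nonneg)
    have dom: "integrable lborel (\<lambda>z. g z * \<rho> z)"
      if [measurable]: "g \<in> borel_measurable borel" and g: "\<And>z. \<bar>g z\<bar> \<le> B * \<Omega> z" for g B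
    proof (rule Bochner_Integration.integrable_bound[of _ "\<lambda>z. B * (\<Omega> z * \<rho> z)"])
      show "AE z in lborel. norm (g z * \<rho> z) \<le> norm (B * (\<Omega> z * \<rho> z))"
      proof (rule AE_I2)
        fix z
        have "norm (g z * \<rho> z) \<le> B * \<Omega> z * \<rho> z"
          using mult_right_mono[OF g \<rho>0, of z] \<rho>0[of z] by (simp add: abs_mult)
        then show "norm (g z * \<rho> z) \<le> norm (B * (\<Omega> z * \<rho> z))"
          by (simp add: mult.assoc)
      qed
    qed (use \<Omega>i in auto)
    have W1: "1 \<le> weight \<theta> z" "1 \<le> weight \<theta>' z" for z :: "'n phase"
      using \<theta> by (auto intro: weight_ge_1)
    have fi1: "integrable lborel (\<lambda>z. f z * \<rho> z)"
    proof (rule dom[OF fm])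
      fix z
      have "\<bar>f z\<bar> \<le> F * weight \<theta> z" using weight_boundedD(3)[OF wf, of "[]" z] by simp
      also have "weight \<theta> z \<le> \<Omega> z"
        using mult_mono[of "weight \<theta> z" "(weight \<theta> z)\<^sup>2" 1 "weight \<theta>' z"] W1[of z] self_le_power[of "weight \<theta> z" 2]
        by (simp add: \<Omega>_def)
      then have "F * weight \<theta> z \<le> F * \<Omega> z" using F by (rule mult_left_mono)
      finally show "\<bar>f z\<bar> \<le> F * \<Omega> z" .
    qed
    have gi: "integrable lborel (\<lambda>z. generator_form f z * \<rho> z)"
      by (rule dom[OF gm, of "A * F"]) (use gb[OF wf] in \<open>simp add: \<Omega>_def\<close>)
    define P where "P = (\<lambda>z. tilted h f z / normalizer h z)"
    have Pm [measurable]: "P \<in> borel_measurable borel"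
      unfolding P_def using gauss_step_measurable[OF pos(1,2) h(1), of "\<lambda>z. f z * exp (q z)"] by measurable
    have am: "(\<lambda>z. tilted h (\<lambda>z. \<bar>f z\<bar>) z / normalizer h z) \<in> borel_measurable borel"
      using gauss_step_measurable[OF pos(1,2) h(1), of "\<lambda>z. \<bar>f z\<bar> * exp (q z)"] by measurable
    have ai: "integrable lborel (\<lambda>z. tilted h (\<lambda>z. \<bar>f z\<bar>) z / normalizer h z * \<rho> z)"
    proof (rule dom[OF am])
      fix z
      show "\<bar>tilted h (\<lambda>z. \<bar>f z\<bar>) z / normalizer h z\<bar> \<le> A * F * \<Omega> z"
        using fb[OF h wf, of z] Zp[OF h, of z] by (simp add: \<Omega>_def)
    qed
    note fub = K_op_Fubini[OF h(1) Zi[OF h] Zp[OF h] fm fi[OF h wf] \<rho>m \<rho>0 ai[unfolded mult.commute[of _ "\<rho> _"]]]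
    have fub3: "(\<integral>z. f z * K_op V \<gamma> \<beta> l h \<rho> z \<partial>lborel) = (\<integral>z. \<rho> z * P z \<partial>lborel)"
      unfolding P_def by (rule fub(3))
    define R where "R = (\<lambda>z. P z - f z - h * generator_form f z)"
    have Rb: "\<bar>R z\<bar> \<le> A * h\<^sup>2 * F * \<Omega> z" for z
      using ex[OF h wf, of z] by (simp add: R_def P_def \<Omega>_def)
    have Ri: "integrable lborel (\<lambda>z. R z * \<rho> z)"
      by (rule dom[OF _ Rb]) (unfold R_def, measurable)
    have Pi: "integrable lborel (\<lambda>z. \<rho> z * P z)"
    proof -
      have "(\<lambda>z. \<rho> z * P z) = (\<lambda>z. R z * \<rho> z + f z * \<rho> z + h * (generator_form f z * \<rho> z))"
        by (auto simp: R_def algebra_simps)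
      then show ?thesis using Ri fi1 gi by simp
    qed
    note ge = kinetic_generator_eq[OF fC]
    have "(\<integral>z. (f z * K_op V \<gamma> \<beta> l h \<rho> z - f z * \<rho> z - h * kinetic_generator V \<gamma> \<beta> f z * \<rho> z) \<partial>lborel)
        = (\<integral>z. f z * K_op V \<gamma> \<beta> l h \<rho> z \<partial>lborel) - (\<integral>z. f z * \<rho> z \<partial>lborel) - h * (\<integral>z. generator_form f z * \<rho> z \<partial>lborel)"
      using fub(2) fi1 gi by (simp add: ge mult.assoc)
    also have "\<dots> = (\<integral>z. R z * \<rho> z \<partial>lborel)"
      unfolding fub3 R_def using Pi fi1 gi by (simp add: algebra_simps)
    finally have "consistency_residual (K_op V \<gamma> \<beta> l) (kinetic_generator V \<gamma> \<beta>) h f \<rho> = \<bar>\<integral>z. R z * \<rho> z \<partial>lborel\<bar>"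
      by (simp add: consistency_residual_def)
    also have "\<dots> \<le> (\<integral>z. \<bar>R z * \<rho> z\<bar> \<partial>lborel)" by (rule integral_abs_bound)
    also have "\<dots> \<le> (\<integral>z. A * h\<^sup>2 * F * (\<Omega> z * \<rho> z) \<partial>lborel)"
    proof (rule integral_mono)
      show "\<bar>R z * \<rho> z\<bar> \<le> A * h\<^sup>2 * F * (\<Omega> z * \<rho> z)" for z
        using mult_right_mono[OF Rb \<rho>0, of z] \<rho>0[of z] by (simp add: abs_mult mult.assoc)
    qed (use Ri \<Omega>i in auto)
    also have "\<dots> = A * h\<^sup>2 * F * enn2real (moment (weight_plus \<theta> \<theta>' 0) \<rho>)"
      by (simp add: mom_eq)
    finally have res: "consistency_residual (K_op V \<gamma> \<beta> l) (kinetic_generator V \<gamma> \<beta>) h f \<rho>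
        \<le> A * h\<^sup>2 * F * enn2real (moment (weight_plus \<theta> \<theta>' 0) \<rho>)" .
    show "integrable lborel (\<lambda>z. f z * K_op V \<gamma> \<beta> l h \<rho> z) \<and> integrable lborel (\<lambda>z. f z * \<rho> z) \<and>
      integrable lborel (\<lambda>z. kinetic_generator V \<gamma> \<beta> f z * \<rho> z) \<and>
      consistency_residual (K_op V \<gamma> \<beta> l) (kinetic_generator V \<gamma> \<beta>) h f \<rho>
        \<le> A * h\<^sup>2 * enn2real (Ck_norm 4 (weight \<theta>) f) * enn2real (moment (weight_plus \<theta> \<theta>' 0) \<rho>)"
      using fub(2) fi1 gi res unfolding ge F_def by blast
  qed
qed

end

text \<open>Dividing the residual by h leaves D h, uniformly over P. Integrability is what allows
  the integral inside the residual to be split.\<close>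

lemma weakly_consistent_of_residual:
  assumes "0 < h0" "0 \<le> D"
    and int: "\<And>\<rho> h. \<rho> \<in> P \<Longrightarrow> 0 < h \<Longrightarrow> h \<le> h0 \<Longrightarrow> integrable lborel (\<lambda>z. f z * K h \<rho> z) \<and>
      integrable lborel (\<lambda>z. f z * \<rho> z) \<and> integrable lborel (\<lambda>z. A f z * \<rho> z)"
    and res: "\<And>\<rho> h. \<rho> \<in> P \<Longrightarrow> 0 < h \<Longrightarrow> h \<le> h0 \<Longrightarrow> consistency_residual K A h f \<rho> \<le> D * h\<^sup>2"
  shows "uniform_limit P (\<lambda>h \<rho>. ((\<integral>z. f z * K h \<rho> z \<partial>lborel) - (\<integral>z. f z * \<rho> z \<partial>lborel)) / h)
     (\<lambda>\<rho>. weak_adjoint A \<rho> f) (at_right 0)"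
proof (rule uniform_limitI)
  let ?Q = "\<lambda>h \<rho>. ((\<integral>z. f z * K h \<rho> z \<partial>lborel) - (\<integral>z. f z * \<rho> z \<partial>lborel)) / h"
  fix e :: real assume e: "0 < e"
  \<comment> \<open>D + 1 avoids a division by zero and yields the strict inequality at the
    end.\<close>
  define b where "b = min h0 (e / (D + 1))"
  have b: "0 < b" "b \<le> h0" "b * (D + 1) \<le> e"
  proof -
    show "0 < b" "b \<le> h0" using assms(1,2) e by (auto simp: b_def)
    have "b * (D + 1) \<le> e / (D + 1) * (D + 1)"
      using assms(2) by (intro mult_right_mono) (auto simp: b_def)
    then show "b * (D + 1) \<le> e" using assms(2) by simp
  qed
  show "\<forall>\<^sub>F h in at_right 0. \<forall>\<rho>\<in>P. dist (?Q h \<rho>) (weak_adjoint A \<rho> f) < e"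
  proof (rule eventually_at_rightI[OF _ b(1)], rule ballI)
    fix h \<rho> assume "h \<in> {0<..<b}" and \<rho>: "\<rho> \<in> P"
    then have h: "0 < h" "h < b" "h \<le> h0" using b by auto
    note i = int[OF \<rho> h(1,3)]
    have "(\<integral>z. (f z * K h \<rho> z - f z * \<rho> z - h * A f z * \<rho> z) \<partial>lborel)
        = (\<integral>z. f z * K h \<rho> z \<partial>lborel) - (\<integral>z. f z * \<rho> z \<partial>lborel) - h * weak_adjoint A \<rho> f"
      using i by (simp add: weak_adjoint_def mult.assoc)
    also have "\<dots> = h * (?Q h \<rho> - weak_adjoint A \<rho> f)"
      using h by (simp add: field_simps)
    finally have "h * dist (?Q h \<rho>) (weak_adjoint A \<rho> f) \<le> D * h\<^sup>2"
      using res[OF \<rho> h(1,3)] h by (simp add: consistency_residual_def dist_real_def abs_mult)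
    then have "dist (?Q h \<rho>) (weak_adjoint A \<rho> f) \<le> D * h"
      using h by (simp add: power2_eq_square)
    also have "D * h < e"
    proof -
      have "D * h \<le> D * b" using h assms(2) by (intro mult_left_mono) auto
      also have "\<dots> < b * (D + 1)" using b(1) by (simp add: algebra_simps)
      finally show ?thesis using b(3) by linarith
    qed
    finally show "dist (?Q h \<rho>) (weak_adjoint A \<rho> f) < e" .
  qed
qed

theorem proposition2p6:
  fixes V :: "real^'n \<Rightarrow> real" and \<gamma> \<beta> l \<theta> \<theta>' :: real
  assumes "\<gamma> > 0" "\<beta> > 0" "l > 0" "0 < \<theta>" "\<theta> < \<theta>'"
    and "C_k 3 V"
    and "bdd_below (range V)"
    and "bounded (range (hessian V))"
    and "\<forall>\<mu>. set_mset \<mu> \<subseteq> Basis \<and> size \<mu> = 3 \<longrightarrow>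
           (\<exists>C\<ge>0. \<exists>m\<ge>0. \<forall>x. \<bar>multi_deriv \<mu> V x\<bar> \<le> C * (1 + norm x) powr m)"
  shows "\<exists>h0>0. \<exists>m::nat.
      (\<forall>h yw. 0 < h \<and> h \<le> h0 \<longrightarrow>
         0 < G_op \<gamma> \<beta> h (psi V \<gamma> \<beta> l) yw \<and> G_op \<gamma> \<beta> h (psi V \<gamma> \<beta> l) yw < \<infinity>) \<and>
      (\<forall>h \<rho>. 0 < h \<and> h \<le> h0 \<and> integrable lborel \<rho> \<and> (\<forall>z. 0 \<le> \<rho> z) \<longrightarrow>
         (AE z in lborel. integrable lborel (K_integrand V \<gamma> \<beta> l h \<rho> z))) \<and>
      (\<forall>T>0. \<exists>hT>0. hT \<le> min h0 T \<and> (\<exists>C>0.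
         \<forall>f\<in>Ck_space 4 (weight \<theta>). \<forall>\<rho>. \<forall>h.
           prob_density \<rho> \<and> moment (weight_plus \<theta> \<theta>' (2 * m)) \<rho> < \<infinity> \<and> 0 < h \<and> h \<le> hT \<longrightarrow>
           integrable lborel (\<lambda>z. f z * K_op V \<gamma> \<beta> l h \<rho> z) \<and>
           integrable lborel (\<lambda>z. f z * \<rho> z) \<and>
           integrable lborel (\<lambda>z. kinetic_generator V \<gamma> \<beta> f z * \<rho> z) \<and>
           consistency_residual (K_op V \<gamma> \<beta> l) (kinetic_generator V \<gamma> \<beta>) h f \<rho>
             \<le> C * h\<^sup>2 * enn2real (Ck_norm 4 (weight \<theta>) f)
                 * enn2real (moment (weight_plus \<theta> \<theta>' (2 * m)) \<rho>))) \<and>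
      (\<forall>P. (\<forall>\<rho>\<in>P. prob_density \<rho>) \<and>
           (\<exists>M::real. \<forall>\<rho>\<in>P. moment (weight_plus \<theta> \<theta>' (2 * m)) \<rho> \<le> ennreal M) \<longrightarrow>
         weakly_consistent (K_op V \<gamma> \<beta> l) (kinetic_generator V \<gamma> \<beta>)
           (Ck_space 4 (weight \<theta>)) P \<and>
         (\<forall>f\<in>Ck_space 4 (weight \<theta>). \<exists>C. \<exists>h1>0. \<forall>\<rho>\<in>P. \<forall>h. 0 < h \<and> h \<le> h1 \<longrightarrow>
            consistency_residual (K_op V \<gamma> \<beta> l) (kinetic_generator V \<gamma> \<beta>) h f \<rho> \<le> C * h\<^sup>2))"
proof -
  obtain C M where "potential V \<gamma> \<beta> l C M"
    using potential_exists[OF assms(1-3,6,8,9)] by blast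
  then interpret potential V \<gamma> \<beta> l C M .
  let ?K = "K_op V \<gamma> \<beta> l" and ?L = "kinetic_generator V \<gamma> \<beta>" and ?\<Omega> = "weight_plus \<theta> \<theta>' 0 :: 'n phase \<Rightarrow> real"
  obtain h0 A where h0: "0 < h0" and A: "0 < A" and
    G: "\<And>h yw. 0 < h \<Longrightarrow> h \<le> h0 \<Longrightarrow>
      0 < G_op \<gamma> \<beta> h (psi V \<gamma> \<beta> l) yw \<and> G_op \<gamma> \<beta> h (psi V \<gamma> \<beta> l) yw < \<infinity>" and
    K: "\<And>h \<rho>. 0 < h \<Longrightarrow> h \<le> h0 \<Longrightarrow> integrable lborel \<rho> \<Longrightarrow> \<forall>z. 0 \<le> \<rho> z \<Longrightarrow>
      AE z in lborel. integrable lborel (K_integrand V \<gamma> \<beta> l h \<rho> z)" and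
    est: "\<And>f \<rho> h. f \<in> Ck_space 4 (weight \<theta>) \<Longrightarrow> prob_density \<rho> \<Longrightarrow> moment ?\<Omega> \<rho> < \<infinity> \<Longrightarrow>
      0 < h \<Longrightarrow> h \<le> h0 \<Longrightarrow>
      integrable lborel (\<lambda>z. f z * ?K h \<rho> z) \<and> integrable lborel (\<lambda>z. f z * \<rho> z) \<and>
      integrable lborel (\<lambda>z. ?L f z * \<rho> z) \<and>
      consistency_residual ?K ?L h f \<rho>
        \<le> A * h\<^sup>2 * enn2real (Ck_norm 4 (weight \<theta>) f) * enn2real (moment ?\<Omega> \<rho>)"
    by (rule consistency_estimate[OF less_imp_le[OF assms(4)] assms(5)]) (rule that; assumption)
  have uniform: "weakly_consistent ?K ?L (Ck_space 4 (weight \<theta>)) P \<and>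
      (\<forall>f\<in>Ck_space 4 (weight \<theta>). \<exists>C. \<exists>h1>0. \<forall>\<rho>\<in>P. \<forall>h. 0 < h \<and> h \<le> h1 \<longrightarrow>
         consistency_residual ?K ?L h f \<rho> \<le> C * h\<^sup>2)"
    if P: "\<forall>\<rho>\<in>P. prob_density \<rho>" and M: "\<forall>\<rho>\<in>P. moment ?\<Omega> \<rho> \<le> ennreal M" for P and M :: real
  proof -
    \<comment> \<open>The uniform moment bound may be negative, in which case \<open>ennreal\<close>
      truncates it to 0.\<close>
    have fin: "moment ?\<Omega> \<rho> < \<infinity>" "enn2real (moment ?\<Omega> \<rho>) \<le> max 0 M" if "\<rho> \<in> P" for \<rho>
    proof -
      have le: "moment ?\<Omega> \<rho> \<le> ennreal (max 0 M)"
        using M that by (auto intro: order_trans ennreal_leI)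
      then show "moment ?\<Omega> \<rho> < \<infinity>" by (rule le_less_trans) simp
      show "enn2real (moment ?\<Omega> \<rho>) \<le> max 0 M"
        using enn2real_mono[OF le] by simp
    qed
    have res: "consistency_residual ?K ?L h f \<rho> \<le> (A * enn2real (Ck_norm 4 (weight \<theta>) f) * max 0 M) * h\<^sup>2"
      if "f \<in> Ck_space 4 (weight \<theta>)" "\<rho> \<in> P" "0 < h" "h \<le> h0" for f \<rho> h
    proof -
      have "consistency_residual ?K ?L h f \<rho>
          \<le> A * h\<^sup>2 * enn2real (Ck_norm 4 (weight \<theta>) f) * enn2real (moment ?\<Omega> \<rho>)"
        using est[of f \<rho> h] that P fin by blast
      also have "\<dots> \<le> A * h\<^sup>2 * enn2real (Ck_norm 4 (weight \<theta>) f) * max 0 M"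
        using fin that A by (intro mult_left_mono) auto
      finally show ?thesis by (simp add: mult_ac)
    qed
    have "uniform_limit P (\<lambda>h \<rho>. ((\<integral>z. f z * ?K h \<rho> z \<partial>lborel) - (\<integral>z. f z * \<rho> z \<partial>lborel)) / h)
        (\<lambda>\<rho>. weak_adjoint ?L \<rho> f) (at_right 0)" if f: "f \<in> Ck_space 4 (weight \<theta>)" for f
    proof (rule weakly_consistent_of_residual[OF h0 _ _ res[OF f]])
      show "0 \<le> A * enn2real (Ck_norm 4 (weight \<theta>) f) * max 0 M" using A by simp
      show "integrable lborel (\<lambda>z. f z * ?K h \<rho> z) \<and> integrable lborel (\<lambda>z. f z * \<rho> z) \<and>
          integrable lborel (\<lambda>z. ?L f z * \<rho> z)" if "\<rho> \<in> P" "0 < h" "h \<le> h0" for \<rho> h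
        using est[OF f _ _ that(2,3)] P fin that by blast
    qed
    then show ?thesis unfolding weakly_consistent_def using res h0 by blast
  qed
  show ?thesis
  proof (rule exI[of _ h0], rule conjI[OF h0], rule exI[of _ "0::nat"], intro conjI allI impI)
    fix T :: real assume T: "0 < T"
    show "\<exists>hT>0. hT \<le> min h0 T \<and> (\<exists>C>0. \<forall>f\<in>Ck_space 4 (weight \<theta>). \<forall>\<rho> h.
        prob_density \<rho> \<and> moment (weight_plus \<theta> \<theta>' (2 * 0)) \<rho> < \<infinity> \<and> 0 < h \<and> h \<le> hT \<longrightarrow>
        integrable lborel (\<lambda>z. f z * ?K h \<rho> z) \<and> integrable lborel (\<lambda>z. f z * \<rho> z) \<and>
        integrable lborel (\<lambda>z. ?L f z * \<rho> z) \<and>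
        consistency_residual ?K ?L h f \<rho>
          \<le> C * h\<^sup>2 * enn2real (Ck_norm 4 (weight \<theta>) f) * enn2real (moment (weight_plus \<theta> \<theta>' (2 * 0)) \<rho>))"
      \<comment> \<open>The same constant serves every T; only the range of step sizes is cut at
        T.\<close>
      using h0 T A est by (intro exI[of _ "min h0 T"] conjI exI[of _ A]) auto
  qed (use h0 G K uniform in auto)
qed

end
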